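(* Let $0<\alpha<1$, $s\ge 0$, $T>0$, and consider the problem $$\mathrm{i}\,\partial_t^\alpha u(t)+Au(t)=0,\quad t\in(0,T),\qquad u(0)=u_0. \tag{P}$$ (i) If $u_0\in H_s$, there exists a unique weak solution $u\in C([0,T];H_s)$ to (P) such that $\partial_t^\alpha u\in C((0,T];H_s)$ and the following estimates hold, with a constant $C>0$ independent of $u_0$ and $t$: $$\|u\|_{C([0,T];H_s)}\le C\|u_0\|_s,\qquad \|\partial_t^\alpha u(t)\|_s\le \frac{C}{t^\alpha}\|u_0\|_s\quad\forall t\in(0,T].$$ (ii) If $u_0\in H_{s+1/2}$, the unique weak solution to (P) satisfies $u\in L^2(0,T;H_{s+1})$, $\partial_t^\alpha u\in L^2(0,T;H_s)$ and, for a constant $C>0$ independent of $u_0$, $$\|u\|_{L^2(0,T;H_{s+1})}+\|\partial_t^\alpha u\|_{L^2(0,T;H_s)}\le C\|u_0\|_{s+1/2}.$$ (iii) If $u_0\in H_{s+1}$, the unique weak solution to (P) satisfies $u\in C([0,T];H_{s+1})$, $\partial_t^\alpha u\in C([0,T];H_s)$ and, for a constant $C>0$ independent of $u_0$, $$\|u\|_{C([0,T];H_{s+1})}+\|\partial_t^\alpha u\|_{C([0,T];H_s)}\le C\|u_0\|_{s+1}.$$ Moreover, the unique weak solution to (P) is given by $$u(t)=\sum_{n=1}^\infty\langle u_0,\varphi_n\rangle E_{\alpha,1}(-\mathrm{i}\lambda_n t^\alpha)\varphi_n.$$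
   Context: $(H,\langle\cdot,\cdot\rangle)$ is a (complex) Hilbert space with norm $\|\cdot\|$; $A:D(A)\subset H\to H$ is a negative-definite self-adjoint operator with compact resolvent. The eigenvalues of $-A$ are $0<\lambda_1\le\lambda_2\le\cdots\to\infty$, with a corresponding Hilbert (orthonormal) basis of eigenvectors $\{\varphi_n\}_{n\ge1}\subset D(A)$. For $s\ge0$, $H_s=\{u\in H:\sum_n\lambda_n^{2s}|\langle u,\varphi_n\rangle|^2<\infty\}$ with $\|u\|_s^2=\sum_n\lambda_n^{2s}|\langle u,\varphi_n\rangle|^2$; thus $H_0=H$, $H_1=D(A)$. Mittag-Leffler function: $E_{\alpha,\beta}(z)=\sum_{k\ge0} z^k/\Gamma(\alpha k+\beta)$, $z\in\mathbb{C}$. Caputo derivative for $0<\alpha<1$: $\partial_t^\alpha u(t)=\frac{1}{\Gamma(1-\alpha)}\int_0^t(t-s)^{-\alpha}\partial_su(s)\,\mathrm{d}s$, whenever the right-hand side is well-defined. Weak solution of (P) for $u_0\in H$: a function $u$ such that (1) $u\in C([0,T];H)$; (2) $\partial_t^\alpha u(t),Au(t)\in H$ for almost all $t\in(0,T)$ and the equation holds in $H$ for almost all $t\in(0,T)$; (3) $\lim_{t\to0^+}\|u(t)-u_0\|=0$. *)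

theory Defs
  imports "HOL-Analysis.Analysis"
begin

section \<open>Complex Hilbert spaces\<close>

text \<open>The complex inner product is linear in its first argument. The norm and the topology are
  those of \<^class>\<open>real_inner\<close>, so that \<^term>\<open>norm x\<close> is the square root of \<open>cinner x x\<close>.\<close>

class chilbert_space = real_inner + banach +
  fixes scaleC :: "complex \<Rightarrow> 'a \<Rightarrow> 'a" (infixr "*\<^sub>C" 75)
    and cinner :: "'a \<Rightarrow> 'a \<Rightarrow> complex"
  assumes scaleC_add_right: "c *\<^sub>C (x + y) = c *\<^sub>C x + c *\<^sub>C y"
    and scaleC_add_left: "(c + d) *\<^sub>C x = c *\<^sub>C x + d *\<^sub>C x"
    and scaleC_scaleC: "c *\<^sub>C (d *\<^sub>C x) = (c * d) *\<^sub>C x"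
    and scaleC_one: "1 *\<^sub>C x = x"
    and scaleR_scaleC: "r *\<^sub>R x = complex_of_real r *\<^sub>C x"
    and cinner_add_left: "cinner (x + y) z = cinner x z + cinner y z"
    and cinner_scaleC_left: "cinner (c *\<^sub>C x) y = c * cinner x y"
    and cinner_commute: "cinner x y = cnj (cinner y x)"
    and inner_eq_Re_cinner: "inner x y = Re (cinner x y)"

global_interpretation complex_vector: vector_space "scaleC :: complex \<Rightarrow> 'a \<Rightarrow> 'a::chilbert_space"
  defines csubspace = complex_vector.subspace
    and cspan = complex_vector.span
  by unfold_locales (simp_all add: scaleC_add_right scaleC_add_left scaleC_scaleC scaleC_one)

instantiation complex :: chilbert_space
begin
definition "scaleC_complex (c :: complex) (x :: complex) = c * x"
definition "cinner_complex (x :: complex) y = x * cnj y"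
instance
  by standard (simp_all add: scaleC_complex_def cinner_complex_def algebra_simps
      scaleR_conv_of_real inner_complex_def)
end

section \<open>Unbounded operators, given by a domain and a map on it\<close>

definition densely_defined_operator :: "'a::chilbert_space set \<Rightarrow> ('a \<Rightarrow> 'a) \<Rightarrow> bool" where
  "densely_defined_operator D A \<longleftrightarrow>
     csubspace D \<and> closure D = UNIV \<and>
     (\<forall>x\<in>D. \<forall>y\<in>D. A (x + y) = A x + A y) \<and>
     (\<forall>c. \<forall>x\<in>D. A (c *\<^sub>C x) = c *\<^sub>C A x)"

text \<open>The pairs \<open>(y, z)\<close> on the left form the graph of the adjoint; it must be that of \<open>A\<close>.\<close>

definition self_adjoint_operator :: "'a::chilbert_space set \<Rightarrow> ('a \<Rightarrow> 'a) \<Rightarrow> bool" where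
  "self_adjoint_operator D A \<longleftrightarrow>
     densely_defined_operator D A \<and>
     (\<forall>y z. (\<forall>x\<in>D. cinner (A x) y = cinner x z) \<longleftrightarrow> y \<in> D \<and> z = A y)"

definition negative_definite_operator :: "'a::chilbert_space set \<Rightarrow> ('a \<Rightarrow> 'a) \<Rightarrow> bool" where
  "negative_definite_operator D A \<longleftrightarrow>
     (\<forall>x\<in>D. x \<noteq> 0 \<longrightarrow> Im (cinner (A x) x) = 0 \<and> Re (cinner (A x) x) < 0)"

definition compact_map :: "('a::metric_space \<Rightarrow> 'b::topological_space) \<Rightarrow> bool" where
  "compact_map R \<longleftrightarrow> (\<forall>S. bounded S \<longrightarrow> compact (closure (R ` S)))"

definition compact_resolvent :: "'a::chilbert_space set \<Rightarrow> ('a \<Rightarrow> 'a) \<Rightarrow> bool" where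
  "compact_resolvent D A \<longleftrightarrow>
     (\<exists>z. bij_betw (\<lambda>x. A x - z *\<^sub>C x) D UNIV \<and>
          compact_map (inv_into D (\<lambda>x. A x - z *\<^sub>C x)))"

text \<open>Eigenvalues (repeated according to multiplicity) and eigenvectors are indexed from \<open>0\<close>,
  so \<open>lam n\<close> and \<open>phi n\<close> stand for $\lambda_{n+1}$ and $\varphi_{n+1}$.\<close>

definition neg_eigenbasis ::
    "'a::chilbert_space set \<Rightarrow> ('a \<Rightarrow> 'a) \<Rightarrow> (nat \<Rightarrow> real) \<Rightarrow> (nat \<Rightarrow> 'a) \<Rightarrow> bool" where
  "neg_eigenbasis D A lam phi \<longleftrightarrow>
     0 < lam 0 \<and> mono lam \<and> filterlim lam at_top sequentially \<and>
     (\<forall>n. phi n \<in> D \<and> - A (phi n) = complex_of_real (lam n) *\<^sub>C phi n) \<and>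
     (\<forall>m n. cinner (phi m) (phi n) = (if m = n then 1 else 0)) \<and>
     closure (cspan (range phi)) = UNIV"

section \<open>The scale of spaces $H_s$ and function spaces with values in it\<close>

definition Hs :: "(nat \<Rightarrow> real) \<Rightarrow> (nat \<Rightarrow> 'a::chilbert_space) \<Rightarrow> real \<Rightarrow> 'a set" where
  "Hs lam phi s = {u. summable (\<lambda>n. lam n powr (2 * s) * (cmod (cinner u (phi n)))\<^sup>2)}"

definition Hs_norm :: "(nat \<Rightarrow> real) \<Rightarrow> (nat \<Rightarrow> 'a::chilbert_space) \<Rightarrow> real \<Rightarrow> 'a \<Rightarrow> real" where
  "Hs_norm lam phi s u = sqrt (\<Sum>n. lam n powr (2 * s) * (cmod (cinner u (phi n)))\<^sup>2)"

text \<open>$f \in C(I; H_s)$, with continuity in the norm of $H_s$.\<close>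

definition Hs_continuous_on ::
    "(nat \<Rightarrow> real) \<Rightarrow> (nat \<Rightarrow> 'a::chilbert_space) \<Rightarrow> real \<Rightarrow> real set \<Rightarrow> (real \<Rightarrow> 'a) \<Rightarrow> bool" where
  "Hs_continuous_on lam phi s I f \<longleftrightarrow>
     (\<forall>t\<in>I. f t \<in> Hs lam phi s) \<and>
     (\<forall>t\<in>I. ((\<lambda>r. Hs_norm lam phi s (f r - f t)) \<longlongrightarrow> 0) (at t within I))"

definition Hs_sup_norm ::
    "(nat \<Rightarrow> real) \<Rightarrow> (nat \<Rightarrow> 'a::chilbert_space) \<Rightarrow> real \<Rightarrow> real \<Rightarrow> (real \<Rightarrow> 'a) \<Rightarrow> real" where
  "Hs_sup_norm lam phi s T f = (SUP t\<in>{0..T}. Hs_norm lam phi s (f t))"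

text \<open>$f \in L^2(0,T; H_s)$ in the sense of Bochner: \<open>f\<close> is almost everywhere the limit, in the
  norm of $H_s$, of $H_s$-valued simple functions (strong measurability), and $\|f\|_s^2$ is
  integrable.\<close>

definition Hs_L2 ::
    "(nat \<Rightarrow> real) \<Rightarrow> (nat \<Rightarrow> 'a::chilbert_space) \<Rightarrow> real \<Rightarrow> real \<Rightarrow> (real \<Rightarrow> 'a) \<Rightarrow> bool" where
  "Hs_L2 lam phi s T f \<longleftrightarrow>
     (\<exists>g. (\<forall>k. simple_function (lebesgue_on {0<..<T}) (g k) \<and>
               g k ` {0<..<T} \<subseteq> Hs lam phi s) \<and>
          (AE t in lebesgue_on {0<..<T}. f t \<in> Hs lam phi s \<and>
             (\<lambda>k::nat. Hs_norm lam phi s (g k t - f t)) \<longlonglongrightarrow> 0)) \<and>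
     integrable (lebesgue_on {0<..<T}) (\<lambda>t. (Hs_norm lam phi s (f t))\<^sup>2)"

definition Hs_L2_norm ::
    "(nat \<Rightarrow> real) \<Rightarrow> (nat \<Rightarrow> 'a::chilbert_space) \<Rightarrow> real \<Rightarrow> real \<Rightarrow> (real \<Rightarrow> 'a) \<Rightarrow> real" where
  "Hs_L2_norm lam phi s T f =
     sqrt (LINT t|lebesgue_on {0<..<T}. (Hs_norm lam phi s (f t))\<^sup>2)"

section \<open>Mittag-Leffler functions and the Caputo derivative\<close>

definition mittag_leffler :: "real \<Rightarrow> real \<Rightarrow> complex \<Rightarrow> complex" where
  "mittag_leffler \<alpha> \<beta> z = (\<Sum>k. z ^ k / complex_of_real (Gamma (\<alpha> * real k + \<beta>)))"

text \<open>\<open>u\<close> is locally absolutely continuous on $(0,t]$ with derivative \<open>u'\<close>: the latter is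
  Bochner integrable on each $[\varepsilon,t]$, and \<open>u\<close> is its indefinite integral.\<close>

definition has_locally_integrable_derivative ::
    "(real \<Rightarrow> 'a::banach) \<Rightarrow> (real \<Rightarrow> 'a) \<Rightarrow> real \<Rightarrow> bool" where
  "has_locally_integrable_derivative u u' t \<longleftrightarrow>
     (\<forall>\<epsilon>\<in>{0<..t}. (\<lambda>s. norm (u' s)) integrable_on {\<epsilon>..t} \<and>
        (\<forall>r\<in>{\<epsilon>..t}. (u' has_integral (u r - u \<epsilon>)) {\<epsilon>..r}))"

text \<open>The integral over $[0,t]$ is the library's gauge integral. It extends the Bochner
  integral and includes convergent improper integrals. The extension is needed: the derivative of
  a solution with data merely in $H$ is in general not Bochner integrable at \<open>0\<close>.\<close>

definition has_caputo_derivative ::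
    "real \<Rightarrow> (real \<Rightarrow> 'a::banach) \<Rightarrow> 'a \<Rightarrow> real \<Rightarrow> bool" where
  "has_caputo_derivative \<alpha> u d t \<longleftrightarrow>
     0 < t \<and>
     (\<exists>u'. has_locally_integrable_derivative u u' t \<and>
           (\<lambda>s. (t - s) powr (- \<alpha>) *\<^sub>R u' s) integrable_on {0..t} \<and>
           d = (1 / Gamma (1 - \<alpha>)) *\<^sub>R integral {0..t} (\<lambda>s. (t - s) powr (- \<alpha>) *\<^sub>R u' s))"

definition caputo_differentiable :: "real \<Rightarrow> (real \<Rightarrow> 'a::banach) \<Rightarrow> real \<Rightarrow> bool" where
  "caputo_differentiable \<alpha> u t \<longleftrightarrow> (\<exists>d. has_caputo_derivative \<alpha> u d t)"

definition caputo_derivative :: "real \<Rightarrow> (real \<Rightarrow> 'a::banach) \<Rightarrow> real \<Rightarrow> 'a" where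
  "caputo_derivative \<alpha> u t = (THE d. has_caputo_derivative \<alpha> u d t)"

section \<open>Weak solutions\<close>

definition weak_solution ::
    "'a::chilbert_space set \<Rightarrow> ('a \<Rightarrow> 'a) \<Rightarrow> real \<Rightarrow> real \<Rightarrow> 'a \<Rightarrow> (real \<Rightarrow> 'a) \<Rightarrow> bool" where
  "weak_solution D A \<alpha> T u0 u \<longleftrightarrow>
     continuous_on {0..T} u \<and>
     (AE t in lebesgue_on {0<..<T}.
        caputo_differentiable \<alpha> u t \<and> u t \<in> D \<and>
        \<i> *\<^sub>C caputo_derivative \<alpha> u t + A (u t) = 0) \<and>
     ((\<lambda>t. norm (u t - u0)) \<longlongrightarrow> 0) (at_right 0)"

text \<open>Solutions are functions on $[0,T]$; their values elsewhere are irrelevant.\<close>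

definition unique_weak_solution ::
    "'a::chilbert_space set \<Rightarrow> ('a \<Rightarrow> 'a) \<Rightarrow> real \<Rightarrow> real \<Rightarrow> 'a \<Rightarrow> (real \<Rightarrow> 'a) \<Rightarrow> bool" where
  "unique_weak_solution D A \<alpha> T u0 u \<longleftrightarrow>
     weak_solution D A \<alpha> T u0 u \<and>
     (\<forall>v. weak_solution D A \<alpha> T u0 v \<longrightarrow> (\<forall>t\<in>{0..T}. v t = u t))"

end

theory Submission
  imports Defs
begin

text \<open>Everything reduces to bounds, uniform in $\lambda > 0$, for the scalar functions
  $y(t) = E_{\alpha,1}(-\mathrm{i}\lambda t^\alpha)$: $|y| \le C$, $|t y'| \le C$ and
  $\lambda t^\alpha |y| \le C$. They are obtained without contour integrals. The power series gives
  the Volterra equation $y = 1 - \mathrm{i}\lambda I^\alpha y$, and since the commutator of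
  $t\,\mathrm{d}/\mathrm{d}t$ and $I^\alpha$ is $\alpha I^\alpha$, also $w = t y'$ and $t w'$ solve
  Volterra equations with the same kernel and with right-hand sides built from the preceding
  functions. The kernel $t^{\alpha-1}$, multiplied by a suitable complex constant, is a superposition
  of exponentials $e^{-prt}$, $r > 0$, along a slanted direction $p$ with $\mathrm{Re}\, p > 0$. Each
  exponential is a kernel of positive type, which bounds the solution of such an equation in
  $L^2(0,T)$ by its right-hand side. The mean square bounds for a function and for its image under
  $t\,\mathrm{d}/\mathrm{d}t$ give the pointwise bounds, and the decay of $y$ follows from
  $-\mathrm{i}\lambda y = \partial_t^\alpha y$ after an integration by parts near $0$.

  For uniqueness, the coefficients of a weak solution satisfy the scalar Caputo equation almost
  everywhere. Integrating that equation against $(t-\tau)^{\alpha-1}$ (Abel inversion) yields the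
  Volterra equation, whose homogeneous version has only the zero solution.\<close>

section \<open>Beta integrals and the growth of the Mittag-Leffler coefficients\<close>

text \<open>The bounds must be uniform in \<lambda>, which runs through the whole spectrum, and in
  the horizon T, because the pointwise bound at time t is read off from the energy on (0,t). Testing
  the Volterra equation with \<open>cnj y\<close> provides both: \<lambda> survives only as a
  positive factor of the kernel form, whose positivity holds on every interval. In the real
  direction, however, positivity says nothing about the mass of |y|^2, which enters with a purely
  imaginary coefficient; only after rotation by a constant with positive imaginary part does the
  form become coercive.

  The second obstacle is t = 0. Uniformly in \<lambda>, the scalar derivative is bounded only by C /
  t, which is not integrable, so absolute convergence of the Caputo integral is lost when the
  coefficients are summed. What stays uniform, by cancellation, is the size of the primitives over
  [0,r]. Hence existence in H works with a primitive that is continuous up to 0, and uniqueness with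
  a cut at \<epsilon> whose remainder is estimated by a mean value theorem rather than by absolute
  values.\<close>

lemma absolutely_integrable_scaleR_continuous:
  fixes h :: "real \<Rightarrow> real" and f :: "real \<Rightarrow> 'b::euclidean_space"
  assumes "h absolutely_integrable_on {a..b}" "continuous_on {a..b} f"
  shows "(\<lambda>s. h s *\<^sub>R f s) absolutely_integrable_on {a..b}"
proof (rule absolutely_integrable_bounded_measurable_product[where h = "\<lambda>x r. r *\<^sub>R x"])
  show "bilinear (\<lambda>(x::'b) r. r *\<^sub>R x)"
    unfolding bilinear_def by (auto intro!: linearI simp: scaleR_right_distrib scaleR_left_distrib)
  show "f \<in> borel_measurable (lebesgue_on {a..b})"
    by (rule continuous_imp_measurable_on_sets_lebesgue) (use assms in auto)
  show "bounded (f ` {a..b})"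
    using assms(2) by (intro compact_imp_bounded compact_continuous_image) auto
qed (use assms in auto)

text \<open>Affine substitution from the unit interval: the two weights contribute a + b - 2 to the
  power of d - c, and the line element contributes 1.\<close>

lemma has_integral_Beta_Icc:
  fixes a b c d :: real
  assumes "0 < a" "0 < b" "c < d"
  shows "((\<lambda>s. (s - c) powr (a - 1) * (d - s) powr (b - 1)) has_integral
          (d - c) powr (a + b - 1) * Beta a b) {c..d}"
proof -
  define m where "m = 1 / (d - c)"
  have m: "m > 0" using assms by (simp add: m_def)
  have "((\<lambda>t. t powr (a - 1) * (1 - t) powr (b - 1)) has_integral Beta a b) (cbox 0 1)"
    using has_integral_Beta_real[OF assms(1,2)] by simp
  note I = has_integral_affinity'[OF this m, of "- c * m"]
  have E: "(0 - (- c * m)) /\<^sub>R m = c" "(1 - (- c * m)) /\<^sub>R m = d" "Beta a b /\<^sub>R m ^ DIM(real) = Beta a b * (d - c)"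
    using m assms(3) by (simp_all add: m_def field_simps)
  have *: "((\<lambda>x. (m * x - c * m) powr (a - 1) * (1 - (m * x - c * m)) powr (b - 1)) has_integral
      Beta a b * (d - c)) {c..d}"
    using I unfolding E by simp
  have "((\<lambda>x. (d - c) powr (a + b - 2) * ((m * x - c * m) powr (a - 1) * (1 - (m * x - c * m)) powr (b - 1)))
      has_integral (d - c) powr (a + b - 2) * (Beta a b * (d - c))) {c..d}"
    by (rule has_integral_mult_right[OF *])
  also have "(d - c) powr (a + b - 2) * (Beta a b * (d - c)) = ((d - c) powr (a + b - 2) * (d - c) powr 1) * Beta a b"
    using assms(3) by simp
  also have "\<dots> = (d - c) powr (a + b - 1) * Beta a b"
    unfolding powr_add[symmetric] by simp
  finally show ?thesis
  proof (rule has_integral_eq[rotated])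
    fix x assume x: "x \<in> {c..d}"
    have "1 = (d - c) * m" using assms(3) by (simp add: m_def)
    then have 0: "1 - (m * x - c * m) = (d - x) * m" by (simp add: algebra_simps)
    have 1: "m * x - c * m = (x - c) / (d - c)" "1 - (m * x - c * m) = (d - x) / (d - c)"
      unfolding 0 by (simp_all add: m_def diff_divide_distrib)
    have "(d - c) powr (a + b - 2) = (d - c) powr (a - 1) * (d - c) powr (b - 1)"
      by (simp add: powr_add[symmetric])
    then show "(d - c) powr (a + b - 2) * ((m * x - c * m) powr (a - 1) * (1 - (m * x - c * m)) powr (b - 1))
        = (x - c) powr (a - 1) * (d - x) powr (b - 1)"
      unfolding 1(2) unfolding 1(1) using x assms(3) by (simp add: powr_divide)
  qed
qed

lemma absolutely_integrable_Beta_Icc: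
  fixes a b c d :: real
  assumes "0 < a" "0 < b"
  shows "(\<lambda>s. (s - c) powr (a - 1) * (d - s) powr (b - 1)) absolutely_integrable_on {c..d}"
proof (cases "c < d")
  case True
  then show ?thesis
    using has_integral_Beta_Icc[OF assms, of c d]
    by (intro nonnegative_absolutely_integrable_1) (auto simp: integrable_on_def)
next
  case False
  then have "negligible {c..d}" by (cases "c = d") auto
  then show ?thesis by (rule absolutely_integrable_negligible)
qed

lemma has_integral_powr_Icc:
  fixes b c d :: real
  assumes "0 < b" "c \<le> d"
  shows "((\<lambda>s. (d - s) powr (b - 1)) has_integral (d - c) powr b / b) {c..d}"
proof -
  have "((\<lambda>s. (d - s) powr (b - 1)) has_integral (- ((d - d) powr b / b) - (- ((d - c) powr b / b)))) {c..d}"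
  proof (rule fundamental_theorem_of_calculus_interior)
    show "continuous_on {c..d} (\<lambda>s. - ((d - s) powr b / b))"
      using assms by (intro continuous_intros continuous_on_powr') auto
  next
    fix s assume "s \<in> {c<..<d}"
    then show "((\<lambda>s. - ((d - s) powr b / b)) has_vector_derivative (d - s) powr (b - 1)) (at s)"
      unfolding has_real_derivative_iff_has_vector_derivative[symmetric]
      using assms by (auto intro!: derivative_eq_intros simp: powr_diff)
  qed (use assms in auto)
  then show ?thesis using assms by simp
qed

lemma absolutely_integrable_powr_Icc:
  fixes b c d :: real
  assumes "0 < b"
  shows "(\<lambda>s. (d - s) powr (b - 1)) absolutely_integrable_on {c..d}"
proof (cases "c \<le> d")
  case True
  then show ?thesis
    using has_integral_powr_Icc[OF assms]
    by (intro nonnegative_absolutely_integrable_1) (auto simp: integrable_on_def)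
qed auto

text \<open>Integration term by term, dominated by the weight times
  \<open>cmod (q k) * (t powr \<alpha>) ^ k\<close>; each term is a Beta integral once the power of
  \<open>s\<close> is merged into the left exponent. The case \<gamma> = 1, \<beta> = \<alpha> is
  the fractional integral of a Mittag-Leffler series, the case \<gamma> = \<alpha>, \<beta> = 1 -
  \<alpha> the Caputo integral of its derivative.\<close>

lemma has_integral_weighted_power_series:
  fixes q :: "nat \<Rightarrow> complex" and \<alpha> \<beta> \<gamma> t :: real
  assumes "0 < \<alpha>" "0 < \<beta>" "0 < \<gamma>" "0 < t"
    and sq: "summable (\<lambda>k. cmod (q k) * (t powr \<alpha>) ^ k)"
  defines "F \<equiv> \<lambda>s. (s powr (\<gamma> - 1) * (t - s) powr (\<beta> - 1)) *\<^sub>R (\<Sum>k. q k * complex_of_real (s powr \<alpha>) ^ k)"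
  shows "F absolutely_integrable_on {0..t}"
    and "(\<lambda>k. q k * complex_of_real (t powr (\<alpha> * k + \<gamma> + \<beta> - 1) * Beta (\<alpha> * k + \<gamma>) \<beta>)) sums integral {0..t} F"
proof -
  let ?M = "lebesgue_on {0..t}"
  define h where "h = (\<lambda>s. s powr (\<gamma> - 1) * (t - s) powr (\<beta> - 1))"
  define f where "f = (\<lambda>k s. h s *\<^sub>R (q k * complex_of_real (s powr \<alpha>) ^ k))"
  have h0: "h s \<ge> 0" for s by (simp add: h_def)
  have h: "h absolutely_integrable_on {0..t}"
    using absolutely_integrable_Beta_Icc[OF assms(3,2), of 0 t] by (simp add: h_def)
  have cf: "continuous_on {0..t} (\<lambda>s. q k * complex_of_real (s powr \<alpha>) ^ k)" for k
    using assms by (intro continuous_intros continuous_on_powr') auto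
  have fa: "f k absolutely_integrable_on {0..t}" for k
    unfolding f_def by (rule absolutely_integrable_scaleR_continuous[OF h cf])
  have fi: "integrable ?M (f k)" for k
    using fa[of k] by (intro absolutely_integrable_imp_integrable) auto
  have hi: "integrable ?M h"
    using h by (intro absolutely_integrable_imp_integrable) auto
  have bnd: "norm (f k s) \<le> (cmod (q k) * (t powr \<alpha>) ^ k) * h s" if "s \<in> {0..t}" for k s
  proof -
    have "(s powr \<alpha>) ^ k \<le> (t powr \<alpha>) ^ k"
      using that assms by (intro power_mono powr_mono2) auto
    then have "h s * (cmod (q k) * (s powr \<alpha>) ^ k) \<le> h s * (cmod (q k) * (t powr \<alpha>) ^ k)"
      using h0 by (intro mult_left_mono) auto
    then show ?thesis
      using h0 by (simp add: f_def norm_mult norm_power mult_ac)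
  qed
  have sf: "summable (\<lambda>k. norm (f k s))" if "s \<in> {0..t}" for s
    by (rule summable_comparison_test'[OF summable_mult2[OF sq, of "h s"], of 0])
      (use bnd[OF that] in auto)
  have Ff: "F s = (\<Sum>k. f k s)" if "s \<in> {0..t}" for s
  proof -
    have "summable (\<lambda>k. norm (q k * complex_of_real (s powr \<alpha>) ^ k))"
    proof (rule summable_comparison_test'[OF sq, of 0])
      fix k
      have "(s powr \<alpha>) ^ k \<le> (t powr \<alpha>) ^ k"
        using that assms by (intro power_mono powr_mono2) auto
      then show "norm (norm (q k * complex_of_real (s powr \<alpha>) ^ k)) \<le> cmod (q k) * (t powr \<alpha>) ^ k"
        by (simp add: norm_mult norm_power mult_left_mono)
    qed
    from summable_norm_cancel[OF this] show ?thesis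
      unfolding F_def f_def h_def by (rule suminf_scaleR_right)
  qed
  have ae: "AE s in ?M. summable (\<lambda>k. norm (f k s))"
    using sf by (intro AE_I2) auto
  have sn: "summable (\<lambda>k. \<integral>s. norm (f k s) \<partial>?M)"
  proof (rule summable_comparison_test'[OF summable_mult2[OF sq, of "\<integral>s. h s \<partial>?M"], of 0])
    fix k
    have "(\<integral>s. norm (f k s) \<partial>?M) \<le> (\<integral>s. (cmod (q k) * (t powr \<alpha>) ^ k) * h s \<partial>?M)"
      using bnd by (intro integral_mono integrable_norm fi integrable_mult_right hi) auto
    then show "norm (\<integral>s. norm (f k s) \<partial>?M) \<le> cmod (q k) * (t powr \<alpha>) ^ k * (\<integral>s. h s \<partial>?M)"
      by simp
  qed
  have 1: "integrable ?M (\<lambda>s. \<Sum>k. f k s)"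
    by (rule integrable_suminf[OF fi ae sn])
  have FM: "integrable ?M F"
    using 1 by (rule Bochner_Integration.integrable_cong[THEN iffD1, rotated -1]) (use Ff in auto)
  then show FA: "F absolutely_integrable_on {0..t}"
    by (simp add: integrable_restrict_space set_integrable_def)
  have "integral\<^sup>L ?M (f k) = q k * complex_of_real (t powr (\<alpha> * k + \<gamma> + \<beta> - 1) * Beta (\<alpha> * k + \<gamma>) \<beta>)" for k
  proof -
    have "((\<lambda>s. (s - 0) powr (\<alpha> * k + \<gamma> - 1) * (t - s) powr (\<beta> - 1)) has_integral
            (t - 0) powr (\<alpha> * k + \<gamma> + \<beta> - 1) * Beta (\<alpha> * k + \<gamma>) \<beta>) {0..t}"
      by (rule has_integral_Beta_Icc) (use assms in \<open>auto intro!: add_nonneg_pos\<close>)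
    then have "((\<lambda>s. q k * complex_of_real (s powr (\<alpha> * k + \<gamma> - 1) * (t - s) powr (\<beta> - 1))) has_integral
            q k * complex_of_real (t powr (\<alpha> * k + \<gamma> + \<beta> - 1) * Beta (\<alpha> * k + \<gamma>) \<beta>)) {0..t}"
      by (intro has_integral_mult_right has_integral_of_real) simp
    then have "(f k has_integral
            q k * complex_of_real (t powr (\<alpha> * k + \<gamma> + \<beta> - 1) * Beta (\<alpha> * k + \<gamma>) \<beta>)) {0..t}"
    proof (rule has_integral_eq[rotated])
      fix s assume s: "s \<in> {0..t}"
      show "q k * complex_of_real (s powr (\<alpha> * k + \<gamma> - 1) * (t - s) powr (\<beta> - 1)) = f k s"
      proof (cases "s = 0")
        case False
        then have "s powr (\<alpha> * k + \<gamma> - 1) = s powr (\<gamma> - 1) * (s powr \<alpha>) ^ k"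
          using s by (simp add: powr_power powr_add[symmetric] mult.commute algebra_simps)
        then show ?thesis
          by (simp add: f_def h_def scaleR_conv_of_real)
      qed (simp add: f_def h_def)
    qed
    then show ?thesis
      using lebesgue_integral_eq_integral[OF fi[of k]] by (simp add: integral_unique)
  qed
  moreover have "integral\<^sup>L ?M (\<lambda>s. \<Sum>k. f k s) = integral {0..t} F"
  proof -
    have "integral\<^sup>L ?M (\<lambda>s. \<Sum>k. f k s) = integral\<^sup>L ?M F"
      by (rule Bochner_Integration.integral_cong) (use Ff in auto)
    then show ?thesis using lebesgue_integral_eq_integral[OF FM] by simp
  qed
  ultimately show "(\<lambda>k. q k * complex_of_real (t powr (\<alpha> * k + \<gamma> + \<beta> - 1) * Beta (\<alpha> * k + \<gamma>) \<beta>)) sums integral {0..t} F"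
    using sums_integral[OF fi ae sn] by simp
qed

text \<open>Log-convexity between \<open>x + a\<close> and \<open>x + a + 1\<close>, with weights
  \<open>a\<close> and \<open>1 - a\<close> whose combination is \<open>x + 1\<close>. In effect
  \<open>Gamma x / Gamma (x + a)\<close> is at most \<open>(x + a) powr (1 - a) / x\<close>, of
  order \<open>x powr (- a)\<close> for large \<open>x\<close>.\<close>

lemma Gamma_real_add_ge:
  fixes x a :: real
  assumes "0 < x" "0 < a" "a < 1"
  shows "Gamma x * x \<le> Gamma (x + a) * (x + a) powr (1 - a)"
proof -
  have c: "a *\<^sub>R (x + a) + (1 - a) *\<^sub>R (x + a + 1) = x + 1" by (simp add: algebra_simps)
  have "(ln \<circ> Gamma) ((1 - (1 - a)) *\<^sub>R (x + a) + (1 - a) *\<^sub>R (x + a + 1))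
     \<le> (1 - (1 - a)) * (ln \<circ> Gamma) (x + a) + (1 - a) * (ln \<circ> Gamma) (x + a + 1)"
    by (rule convex_onD[OF log_convex_Gamma_real]) (use assms in auto)
  then have "ln (Gamma (x + 1)) \<le> a * ln (Gamma (x + a)) + (1 - a) * ln (Gamma (x + a + 1))"
    using c by simp
  also have "Gamma (x + a + 1) = (x + a) * Gamma (x + a)"
    using assms by (intro Gamma_plus1) (auto dest: nonpos_Ints_nonpos)
  also have "ln ((x + a) * Gamma (x + a)) = ln (x + a) + ln (Gamma (x + a))"
    using assms by (intro ln_mult_pos) (auto intro!: Gamma_real_pos)
  finally have "ln (Gamma (x + 1)) \<le> ln (Gamma (x + a)) + (1 - a) * ln (x + a)"
    by (simp add: algebra_simps)
  also have "\<dots> = ln (Gamma (x + a) * (x + a) powr (1 - a))"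
    using assms Gamma_real_pos[of "x + a"] by (subst ln_mult_pos) (auto simp: ln_powr)
  finally have "Gamma (x + 1) \<le> Gamma (x + a) * (x + a) powr (1 - a)"
    using assms Gamma_real_pos[of "x + a"] Gamma_real_pos[of "x + 1"] by (subst (asm) ln_le_cancel_iff) auto
  also have "Gamma (x + 1) = Gamma x * x"
    using assms by (subst Gamma_plus1) (auto dest: nonpos_Ints_nonpos)
  finally show ?thesis .
qed

lemma summable_mittag_leffler_real:
  fixes \<alpha> x :: real
  assumes "0 < \<alpha>" "\<alpha> < 1" "0 \<le> x"
  shows "summable (\<lambda>k. x ^ k / Gamma (\<alpha> * real k + 1))"
proof -
  have "filterlim (\<lambda>k. \<alpha> * real k + 1) at_top sequentially"
    using filterlim_tendsto_add_at_top[OF tendsto_const[of 1]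
        filterlim_tendsto_pos_mult_at_top[OF tendsto_const assms(1) filterlim_real_sequentially]]
    by (simp add: add.commute)
  \<comment> \<open>This expression bounds the ratio of consecutive terms, with
    \<open>y = \<alpha> * k + 1\<close>; the factor \<open>2 powr (1 - \<alpha>)\<close> comes from
    \<open>y + \<alpha> \<le> 2 * y\<close>, valid as \<open>y \<ge> 1\<close>.\<close>
  then have "((\<lambda>k. x * 2 powr (1 - \<alpha>) * (\<alpha> * real k + 1) powr (- \<alpha>)) \<longlongrightarrow> x * 2 powr (1 - \<alpha>) * 0) sequentially"
    using assms(1) by (intro tendsto_intros tendsto_neg_powr) auto
  then have "\<forall>\<^sub>F k in sequentially. x * 2 powr (1 - \<alpha>) * (\<alpha> * real k + 1) powr (- \<alpha>) < 1/2"
    by (rule order_tendstoD) auto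
  then obtain N :: nat where N: "\<And>k. k \<ge> N \<Longrightarrow> x * 2 powr (1 - \<alpha>) * (\<alpha> * real k + 1) powr (- \<alpha>) < 1/2"
    unfolding eventually_sequentially by blast
  show ?thesis
  proof (rule summable_ratio_test[of "1/2" N])
    fix k assume k: "N \<le> k"
    define y where "y = \<alpha> * k + 1"
    have y: "y > 0" using assms by (auto simp: y_def intro!: add_nonneg_pos)
    have G: "Gamma y > 0" "Gamma (y + \<alpha>) > 0" using y assms by (auto intro!: Gamma_real_pos)
    have y1: "y \<ge> 1" using assms by (simp add: y_def)
    have "Gamma y * y \<le> Gamma (y + \<alpha>) * (y + \<alpha>) powr (1 - \<alpha>)"
      by (rule Gamma_real_add_ge) (use y assms in auto)
    also have "\<dots> \<le> Gamma (y + \<alpha>) * (2 * y) powr (1 - \<alpha>)"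
      using y1 assms G by (intro mult_left_mono powr_mono2) auto
    also have "\<dots> = Gamma (y + \<alpha>) * (2 powr (1 - \<alpha>) * y powr (- \<alpha>)) * y"
      using y by (simp add: powr_mult powr_diff powr_minus field_simps)
    finally have "Gamma y \<le> Gamma (y + \<alpha>) * (2 powr (1 - \<alpha>) * y powr (- \<alpha>))"
      using y by simp
    then have "1 / Gamma (y + \<alpha>) \<le> (2 powr (1 - \<alpha>) * y powr (- \<alpha>)) * (1 / Gamma y)"
      using G by (simp add: divide_simps mult_ac)
    then have "x * (1 / Gamma (y + \<alpha>)) \<le> (x * 2 powr (1 - \<alpha>) * y powr (- \<alpha>)) * (1 / Gamma y)"
      using assms(3) by (metis mult.assoc mult_left_mono)
    also have "\<dots> \<le> (1/2) * (1 / Gamma y)"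
      using N[OF k] G by (intro mult_right_mono) (auto simp: y_def)
    finally have "x ^ k * (x * (1 / Gamma (y + \<alpha>))) \<le> x ^ k * ((1/2) * (1 / Gamma y))"
      using assms(3) by (intro mult_left_mono) auto
    moreover have "\<alpha> * real (Suc k) + 1 = y + \<alpha>" by (simp add: y_def algebra_simps)
    ultimately show "norm (x ^ Suc k / Gamma (\<alpha> * real (Suc k) + 1)) \<le> 1/2 * norm (x ^ k / Gamma (\<alpha> * real k + 1))"
      using G assms(3) by (simp add: y_def[symmetric] abs_mult mult_ac)
  qed simp
qed

section \<open>Weighted Mittag-Leffler series\<close>

text \<open>The weights \<open>1\<close>, \<open>\<alpha> k\<close> and \<open>(\<alpha> k)\<^sup>2\<close> give $y(t) = E_{\alpha,1}(z t^\alpha)$, $t y'$ and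
  $t (t y')'$. The power of $t$ is written as \<open>(t powr \<alpha>) ^ k\<close>, not as \<open>t powr (\<alpha> * k)\<close>, because
  \<open>0 powr 0 = 0\<close>.\<close>

definition ml_series :: "real \<Rightarrow> (nat \<Rightarrow> real) \<Rightarrow> complex \<Rightarrow> real \<Rightarrow> complex" where
  "ml_series \<alpha> b z t = (\<Sum>k. complex_of_real (b k / Gamma (\<alpha> * real k + 1)) * (z * complex_of_real (t powr \<alpha>)) ^ k)"

text \<open>The Riemann-Liouville integral, I^\<alpha> in the overview.\<close>

definition frac_integral :: "real \<Rightarrow> (real \<Rightarrow> complex) \<Rightarrow> real \<Rightarrow> complex" where
  "frac_integral \<alpha> y t = (1 / Gamma \<alpha>) *\<^sub>R integral {0..t} (\<lambda>s. (t - s) powr (\<alpha> - 1) *\<^sub>R y s)"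

lemma ml_series_eq_mittag_leffler: "ml_series \<alpha> (\<lambda>_. 1) z t = mittag_leffler \<alpha> 1 (z * complex_of_real (t powr \<alpha>))"
  by (simp add: ml_series_def mittag_leffler_def divide_inverse mult.commute)

context
  fixes \<alpha> :: real
  assumes \<alpha>: "0 < \<alpha>" "\<alpha> < 1"
begin

lemma Gamma_ml_pos: "Gamma (\<alpha> * real k + 1) > 0"
  using \<alpha> by (intro Gamma_real_pos add_nonneg_pos) auto

text \<open>Geometrically growing weights only replace \<open>x\<close> by \<open>4 * x\<close> in
  an entire series. The base 4 fits the largest weight in use, the square of
  \<open>\<alpha> * k\<close>, which is at most the square of \<open>2 ^ k\<close>.\<close>

lemma summable_ml_series:
  assumes b: "\<And>k. \<bar>b k\<bar> \<le> 4 ^ k"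
  shows "summable (\<lambda>k. norm (complex_of_real (b k / Gamma (\<alpha> * real k + 1)) * x ^ k))"
proof (rule summable_comparison_test'[OF summable_mittag_leffler_real[OF \<alpha>, of "4 * cmod x"], of 0])
  fix k
  have "\<bar>b k\<bar> * cmod x ^ k \<le> 4 ^ k * cmod x ^ k"
    using b by (intro mult_right_mono) auto
  then show "norm (norm (complex_of_real (b k / Gamma (\<alpha> * real k + 1)) * x ^ k)) \<le> (4 * cmod x) ^ k / Gamma (\<alpha> * real k + 1)"
    using Gamma_ml_pos[of k]
    by (simp add: norm_mult norm_divide norm_power power_mult_distrib divide_right_mono)
qed simp

lemma ml_series_sums:
  assumes b: "\<And>k. \<bar>b k\<bar> \<le> 4 ^ k"
  shows "(\<lambda>k. complex_of_real (b k / Gamma (\<alpha> * real k + 1)) * (z * complex_of_real (t powr \<alpha>)) ^ k) sums ml_series \<alpha> b z t"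
  unfolding ml_series_def by (rule summable_sums[OF summable_norm_cancel[OF summable_ml_series[OF b]]])

lemma continuous_on_ml_series:
  assumes b: "\<And>k. \<bar>b k\<bar> \<le> 4 ^ k"
  shows "continuous_on {0..} (ml_series \<alpha> b z)"
proof -
  let ?P = "\<lambda>x. \<Sum>k. complex_of_real (b k / Gamma (\<alpha> * real k + 1)) * x ^ k"
  have "isCont ?P x" for x
    by (rule isCont_powser_converges_everywhere[OF summable_norm_cancel[OF summable_ml_series[OF b]]])
  then have "continuous_on UNIV ?P"
    by (simp add: continuous_on_eq_continuous_at)
  moreover have "continuous_on {0..} (\<lambda>t. z * complex_of_real (t powr \<alpha>))"
    using \<alpha> by (intro continuous_intros continuous_on_powr') auto
  ultimately have "continuous_on {0..} (\<lambda>t. ?P (z * complex_of_real (t powr \<alpha>)))"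
    by (rule continuous_on_compose2) auto
  then show ?thesis by (simp add: ml_series_def[abs_def])
qed

text \<open>With P the power series and x = z t^\<alpha>, the chain rule gives (\<alpha> / t) x
  P'(x), and x P'(x) multiplies the coefficients by k. The base 2 in the hypothesis keeps the new
  weight \<open>\<alpha> * k * b k\<close> below \<open>4 ^ k\<close>.\<close>

lemma has_vector_derivative_ml_series:
  assumes b: "\<And>k. \<bar>b k\<bar> \<le> 2 ^ k" and t: "0 < t"
  shows "(ml_series \<alpha> b z has_vector_derivative (1 / t) *\<^sub>R ml_series \<alpha> (\<lambda>k. \<alpha> * real k * b k) z t) (at t)"
proof -
  define c where "c = (\<lambda>k. complex_of_real (b k / Gamma (\<alpha> * real k + 1)))"
  define P where "P = (\<lambda>x. \<Sum>k. c k * x ^ k)"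
  define P' where "P' = (\<lambda>x. \<Sum>k. diffs c k * x ^ k)"
  define x where "x = z * complex_of_real (t powr \<alpha>)"
  have b4: "\<bar>b k\<bar> \<le> 4 ^ k" for k
    using b[of k] power_mono[of "2::real" 4 k] by linarith
  have sc: "summable (\<lambda>k. c k * y ^ k)" for y
    unfolding c_def by (rule summable_norm_cancel[OF summable_ml_series[OF b4]])
  have dP: "(P has_field_derivative P' y) (at y)" for y
    unfolding P_def P'_def by (rule termdiffs_strong_converges_everywhere[OF sc])
  have "((\<lambda>r. P (z * complex_of_real (r powr \<alpha>))) has_vector_derivative
      z * complex_of_real (\<alpha> * t powr (\<alpha> - 1)) * P' x) (at t)"
  proof -
    have "((\<lambda>r. r powr \<alpha>) has_field_derivative \<alpha> * t powr (\<alpha> - 1)) (at t)"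
      using t by (intro has_real_derivative_powr) auto
    then have "((\<lambda>r. complex_of_real (r powr \<alpha>)) has_vector_derivative complex_of_real (\<alpha> * t powr (\<alpha> - 1))) (at t)"
      by (rule has_vector_derivative_of_real)
    then have "((\<lambda>r. z * complex_of_real (r powr \<alpha>)) has_vector_derivative z * complex_of_real (\<alpha> * t powr (\<alpha> - 1))) (at t)"
      by (rule has_vector_derivative_mult_right)
    from field_vector_diff_chain_at[OF this dP] show ?thesis
      by (simp add: o_def x_def)
  qed
  moreover have "z * complex_of_real (\<alpha> * t powr (\<alpha> - 1)) * P' x = (1 / t) *\<^sub>R (\<alpha> * (x * P' x))"
    using t by (simp add: x_def powr_diff scaleR_conv_of_real)
  moreover have "x * P' x = (\<Sum>k. of_nat k * c k * x ^ k)"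
  proof -
    have "summable (\<lambda>n. diffs c n * x ^ n)"
      by (rule termdiff_converges_all[OF sc])
    from sums_mult[OF diffs_equiv[OF this], of x]
    have 1: "(\<lambda>n. x * (of_nat n * c n * x ^ (n - Suc 0))) sums (x * P' x)"
      by (simp add: P'_def)
    have 2: "(\<lambda>n. x * (of_nat n * c n * x ^ (n - Suc 0))) = (\<lambda>n. of_nat n * c n * x ^ n)"
    proof
      fix n show "x * (of_nat n * c n * x ^ (n - Suc 0)) = of_nat n * c n * x ^ n"
        by (cases n) auto
    qed
    show ?thesis using 1 unfolding 2 by (rule sums_unique)
  qed
  moreover have "\<alpha> * (\<Sum>k. of_nat k * c k * x ^ k) = ml_series \<alpha> (\<lambda>k. \<alpha> * real k * b k) z t"
  proof -
    have "\<bar>\<alpha> * real k * b k\<bar> \<le> 4 ^ k" for k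
    proof -
      have "real k \<le> 2 ^ k" by (metis of_nat_less_two_power less_imp_le)
      then have "(\<alpha> * real k) * \<bar>b k\<bar> \<le> (1 * 2 ^ k) * 2 ^ k"
        using \<alpha> b[of k] by (intro mult_mono) auto
      also have "\<dots> = 4 ^ k" by (simp add: power_mult_distrib[symmetric])
      finally show ?thesis using \<alpha> by (simp add: abs_mult)
    qed
    from ml_series_sums[OF this, of z t]
    have 1: "(\<lambda>k. complex_of_real \<alpha> * (of_nat k * c k * x ^ k)) sums ml_series \<alpha> (\<lambda>k. \<alpha> * real k * b k) z t"
      by (simp add: c_def x_def mult_ac)
    have "(\<lambda>k. of_nat k * c k * x ^ k) sums (ml_series \<alpha> (\<lambda>k. \<alpha> * real k * b k) z t / complex_of_real \<alpha>)"
      using sums_divide[OF 1, of "complex_of_real \<alpha>"] \<alpha> by simp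
    then show ?thesis using \<alpha> by (simp add: sums_iff)
  qed
  ultimately show ?thesis
    by (simp add: P_def c_def ml_series_def[abs_def])
qed

text \<open>The quotient \<open>Beta (\<alpha> * k + 1) \<alpha> / Gamma \<alpha>\<close> replaces
  \<open>Gamma (\<alpha> * k + 1)\<close> by \<open>Gamma (\<alpha> * (k + 1) + 1)\<close>, so
  fractional integration shifts the index by one; the factor \<open>z\<close> supplies the missing
  power.\<close>

lemma ml_series_frac_integral:
  assumes b: "\<And>k. \<bar>b k\<bar> \<le> 4 ^ k" and t: "0 \<le> t"
  shows "z * frac_integral \<alpha> (ml_series \<alpha> b z) t = ml_series \<alpha> (\<lambda>j. if j = 0 then 0 else b (j - 1)) z t"
proof (cases "t = 0")
  case True
  have "ml_series \<alpha> (\<lambda>j. if j = 0 then 0 else b (j - 1)) z 0 = 0"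
  proof -
    have "(\<lambda>k. complex_of_real ((if k = 0 then 0 else b (k - 1)) / Gamma (\<alpha> * real k + 1)) * (z * complex_of_real (0 powr \<alpha>)) ^ k) = (\<lambda>_. 0)"
      by (rule ext) (simp add: power_0_left)
    then show ?thesis unfolding ml_series_def by (simp only: suminf_zero)
  qed
  with True show ?thesis by (simp add: frac_integral_def)
next
  case False
  with t have t: "t > 0" by simp
  define q where "q = (\<lambda>k. complex_of_real (b k / Gamma (\<alpha> * real k + 1)) * z ^ k)"
  have sq: "summable (\<lambda>k. cmod (q k) * (t powr \<alpha>) ^ k)"
    using summable_ml_series[OF b, of "z * complex_of_real (t powr \<alpha>)"]
    by (simp add: q_def norm_mult norm_divide norm_power power_mult_distrib mult_ac)
  have "(\<lambda>k. q k * complex_of_real (t powr (\<alpha> * k + 1 + \<alpha> - 1) * Beta (\<alpha> * k + 1) \<alpha>)) sums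
     integral {0..t} (\<lambda>s. (s powr (1 - 1) * (t - s) powr (\<alpha> - 1)) *\<^sub>R (\<Sum>k. q k * complex_of_real (s powr \<alpha>) ^ k))"
    by (rule has_integral_weighted_power_series) (use \<alpha> t sq in auto)
  \<comment> \<open>The point 0 is exempted because \<open>0 powr 0\<close> is 0, whereas the
    constant weight 1 is meant.\<close>
  also have "integral {0..t} (\<lambda>s. (s powr (1 - 1) * (t - s) powr (\<alpha> - 1)) *\<^sub>R (\<Sum>k. q k * complex_of_real (s powr \<alpha>) ^ k))
     = integral {0..t} (\<lambda>s. (t - s) powr (\<alpha> - 1) *\<^sub>R ml_series \<alpha> b z s)"
    by (rule integral_spike[of "{0}"]) (auto simp: ml_series_def q_def power_mult_distrib mult_ac)
  finally have "(\<lambda>k. z * (q k * complex_of_real (t powr (\<alpha> * k + 1 + \<alpha> - 1) * Beta (\<alpha> * k + 1) \<alpha>) / Gamma \<alpha>)) sums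
      (z * (integral {0..t} (\<lambda>s. (t - s) powr (\<alpha> - 1) *\<^sub>R ml_series \<alpha> b z s) / Gamma \<alpha>))"
    by (intro sums_mult sums_divide)
  also have "(\<lambda>k. z * (q k * complex_of_real (t powr (\<alpha> * k + 1 + \<alpha> - 1) * Beta (\<alpha> * k + 1) \<alpha>) / Gamma \<alpha>))
     = (\<lambda>k. complex_of_real (b k / Gamma (\<alpha> * real (Suc k) + 1)) * (z * complex_of_real (t powr \<alpha>)) ^ Suc k)"
  proof
    fix k
    have 1: "t powr (\<alpha> * k + 1 + \<alpha> - 1) = (t powr \<alpha>) ^ Suc k"
      using t by (simp add: powr_power algebra_simps del: power_Suc)
    have "Gamma \<alpha> > 0" using \<alpha> by (intro Gamma_real_pos)
    then have "b k / Gamma (\<alpha> * k + 1) * (Beta (\<alpha> * k + 1) \<alpha> / Gamma \<alpha>) = b k / Gamma (\<alpha> * real (Suc k) + 1)"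
      using Gamma_ml_pos[of k] by (simp add: Beta_def algebra_simps)
    from this[symmetric] show "z * (q k * complex_of_real (t powr (\<alpha> * k + 1 + \<alpha> - 1) * Beta (\<alpha> * k + 1) \<alpha>) / Gamma \<alpha>)
      = complex_of_real (b k / Gamma (\<alpha> * real (Suc k) + 1)) * (z * complex_of_real (t powr \<alpha>)) ^ Suc k"
      unfolding 1 q_def by (simp add: power_mult_distrib)
  qed
  finally have "(\<lambda>k. complex_of_real ((if Suc k = 0 then 0 else b (Suc k - 1)) / Gamma (\<alpha> * real (Suc k) + 1)) * (z * complex_of_real (t powr \<alpha>)) ^ Suc k)
    sums (z * (integral {0..t} (\<lambda>s. (t - s) powr (\<alpha> - 1) *\<^sub>R ml_series \<alpha> b z s) / Gamma \<alpha>))"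
    by simp
  then have "(\<lambda>k. complex_of_real ((if k = 0 then 0 else b (k - 1)) / Gamma (\<alpha> * real k + 1)) * (z * complex_of_real (t powr \<alpha>)) ^ k)
    sums (z * (integral {0..t} (\<lambda>s. (t - s) powr (\<alpha> - 1) *\<^sub>R ml_series \<alpha> b z s) / Gamma \<alpha>))"
    by (subst (asm) sums_Suc_iff) simp
  then show ?thesis
    unfolding ml_series_def[of \<alpha> "\<lambda>j. if j = 0 then 0 else b (j - 1)"] frac_integral_def
    by (simp add: sums_iff scaleR_conv_of_real field_simps)
qed

text \<open>The additive constant enters at index 0 only, where the Gamma factor and the power are
  both 1; it corrects the value that a shifted polynomial weight would take there.\<close>

lemma ml_series_add:
  assumes "\<And>k. \<bar>b k\<bar> \<le> 4 ^ k" "\<And>k. \<bar>b' k\<bar> \<le> 4 ^ k" "\<And>k. \<bar>b'' k\<bar> \<le> 4 ^ k"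
  shows "ml_series \<alpha> (\<lambda>k. b k + c * b' k + d * b'' k + (if k = 0 then e else 0)) z t
    = ml_series \<alpha> b z t + c * ml_series \<alpha> b' z t + d * ml_series \<alpha> b'' z t + complex_of_real e"
proof -
  let ?x = "z * complex_of_real (t powr \<alpha>)"
  have "(\<lambda>k. if k = 0 then complex_of_real e else 0) sums complex_of_real e"
    using sums_single[of 0 "\<lambda>_. complex_of_real e"] by (simp add: eq_commute)
  then have "(\<lambda>k. complex_of_real (b k / Gamma (\<alpha> * real k + 1)) * ?x ^ k
      + complex_of_real c * (complex_of_real (b' k / Gamma (\<alpha> * real k + 1)) * ?x ^ k)
      + complex_of_real d * (complex_of_real (b'' k / Gamma (\<alpha> * real k + 1)) * ?x ^ k)
      + (if k = 0 then complex_of_real e else 0)) sums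
     (ml_series \<alpha> b z t + c * ml_series \<alpha> b' z t + d * ml_series \<alpha> b'' z t + complex_of_real e)"
    by (intro sums_add sums_mult ml_series_sums assms)
  also have "(\<lambda>k. complex_of_real (b k / Gamma (\<alpha> * real k + 1)) * ?x ^ k
      + complex_of_real c * (complex_of_real (b' k / Gamma (\<alpha> * real k + 1)) * ?x ^ k)
      + complex_of_real d * (complex_of_real (b'' k / Gamma (\<alpha> * real k + 1)) * ?x ^ k)
      + (if k = 0 then complex_of_real e else 0))
     = (\<lambda>k. complex_of_real ((b k + c * b' k + d * b'' k + (if k = 0 then e else 0)) / Gamma (\<alpha> * real k + 1)) * ?x ^ k)"
    by (rule ext) (auto simp: add_divide_distrib algebra_simps)
  finally show ?thesis unfolding ml_series_def by (simp add: sums_iff)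
qed

lemma weight_bounds:
  "\<bar>1\<bar> \<le> (4::real) ^ k" "\<bar>\<alpha> * real k\<bar> \<le> 4 ^ k" "\<bar>(\<alpha> * real k) * (\<alpha> * real k)\<bar> \<le> 4 ^ k"
  "\<bar>1\<bar> \<le> (2::real) ^ k" "\<bar>\<alpha> * real k\<bar> \<le> 2 ^ k"
proof -
  have 2: "real k \<le> 2 ^ k" by (metis of_nat_less_two_power less_imp_le)
  have 3: "\<alpha> * real k \<le> 1 * 2 ^ k" using \<alpha> 2 by (intro mult_mono) auto
  have "(\<alpha> * real k) * (\<alpha> * real k) \<le> 2 ^ k * 2 ^ k"
    using \<alpha> 3 by (intro mult_mono) auto
  also have "\<dots> = 4 ^ k" by (simp add: power_mult_distrib[symmetric])
  finally show "\<bar>(\<alpha> * real k) * (\<alpha> * real k)\<bar> \<le> 4 ^ k" by simp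
  show "\<bar>\<alpha> * real k\<bar> \<le> 2 ^ k" using 3 \<alpha> by simp
  then show "\<bar>\<alpha> * real k\<bar> \<le> 4 ^ k" using power_mono[of "2::real" 4 k] by linarith
qed auto

text \<open>Shifting the weights turns the index-shifted series of \<open>ml_series_frac_integral\<close> back into the
  series for $y$, $t y'$ and $t (t y')'$.\<close>

lemma ml_series_volterra:
  fixes z :: complex and y w v :: "real \<Rightarrow> complex"
  assumes t: "0 \<le> t"
  defines "y \<equiv> ml_series \<alpha> (\<lambda>_. 1) z" and "w \<equiv> ml_series \<alpha> (\<lambda>k. \<alpha> * real k) z"
    and "v \<equiv> ml_series \<alpha> (\<lambda>k. (\<alpha> * real k) * (\<alpha> * real k)) z"
  shows "y t = 1 + z * frac_integral \<alpha> y t"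
    and "w t = \<alpha> * (y t - 1) + z * frac_integral \<alpha> w t"
    and "v t = 2 * \<alpha> * w t - \<alpha> ^ 2 * (y t - 1) + z * frac_integral \<alpha> v t"
proof -
  note wb = weight_bounds
  have "z * frac_integral \<alpha> y t = ml_series \<alpha> (\<lambda>k. 1 + 0 * 1 + 0 * 1 + (if k = 0 then -1 else 0)) z t"
    unfolding y_def by (subst ml_series_frac_integral[OF wb(1) t]) (rule arg_cong[where f = "\<lambda>b. ml_series \<alpha> b z t"], auto)
  also have "\<dots> = y t + 0 * y t + 0 * y t + complex_of_real (-1)"
    unfolding y_def by (subst ml_series_add[OF wb(1) wb(1) wb(1)]) simp
  finally show "y t = 1 + z * frac_integral \<alpha> y t" by simp
  have "z * frac_integral \<alpha> w t = ml_series \<alpha> (\<lambda>k. \<alpha> * real k + (-\<alpha>) * 1 + 0 * 1 + (if k = 0 then \<alpha> else 0)) z t"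
    unfolding w_def by (subst ml_series_frac_integral[OF wb(2) t]) (rule arg_cong[where f = "\<lambda>b. ml_series \<alpha> b z t"], auto simp: algebra_simps of_nat_diff)
  also have "\<dots> = w t + complex_of_real (-\<alpha>) * y t + 0 * y t + complex_of_real \<alpha>"
    unfolding w_def y_def by (subst ml_series_add[OF wb(2) wb(1) wb(1)]) simp
  finally show "w t = \<alpha> * (y t - 1) + z * frac_integral \<alpha> w t" by (simp add: algebra_simps)
  \<comment> \<open>For k \<ge> 1 the shifted weight is the square of
    \<open>\<alpha> * (k - 1)\<close>, expanded in the three weights; at k = 0 the expansion leaves
    \<alpha>^2, which the last term removes.\<close>
  have "z * frac_integral \<alpha> v t
      = ml_series \<alpha> (\<lambda>k. (\<alpha> * real k) * (\<alpha> * real k) + (-2 * \<alpha>) * (\<alpha> * real k) + \<alpha>\<^sup>2 * 1 + (if k = 0 then -(\<alpha>\<^sup>2) else 0)) z t"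
    unfolding v_def by (subst ml_series_frac_integral[OF wb(3) t])
      (rule arg_cong[where f = "\<lambda>b. ml_series \<alpha> b z t"], auto simp: algebra_simps of_nat_diff power2_eq_square)
  also have "\<dots> = v t + complex_of_real (-2 * \<alpha>) * w t + complex_of_real (\<alpha>\<^sup>2) * y t + complex_of_real (-(\<alpha>\<^sup>2))"
    unfolding v_def w_def y_def by (subst ml_series_add[OF wb(3) wb(2) wb(1)]) simp
  finally show "v t = 2 * \<alpha> * w t - \<alpha> ^ 2 * (y t - 1) + z * frac_integral \<alpha> v t"
    by (simp add: algebra_simps)
qed

text \<open>The weight \<open>\<alpha> * k\<close> cancels against the Gamma factor, so the
  derivative is the series of z^(k+1) s^(\<alpha>(k+1) - 1) / Gamma (\<alpha>(k+1)). Its Caputo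
  integral consists of Beta integrals with parameters \<alpha>(k+1) and 1 - \<alpha>, which restore
  \<open>Gamma (\<alpha> * k + 1)\<close> and leave one factor z: y is an eigenfunction of the
  Caputo derivative.\<close>

lemma ml_series_caputo:
  fixes z :: complex and d :: "real \<Rightarrow> complex"
  assumes t: "0 < t" and z: "z \<noteq> 0"
  defines "d \<equiv> \<lambda>s. (1 / s) *\<^sub>R ml_series \<alpha> (\<lambda>k. \<alpha> * real k) z s"
  shows "(\<lambda>s. (t - s) powr (- \<alpha>) *\<^sub>R d s) absolutely_integrable_on {0..t}"
    and "integral {0..t} (\<lambda>s. (t - s) powr (- \<alpha>) *\<^sub>R d s) = Gamma (1 - \<alpha>) * z * ml_series \<alpha> (\<lambda>_. 1) z t"
proof -
  define q where "q = (\<lambda>k. complex_of_real (1 / Gamma (\<alpha> * real (Suc k))) * z ^ Suc k)"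
  define F where "F = (\<lambda>s. (s powr (\<alpha> - 1) * (t - s) powr ((1 - \<alpha>) - 1)) *\<^sub>R (\<Sum>k. q k * complex_of_real (s powr \<alpha>) ^ k))"
  have G: "(\<alpha> * real (Suc k)) / Gamma (\<alpha> * real (Suc k) + 1) = 1 / Gamma (\<alpha> * real (Suc k))" for k
  proof -
    have p: "\<alpha> * real (Suc k) > 0" using \<alpha> by simp
    then have "Gamma (\<alpha> * real (Suc k) + 1) = (\<alpha> * real (Suc k)) * Gamma (\<alpha> * real (Suc k))"
      by (intro Gamma_plus1) (auto dest: nonpos_Ints_nonpos)
    then show ?thesis using p by simp
  qed
  have sq: "summable (\<lambda>k. cmod (q k) * (s powr \<alpha>) ^ k)" if s: "s > 0" for s
  proof -
    have "summable (\<lambda>k. norm (complex_of_real ((\<alpha> * real (Suc k)) / Gamma (\<alpha> * real (Suc k) + 1)) * (z * complex_of_real (s powr \<alpha>)) ^ Suc k))"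
      by (subst summable_Suc_iff) (rule summable_ml_series[OF weight_bounds(2)])
    from summable_divide[OF this, of "s powr \<alpha>"]
    show ?thesis using s by (simp only: G) (simp add: q_def norm_mult norm_power norm_divide power_mult_distrib mult_ac)
  qed
  have dF: "(t - s) powr (- \<alpha>) *\<^sub>R d s = F s" if s: "s \<in> {0..t} - {0}" for s
  proof -
    have s0: "s > 0" using s by auto
    have 1: "(\<lambda>k. complex_of_real ((\<alpha> * real (Suc k)) / Gamma (\<alpha> * real (Suc k) + 1)) * (z * complex_of_real (s powr \<alpha>)) ^ Suc k) sums ml_series \<alpha> (\<lambda>k. \<alpha> * real k) z s"
      using ml_series_sums[OF weight_bounds(2), of z s] by (subst sums_Suc_iff) simp
    have 2: "(\<lambda>k. complex_of_real ((\<alpha> * real (Suc k)) / Gamma (\<alpha> * real (Suc k) + 1)) * (z * complex_of_real (s powr \<alpha>)) ^ Suc k)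
      = (\<lambda>k. complex_of_real (s powr \<alpha>) * (q k * complex_of_real (s powr \<alpha>) ^ k))"
      unfolding G by (rule ext) (simp add: q_def power_mult_distrib mult_ac)
    have *: "(\<lambda>k. complex_of_real (s powr \<alpha>) * (q k * complex_of_real (s powr \<alpha>) ^ k)) sums ml_series \<alpha> (\<lambda>k. \<alpha> * real k) z s"
      using 1 unfolding 2 .
    have "summable (\<lambda>k. q k * complex_of_real (s powr \<alpha>) ^ k)"
      by (rule summable_norm_cancel) (use sq[OF s0] in \<open>simp add: norm_mult norm_power\<close>)
    from sums_unique[OF *] suminf_mult[OF this]
    have e: "ml_series \<alpha> (\<lambda>k. \<alpha> * real k) z s = complex_of_real (s powr \<alpha>) * (\<Sum>k. q k * complex_of_real (s powr \<alpha>) ^ k)"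
      by simp
    have "d s = s powr (\<alpha> - 1) *\<^sub>R (\<Sum>k. q k * complex_of_real (s powr \<alpha>) ^ k)"
      using s0 unfolding d_def e by (simp add: powr_diff scaleR_conv_of_real)
    then show ?thesis by (simp add: F_def mult.commute)
  qed
  have "0 < 1 - \<alpha>" using \<alpha> by simp
  note W = has_integral_weighted_power_series[OF \<alpha>(1) this \<alpha>(1) t sq[OF t]]
  have "F absolutely_integrable_on {0..t}" using W(1) unfolding F_def .
  then show "(\<lambda>s. (t - s) powr (- \<alpha>) *\<^sub>R d s) absolutely_integrable_on {0..t}"
    by (rule absolutely_integrable_spike[where S = "{0}"]) (use dF in auto)
  have "(\<lambda>k. q k * complex_of_real (t powr (\<alpha> * k + \<alpha> + (1 - \<alpha>) - 1) * Beta (\<alpha> * k + \<alpha>) (1 - \<alpha>))) sums integral {0..t} F"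
    using W(2) unfolding F_def .
  moreover have "q k * complex_of_real (t powr (\<alpha> * k + \<alpha> + (1 - \<alpha>) - 1) * Beta (\<alpha> * k + \<alpha>) (1 - \<alpha>))
    = (Gamma (1 - \<alpha>) * z) * (complex_of_real (1 / Gamma (\<alpha> * real k + 1)) * (z * complex_of_real (t powr \<alpha>)) ^ k)" for k
  proof -
    have "\<alpha> * k + \<alpha> + (1 - \<alpha>) - 1 = real k * \<alpha>" by simp
    then have "t powr (\<alpha> * k + \<alpha> + (1 - \<alpha>) - 1) = (t powr \<alpha>) ^ k"
      using t by (simp only:) (simp add: powr_power)
    moreover have "Gamma (\<alpha> * real (Suc k)) > 0" using \<alpha> by (intro Gamma_real_pos) simp
    then have "Beta (\<alpha> * k + \<alpha>) (1 - \<alpha>) = Gamma (\<alpha> * real (Suc k)) * (Gamma (1 - \<alpha>) / Gamma (\<alpha> * real k + 1))"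
      by (simp add: Beta_def algebra_simps)
    ultimately show ?thesis
      using \<open>Gamma (\<alpha> * real (Suc k)) > 0\<close> unfolding q_def power_mult_distrib
      by (simp del: of_nat_Suc)
  qed
  ultimately have "(\<lambda>k. (Gamma (1 - \<alpha>) * z) * (complex_of_real (1 / Gamma (\<alpha> * real k + 1)) * (z * complex_of_real (t powr \<alpha>)) ^ k)) sums integral {0..t} F"
    by simp
  moreover have "(\<lambda>k. (Gamma (1 - \<alpha>) * z) * (complex_of_real (1 / Gamma (\<alpha> * real k + 1)) * (z * complex_of_real (t powr \<alpha>)) ^ k)) sums (Gamma (1 - \<alpha>) * z * ml_series \<alpha> (\<lambda>_. 1) z t)"
    by (intro sums_mult ml_series_sums weight_bounds)
  ultimately have "integral {0..t} F = Gamma (1 - \<alpha>) * z * ml_series \<alpha> (\<lambda>_. 1) z t"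
    by (rule sums_unique2)
  moreover have "integral {0..t} F = integral {0..t} (\<lambda>s. (t - s) powr (- \<alpha>) *\<^sub>R d s)"
    by (rule integral_spike[of "{0}"]) (use dF in auto)
  ultimately show "integral {0..t} (\<lambda>s. (t - s) powr (- \<alpha>) *\<^sub>R d s) = Gamma (1 - \<alpha>) * z * ml_series \<alpha> (\<lambda>_. 1) z t"
    by simp
qed

end

section \<open>An energy estimate for Volterra equations\<close>

text \<open>Here \<open>w\<close> solves w' = y - c w with w(0) = 0, so the real part of
  \<open>cnj y * w\<close> is half the derivative of |w|^2 plus Re c |w|^2, and its integral is at
  least |w(T)|^2 / 2.\<close>

lemma exp_kernel_positive:
  fixes y :: "real \<Rightarrow> complex"
  assumes y: "continuous_on {0..T} y" and c: "0 \<le> Re c" and T: "0 \<le> T"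
  defines "w \<equiv> \<lambda>t. integral {0..t} (\<lambda>s. exp (- c * (t - s)) * y s)"
  shows "continuous_on {0..T} w" "0 \<le> Re (integral {0..T} (\<lambda>t. cnj (y t) * w t))"
proof -
  define v where "v = (\<lambda>t. integral {0..t} (\<lambda>s. exp (c * complex_of_real s) * y s))"
  have cv: "continuous_on {0..T} (\<lambda>s. exp (c * complex_of_real s) * y s)"
    by (intro continuous_intros y)
  have w: "w t = exp (- c * complex_of_real t) * v t" for t
  proof -
    have "w t = integral {0..t} (\<lambda>s. exp (- c * complex_of_real t) * (exp (c * complex_of_real s) * y s))"
      unfolding w_def by (rule integral_cong) (simp add: exp_add[symmetric] algebra_simps flip: mult.assoc)
    then show ?thesis by (simp add: v_def)
  qed
  have vd: "(v has_vector_derivative exp (c * complex_of_real t) * y t) (at t within {0..T})" if "t \<in> {0..T}" for t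
    unfolding v_def by (rule integral_has_vector_derivative[OF cv that])
  have ed: "((\<lambda>t. exp (- c * complex_of_real t)) has_vector_derivative (- c) * exp (- c * complex_of_real t)) (at t within {0..T})" for t
    by (rule has_vector_derivative_real_field) (auto intro!: derivative_eq_intros)
  have wd: "(w has_vector_derivative y t - c * w t) (at t within {0..T})" if t: "t \<in> {0..T}" for t
  proof -
    have "((\<lambda>t. exp (- c * complex_of_real t) * v t) has_vector_derivative
      exp (- c * complex_of_real t) * (exp (c * complex_of_real t) * y t) + ((- c) * exp (- c * complex_of_real t)) * v t) (at t within {0..T})"
      by (rule has_vector_derivative_mult[OF ed vd[OF t]])
    moreover have "exp (- c * complex_of_real t) * (exp (c * complex_of_real t) * y t) = y t"
      by (simp flip: mult.assoc exp_add)
    ultimately show ?thesis unfolding w[abs_def] by (simp only:) (simp add: mult.assoc)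
  qed
  then show cw: "continuous_on {0..T} w"
    by (intro continuous_on_vector_derivative)
  have "((\<lambda>t. 2 * (w t \<bullet> (y t - c * w t))) has_integral (w T \<bullet> w T - w 0 \<bullet> w 0)) {0..T}"
  proof (rule fundamental_theorem_of_calculus[OF T])
    fix t assume t: "t \<in> {0..T}"
    have "((\<lambda>t. w t \<bullet> w t) has_derivative (\<lambda>h. w t \<bullet> (h *\<^sub>R (y t - c * w t)) + (h *\<^sub>R (y t - c * w t)) \<bullet> w t)) (at t within {0..T})"
      using wd[OF t] unfolding has_vector_derivative_def by (rule has_derivative_inner) (use wd[OF t] in \<open>simp add: has_vector_derivative_def\<close>)
    then show "((\<lambda>t. w t \<bullet> w t) has_vector_derivative 2 * (w t \<bullet> (y t - c * w t))) (at t within {0..T})"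
      unfolding has_vector_derivative_def by (rule has_derivative_eq_rhs) (auto simp: inner_commute)
  qed
  moreover have "w 0 = 0" by (simp add: w_def)
  ultimately have 1: "((\<lambda>t. w t \<bullet> (y t - c * w t)) has_integral (w T \<bullet> w T) / 2) {0..T}"
    using has_integral_mult_right[of "\<lambda>t. 2 * (w t \<bullet> (y t - c * w t))" "w T \<bullet> w T" "{0..T}" "1/2"] by simp
  have ic: "(\<lambda>t. cnj (y t) * w t) integrable_on {0..T}"
    by (intro integrable_continuous_interval continuous_intros y cw)
  have "((\<lambda>t. Re (cnj (y t) * w t)) has_integral Re (integral {0..T} (\<lambda>t. cnj (y t) * w t))) {0..T}"
    using has_integral_Re[OF integrable_integral[OF ic]] .
  then have "(w T \<bullet> w T) / 2 \<le> Re (integral {0..T} (\<lambda>t. cnj (y t) * w t))"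
  proof (rule has_integral_le[OF 1])
    fix t
    have "w t \<bullet> (c * w t) = Re c * (cmod (w t))\<^sup>2"
      unfolding cmod_power2 by (simp add: inner_complex_def power2_eq_square algebra_simps)
    then have "w t \<bullet> (c * w t) \<ge> 0" using c by simp
    then show "w t \<bullet> (y t - c * w t) \<le> Re (cnj (y t) * w t)"
      by (simp add: inner_diff_right) (simp add: inner_complex_def mult.commute)
  qed
  then show "0 \<le> Re (integral {0..T} (\<lambda>t. cnj (y t) * w t))"
    by (rule order_trans[rotated]) simp
qed

text \<open>The passage between gauge integrals over intervals, in which the estimates are stated,
  and Lebesgue integrals over \<open>lborel\<close>, in which Fubini's theorem is applied.\<close>

lemma has_bochner_integral_lborel_vanishing:
  fixes f :: "'a::euclidean_space \<Rightarrow> 'b::euclidean_space"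
  assumes m: "f \<in> borel_measurable borel" and S: "f absolutely_integrable_on S"
    and z: "\<And>x. x \<notin> S \<Longrightarrow> f x = 0"
  shows "has_bochner_integral lborel f (integral S f)"
proof -
  have e: "(\<lambda>x. indicator S x *\<^sub>R f x) = f" "(\<lambda>x. if x \<in> S then f x else 0) = f"
    using z by (auto simp: indicator_def)
  have "integrable lebesgue f" using S unfolding set_integrable_def e .
  then have i: "integrable lborel f" using m by (simp add: integrable_completion)
  have "integral S f = integral UNIV f"
    using integral_restrict_UNIV[of S f] unfolding e by simp
  then show ?thesis
    using i integral_unique[OF has_integral_integral_lborel[OF i]] by (simp add: has_bochner_integral_iff)
qed

section \<open>The kernel t^(\<alpha> - 1) as a superposition of decaying exponentials\<close>

context
  fixes \<alpha> :: real
  assumes \<alpha>: "0 < \<alpha>" "\<alpha> < 1"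
begin

text \<open>The direction must not be real: the imaginary part of the resulting constant \<open>slanted_Gamma 1\<close> is what
  makes the energy estimate coercive for the purely imaginary coefficient $-\mathrm{i}\lambda$.\<close>

definition slant :: complex where "slant = Complex 1 (- 1 / 2)"

text \<open>Analytically this is Gamma (1 - \<alpha>) (p \<tau>)^(\<alpha> - 1) with p =
  \<open>slant\<close>. Its scaling law and the sign of its imaginary part at \<tau> = 1 are derived
  from the integral itself, without rotating the contour.\<close>

definition slanted_Gamma :: "real \<Rightarrow> complex" where
  "slanted_Gamma \<tau> = (\<integral>r. indicator {0<..} r *\<^sub>R (exp (- slant * complex_of_real (r * \<tau>)) * complex_of_real (r powr (- \<alpha>))) \<partial>lborel)"

lemma Re_slant [simp]: "Re slant = 1"
  by (simp add: slant_def)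

lemma norm_exp_slant: "cmod (exp (- slant * complex_of_real x)) = exp (- x)"
  by (simp add: slant_def norm_exp_eq_Re)

text \<open>Substitution of \<open>\<tau> * r\<close> in the Gamma integral. The value b = 1 -
  \<alpha> gives the modulus of the slanted integrand, and b = 2 - \<alpha>, b = 3 - \<alpha> give
  the moments in the sign estimate for \<open>slanted_Gamma 1\<close>.\<close>

lemma gamma_kernel_integral:
  fixes \<tau> b :: real
  assumes "0 < \<tau>" "0 < b"
  shows "has_bochner_integral lborel (\<lambda>r. indicator {0<..} r * (exp (- (r * \<tau>)) * r powr (b - 1))) (\<tau> powr (- b) * Gamma b)"
proof -
  let ?g = "\<lambda>r::real. (indicator {0<..} r :: real) * (exp (- r) * r powr (b - 1))"
  have "((\<lambda>r. r powr (b - 1) / exp r) has_integral Gamma b) {0..}"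
    by (rule Gamma_integral_real) (use assms in auto)
  then have gi: "(?g has_integral Gamma b) {0..}"
    by (rule has_integral_spike[of "{0}", rotated 2]) (auto simp: indicator_def exp_minus field_simps)
  have "?g absolutely_integrable_on {0..}"
    using gi by (intro nonnegative_absolutely_integrable_1) (auto simp: integrable_on_def)
  moreover have gm: "?g \<in> borel_measurable borel" by measurable
  ultimately have "has_bochner_integral lborel ?g (Gamma b)"
    using gi by (subst integral_unique[OF gi, symmetric])
      (intro has_bochner_integral_lborel_vanishing, auto simp: indicator_def)
  then have "has_bochner_integral lborel (\<lambda>x. ?g (0 + \<tau> * x)) (Gamma b /\<^sub>R \<bar>\<tau>\<bar>)"
    using assms by (intro lborel_has_bochner_integral_real_affine_iff[THEN iffD1, rotated]) auto
  then have "has_bochner_integral lborel (\<lambda>x. (\<tau> powr (1 - b)) * ?g (0 + \<tau> * x)) (\<tau> powr (1 - b) * (Gamma b /\<^sub>R \<bar>\<tau>\<bar>))"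
    by (intro has_bochner_integral_mult_right) auto
  moreover have "(\<lambda>x. (\<tau> powr (1 - b)) * ?g (0 + \<tau> * x)) = (\<lambda>r. indicator {0<..} r * (exp (- (r * \<tau>)) * r powr (b - 1)))"
  proof
    fix x
    have "\<tau> powr (1 - b) * (\<tau> * x) powr (b - 1) = x powr (b - 1)" if "x > 0"
      using that assms by (simp add: powr_mult flip: mult.assoc powr_add)
    then show "(\<tau> powr (1 - b)) * ?g (0 + \<tau> * x) = indicator {0<..} x * (exp (- (x * \<tau>)) * x powr (b - 1))"
      using assms by (auto simp: indicator_def zero_less_mult_iff mult.commute)
  qed
  moreover have "\<tau> powr (1 - b) * (Gamma b /\<^sub>R \<bar>\<tau>\<bar>) = \<tau> powr (- b) * Gamma b"
    using assms by (simp add: powr_diff powr_minus field_simps)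
  ultimately show ?thesis by (simp only:)
qed

lemma integrable_slanted_Gamma:
  assumes "0 < \<tau>"
  shows "integrable lborel (\<lambda>r. indicator {0<..} r *\<^sub>R (exp (- slant * complex_of_real (r * \<tau>)) * complex_of_real (r powr (- \<alpha>))))"
proof (rule Bochner_Integration.integrable_bound)
  show "integrable lborel (\<lambda>r. indicator {0<..} r * (exp (- (r * \<tau>)) * r powr ((1 - \<alpha>) - 1)))"
    using gamma_kernel_integral[OF assms, of "1 - \<alpha>"] \<alpha> by (simp add: has_bochner_integral_iff)
  show "AE r in lborel. norm (indicator {0<..} r *\<^sub>R (exp (- slant * complex_of_real (r * \<tau>)) * complex_of_real (r powr (- \<alpha>))))
     \<le> norm (indicator {0<..} r * (exp (- (r * \<tau>)) * r powr ((1 - \<alpha>) - 1)))"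
    unfolding norm_scaleR norm_mult norm_exp_slant by (auto simp: indicator_def)
qed measurable

text \<open>Rescaling \<open>r\<close> exhibits the kernel: up to a complex constant,
  \<open>\<tau> powr (\<alpha> - 1)\<close> is an integral of exponentials in \<tau> against the
  positive weight \<open>r powr (- \<alpha>)\<close>.\<close>

lemma slanted_Gamma_scale:
  assumes "0 < \<tau>"
  shows "slanted_Gamma \<tau> = \<tau> powr (\<alpha> - 1) *\<^sub>R slanted_Gamma 1"
proof -
  let ?g = "\<lambda>r::real. indicator {0<..} r *\<^sub>R (exp (- slant * complex_of_real (r * 1)) * complex_of_real (r powr (- \<alpha>)))"
  have "slanted_Gamma 1 = \<bar>\<tau>\<bar> *\<^sub>R (\<integral>r. ?g (0 + \<tau> * r) \<partial>lborel)"
    unfolding slanted_Gamma_def using assms by (intro lborel_integral_real_affine) auto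
  also have "(\<lambda>r. ?g (0 + \<tau> * r)) = (\<lambda>r. \<tau> powr (- \<alpha>) *\<^sub>R (indicator {0<..} r *\<^sub>R (exp (- slant * complex_of_real (r * \<tau>)) * complex_of_real (r powr (- \<alpha>)))))"
    using assms by (auto simp: fun_eq_iff indicator_def zero_less_mult_iff mult_ac powr_mult scaleR_conv_of_real)
  also have "(\<integral>r. \<tau> powr (- \<alpha>) *\<^sub>R (indicator {0<..} r *\<^sub>R (exp (- slant * complex_of_real (r * \<tau>)) * complex_of_real (r powr (- \<alpha>)))) \<partial>lborel) = \<tau> powr (- \<alpha>) *\<^sub>R slanted_Gamma \<tau>"
    unfolding slanted_Gamma_def by (rule integral_scaleR_right)
  finally have "slanted_Gamma 1 = (\<bar>\<tau>\<bar> * \<tau> powr (- \<alpha>)) *\<^sub>R slanted_Gamma \<tau>" by simp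
  moreover have "\<tau> powr (\<alpha> - 1) * (\<bar>\<tau>\<bar> * \<tau> powr (- \<alpha>)) = 1"
    using assms by (simp add: powr_diff powr_minus)
  ultimately show ?thesis by simp
qed

text \<open>The imaginary part exp(-r) r^(-\<alpha>) sin(r/2) of the integrand changes sign, but the
  minorant sin x \<ge> x - x^2 / 2 for x \<ge> 0 has computable moments, which give Gamma (2 -
  \<alpha>) (1/2 - (2 - \<alpha>) / 8). With a slope m in place of 1/2 this argument asks for m (2 -
  \<alpha>) < 2, so 1/2 serves all \<alpha> at once.\<close>

lemma Im_slanted_Gamma_pos: "0 < Im (slanted_Gamma 1)"
proof -
  let ?f = "\<lambda>r::real. indicator {0<..} r *\<^sub>R (exp (- slant * complex_of_real (r * 1)) * complex_of_real (r powr (- \<alpha>)))"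
  let ?h = "\<lambda>b r::real. indicator {0<..} r * (exp (- (r * 1)) * r powr (b - 1))"
  have h1: "has_bochner_integral lborel (?h (2 - \<alpha>)) (1 powr (- (2 - \<alpha>)) * Gamma (2 - \<alpha>))"
    by (rule gamma_kernel_integral) (use \<alpha> in auto)
  have h2: "has_bochner_integral lborel (?h (3 - \<alpha>)) (1 powr (- (3 - \<alpha>)) * Gamma (3 - \<alpha>))"
    by (rule gamma_kernel_integral) (use \<alpha> in auto)
  have "Gamma ((2 - \<alpha>) + 1) = (2 - \<alpha>) * Gamma (2 - \<alpha>)"
    using \<alpha> by (intro Gamma_plus1) (auto dest: nonpos_Ints_nonpos)
  then have G: "Gamma (3 - \<alpha>) = (2 - \<alpha>) * Gamma (2 - \<alpha>)" by (simp add: algebra_simps)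
  have "Gamma (2 - \<alpha>) > 0" using \<alpha> by (intro Gamma_real_pos) auto
  then have "0 < Gamma (2 - \<alpha>) * (1/2 - (2 - \<alpha>) / 8)" using \<alpha> by (intro mult_pos_pos) auto
  also have "\<dots> = (\<integral>r. 1/2 * ?h (2 - \<alpha>) r - 1/8 * ?h (3 - \<alpha>) r \<partial>lborel)"
    using h1 h2 G by (simp add: has_bochner_integral_iff algebra_simps)
  also have "\<dots> \<le> (\<integral>r. Im (?f r) \<partial>lborel)"
  proof (rule integral_mono)
    show "integrable lborel (\<lambda>r. 1/2 * ?h (2 - \<alpha>) r - 1/8 * ?h (3 - \<alpha>) r)"
      using h1 h2 by (simp add: has_bochner_integral_iff)
    show "integrable lborel (\<lambda>r. Im (?f r))"
      by (intro integrable_Im integrable_slanted_Gamma) simp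
    fix r :: real
    show "1/2 * ?h (2 - \<alpha>) r - 1/8 * ?h (3 - \<alpha>) r \<le> Im (?f r)"
    proof (cases "r > 0")
      case True
      have "\<bar>sin (r/2) - (\<Sum>m<2. sin_coeff m * (r/2) ^ m)\<bar> \<le> inverse (fact 2) * \<bar>r/2\<bar> ^ 2"
        by (rule Maclaurin_sin_bound)
      then have "sin (r/2) \<ge> r / 2 - r\<^sup>2 / 8"
        unfolding abs_le_iff by (simp add: numeral_2_eq_2 sin_coeff_def power2_eq_square)
      then have "(exp (- r) * r powr (- \<alpha>)) * (r / 2 - r\<^sup>2 / 8) \<le> (exp (- r) * r powr (- \<alpha>)) * sin (r/2)"
        by (intro mult_left_mono) auto
      moreover have "r powr (2 - \<alpha> - 1) = r powr (- \<alpha>) * r" "r powr (3 - \<alpha> - 1) = r powr (- \<alpha>) * r\<^sup>2"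
        using True powr_add[of r "- \<alpha>" 1] powr_add[of r "- \<alpha>" 2] by simp_all
      moreover have "Im (?f r) = (exp (- r) * r powr (- \<alpha>)) * sin (r/2)"
        using True by (simp add: slant_def Im_exp Re_exp)
      ultimately show ?thesis using True by (simp add: algebra_simps)
    qed simp
  qed
  also have "\<dots> = Im (slanted_Gamma 1)"
    unfolding slanted_Gamma_def by (rule integral_Im) (intro integrable_slanted_Gamma, simp)
  finally show ?thesis .
qed


text \<open>The constant times the kernel is an integral over r > 0 of exponential kernels with
  exponent c = r \<open>slant\<close>. Exchanging this integral with the one over the triangle s < t
  leaves, for each r, the positive form of \<open>exp_kernel_positive\<close> times
  \<open>r powr (- \<alpha>)\<close>.\<close>

lemma frac_kernel_positive:
  fixes y :: "real \<Rightarrow> complex"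
  assumes y: "continuous_on {0..T} y" and T: "0 \<le> T"
  shows "0 \<le> Re (slanted_Gamma 1 * integral {0..T} (\<lambda>t. cnj (y t) * integral {0..t} (\<lambda>s. (t - s) powr (\<alpha> - 1) *\<^sub>R y s)))"
proof -
  \<comment> \<open>Extension by zero gives a bounded Borel function on the line, as the integrals
    over the product space require.\<close>
  define Y where "Y = (\<lambda>t. indicator {0..T} t *\<^sub>R y t)"
  have Ym[measurable]: "Y \<in> borel_measurable borel"
    unfolding Y_def by (rule borel_measurable_continuous_on_indicator) (use y in auto)
  obtain M' where M': "\<forall>t\<in>{0..T}. norm (y t) \<le> M'"
    using compact_imp_bounded[OF compact_continuous_image[OF y]] by (auto simp: bounded_iff)
  define M where "M = \<bar>M'\<bar>"
  have M0: "M \<ge> 0" by (simp add: M_def)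
  have YM: "norm (Y t) \<le> M" for t
    using M' by (auto simp: Y_def M_def indicator_def intro: order_trans[OF _ abs_ge_self])
  have Yy: "Y t = y t" if "t \<in> {0..T}" for t using that by (simp add: Y_def)
  define k where "k = (\<lambda>(t, s). if 0 \<le> t \<and> t \<le> T \<and> 0 \<le> s \<and> s < t then (t - s) powr (\<alpha> - 1) else 0)"
  have km[measurable]: "k \<in> borel_measurable (borel \<Otimes>\<^sub>M borel)" unfolding k_def by measurable
  have k0: "k x \<ge> 0" for x by (auto simp: k_def split: prod.split)
  have kz: "k (t, s) = 0" if "s \<notin> {0..t}" for t s using that by (auto simp: k_def)
  have ks: "k (t, s) = (t - s) powr (\<alpha> - 1)" if "t \<in> {0..T}" "s \<in> {0..t}" for t s
    using that by (auto simp: k_def)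
  have ka: "(\<lambda>s. k (t, s)) absolutely_integrable_on {0..t}" if t: "t \<in> {0..T}" for t
    by (rule absolutely_integrable_spike[where S = "{}", OF absolutely_integrable_powr_Icc[OF \<alpha>(1)]]) (use ks t in auto)
  have kb: "has_bochner_integral lborel (\<lambda>s. k (t, s)) (indicator {0..T} t * (t powr \<alpha> / \<alpha>))" for t
  proof (cases "t \<in> {0..T}")
    case True
    have "integral {0..t} (\<lambda>s. k (t, s)) = integral {0..t} (\<lambda>s. (t - s) powr (\<alpha> - 1))"
      by (rule integral_cong) (use ks True in auto)
    also have "\<dots> = t powr \<alpha> / \<alpha>"
      using has_integral_powr_Icc[OF \<alpha>(1), of 0 t] True by (simp add: integral_unique)
    finally show ?thesis
      using has_bochner_integral_lborel_vanishing[OF _ ka[OF True]] kz True by simp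
  next
    case False
    then have "(\<lambda>s. k (t, s)) = (\<lambda>_. 0)" by (auto simp: k_def)
    with False show ?thesis by (simp add: has_bochner_integral_zero)
  qed
  have ki: "integrable (lborel \<Otimes>\<^sub>M lborel) k"
  proof (rule lborel_pair.Fubini_integrable)
    show "integrable lborel (\<lambda>t. \<integral>s. norm (k (t, s)) \<partial>lborel)"
    proof (rule Bochner_Integration.integrable_bound)
      show "integrable lborel (\<lambda>t. indicator {0..T} t * (T powr \<alpha> / \<alpha>))"
        using T by (intro integrable_mult_left integrable_real_indicator) auto
      show "AE t in lborel. norm (\<integral>s. norm (k (t, s)) \<partial>lborel) \<le> norm (indicator {0..T} t * (T powr \<alpha> / \<alpha>))"
      proof (rule AE_I2)
        fix t
        have "(\<integral>s. norm (k (t, s)) \<partial>lborel) = indicator {0..T} t * (t powr \<alpha> / \<alpha>)"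
          using kb[of t] k0 by (simp add: has_bochner_integral_iff)
        moreover have "t powr \<alpha> \<le> T powr \<alpha>" if "0 \<le> t" "t \<le> T"
          using that \<alpha> by (intro powr_mono2) auto
        ultimately show "norm (\<integral>s. norm (k (t, s)) \<partial>lborel) \<le> norm (indicator {0..T} t * (T powr \<alpha> / \<alpha>))"
          using \<alpha> by (auto simp: indicator_def divide_right_mono)
      qed
    qed measurable
    show "AE t in lborel. integrable lborel (\<lambda>s. k (t, s))"
      using kb by (auto simp: has_bochner_integral_iff)
  qed measurable
  \<comment> \<open>The first argument is the pair (t, s), the second the frequency r. The diagonal,
    where the kernel is singular, is left out.\<close>
  define F :: "real \<times> real \<Rightarrow> real \<Rightarrow> complex" where
    "F = (\<lambda>x r. (if 0 \<le> fst x \<and> fst x \<le> T \<and> 0 \<le> snd x \<and> snd x < fst x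
       then (cnj (Y (fst x)) * Y (snd x)) * (indicator {0<..} r *\<^sub>R (exp (- slant * complex_of_real (r * (fst x - snd x))) * complex_of_real (r powr (- \<alpha>)))) else 0))"
  have [measurable]: "(fst :: real \<times> real \<Rightarrow> real) \<in> borel_measurable borel"
      "(snd :: real \<times> real \<Rightarrow> real) \<in> borel_measurable borel"
    by (simp_all add: borel_prod[symmetric])
  have [measurable]: "cnj \<in> borel_measurable borel"
    by (intro borel_measurable_continuous_onI continuous_intros)
  have Fm[measurable]: "case_prod F \<in> borel_measurable (borel \<Otimes>\<^sub>M borel)"
    unfolding F_def by measurable
  have Fr: "integrable lborel (F x)" for x
  proof (cases "0 \<le> fst x \<and> fst x \<le> T \<and> 0 \<le> snd x \<and> snd x < fst x")
    case True
    then have Fx: "F x = (\<lambda>r. (cnj (Y (fst x)) * Y (snd x)) * (indicator {0<..} r *\<^sub>R (exp (- slant * complex_of_real (r * (fst x - snd x))) * complex_of_real (r powr (- \<alpha>)))))"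
      by (simp add: F_def)
    show ?thesis unfolding Fx by (intro integrable_mult_right integrable_slanted_Gamma) (use True in simp)
  next
    case False
    then have "F x = (\<lambda>r. 0)" by (auto simp: F_def)
    then show ?thesis by simp
  qed
  \<comment> \<open>Taking moduli loses only the oscillation of the exponentials, so the r-integral
    is again the singular kernel, now with constant \<open>Gamma (1 - \<alpha>)\<close>. Since
    \<open>k\<close> is integrable over the triangle, Fubini applies.\<close>
  have Fn: "(\<integral>r. norm (F x r) \<partial>lborel) = norm (Y (fst x)) * norm (Y (snd x)) * (k x * Gamma (1 - \<alpha>))" for x
  proof (cases "0 \<le> fst x \<and> fst x \<le> T \<and> 0 \<le> snd x \<and> snd x < fst x")
    case True
    then have "(\<lambda>r. norm (F x r)) = (\<lambda>r. (norm (Y (fst x)) * norm (Y (snd x))) * (indicator {0<..} r * (exp (- (r * (fst x - snd x))) * r powr ((1 - \<alpha>) - 1))))"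
      unfolding F_def norm_mult norm_scaleR by (auto simp: fun_eq_iff norm_mult norm_exp_slant indicator_def simp del: of_real_mult)
    then show ?thesis
      using gamma_kernel_integral[of "fst x - snd x" "1 - \<alpha>"] True \<alpha>
      by (simp add: has_bochner_integral_iff k_def case_prod_unfold)
  qed (auto simp: F_def k_def case_prod_unfold)
  have Fi: "integrable (lborel \<Otimes>\<^sub>M lborel) (case_prod F)"
  proof (rule lborel_pair.Fubini_integrable)
    show "integrable lborel (\<lambda>x. \<integral>r. norm (case_prod F (x, r)) \<partial>lborel)"
    proof (rule Bochner_Integration.integrable_bound)
      show "integrable lborel (\<lambda>x. M * M * (k x * Gamma (1 - \<alpha>)))"
        using ki unfolding lborel_prod by simp
      show "AE x in lborel. norm (\<integral>r. norm (case_prod F (x, r)) \<partial>lborel) \<le> norm (M * M * (k x * Gamma (1 - \<alpha>)))"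
      proof (rule AE_I2)
        fix x
        have "Gamma (1 - \<alpha>) > 0" using \<alpha> by (intro Gamma_real_pos) auto
        note G = this
        then have 0: "0 \<le> k x * Gamma (1 - \<alpha>)" using k0 by simp
        have "norm (Y (fst x)) * norm (Y (snd x)) * (k x * Gamma (1 - \<alpha>)) \<le> M * M * (k x * Gamma (1 - \<alpha>))"
          using YM 0 by (intro mult_right_mono mult_mono M0) auto
        then show "norm (\<integral>r. norm (case_prod F (x, r)) \<partial>lborel) \<le> norm (M * M * (k x * Gamma (1 - \<alpha>)))"
          unfolding prod.case Fn real_norm_def using G k0[of x] M0 by (simp add: abs_mult)
      qed
      have [measurable]: "k \<in> borel_measurable borel" using km by (simp add: borel_prod)
      show "(\<lambda>x. \<integral>r. norm (case_prod F (x, r)) \<partial>lborel) \<in> borel_measurable lborel"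
        unfolding prod.case Fn by measurable
    qed
  qed (use Fr in auto)
  have B: "0 \<le> Re (\<integral>x. F x r \<partial>lborel)" for r
  proof (cases "r > 0")
    case True
    define G where "G = (\<lambda>(t, s). if 0 \<le> t \<and> t \<le> T \<and> 0 \<le> s \<and> s < t
       then cnj (Y t) * Y s * exp (- slant * complex_of_real (r * (t - s))) else 0)"
    have Gm[measurable]: "G \<in> borel_measurable (borel \<Otimes>\<^sub>M borel)" unfolding G_def by measurable
    have Gi: "integrable (lborel \<Otimes>\<^sub>M lborel) G"
    proof (rule Bochner_Integration.integrable_bound)
      have "emeasure lborel ({0..T} \<times> {0..T}) < \<infinity>"
        by (rule emeasure_bounded_finite) (intro bounded_Times, auto)
      then have "integrable lborel (\<lambda>x. (M * M) * indicator ({0..T} \<times> {0..T}) x)"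
        by (intro integrable_mult_right integrable_real_indicator) (auto simp: borel_prod[symmetric])
      then show "integrable (lborel \<Otimes>\<^sub>M lborel) (\<lambda>x. (M * M) * indicator ({0..T} \<times> {0..T}) x)"
        unfolding lborel_prod .
      have "norm (G x) \<le> M * M * indicator ({0..T} \<times> {0..T}) x" for x
      proof (cases "0 \<le> fst x \<and> fst x \<le> T \<and> 0 \<le> snd x \<and> snd x < fst x")
        case c: True
        have "norm (G x) = norm (Y (fst x)) * norm (Y (snd x)) * exp (- (r * (fst x - snd x)))"
          using c unfolding G_def case_prod_unfold by (simp add: norm_mult norm_exp_slant del: of_real_mult)
        also have "\<dots> \<le> (M * M) * 1"
          using c True YM M0 by (intro mult_mono) auto
        finally show ?thesis using c by (auto simp: indicator_def mem_Times_iff)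
      qed (auto simp: G_def case_prod_unfold)
      then show "AE x in lborel \<Otimes>\<^sub>M lborel. norm (G x) \<le> norm (M * M * indicator ({0..T} \<times> {0..T}) x)"
        using M0 by (intro AE_I2) (simp add: abs_mult)
    qed measurable
    have "(\<integral>x. F x r \<partial>lborel) = (\<integral>x. r powr (- \<alpha>) *\<^sub>R G x \<partial>lborel)"
      by (rule Bochner_Integration.integral_cong) (use True in \<open>auto simp: F_def G_def scaleR_conv_of_real\<close>)
    also have "\<dots> = r powr (- \<alpha>) *\<^sub>R (\<integral>x. G x \<partial>lborel)" by simp
    also have "(\<integral>x. G x \<partial>lborel) = (\<integral>t. \<integral>s. G (t, s) \<partial>lborel \<partial>lborel)"
      unfolding lborel_prod[symmetric] by (rule lborel_pair.integral_fst'[OF Gi, symmetric])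
    finally have F1: "(\<integral>x. F x r \<partial>lborel) = r powr (- \<alpha>) *\<^sub>R (\<integral>t. \<integral>s. G (t, s) \<partial>lborel \<partial>lborel)" .
    define w where "w = (\<lambda>t. integral {0..t} (\<lambda>s. exp (- (slant * of_real r) * complex_of_real (t - s)) * y s))"
    have E: "continuous_on {0..T} w" "0 \<le> Re (integral {0..T} (\<lambda>t. cnj (y t) * w t))"
      using exp_kernel_positive[OF y _ T, of "slant * of_real r"] True unfolding w_def by (auto simp: slant_def)
    have Gz: "G (t, s) = 0" if "s \<notin> {0..t}" for s t using that by (auto simp: G_def)
    have Gs: "(\<integral>s. G (t, s) \<partial>lborel) = indicator {0..T} t *\<^sub>R (cnj (y t) * w t)" for t
    proof (cases "t \<in> {0..T}")
      case t: True
      define g where "g = (\<lambda>s. cnj (y t) * (exp (- (slant * of_real r) * complex_of_real (t - s)) * y s))"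
      have "continuous_on {0..t} g"
        unfolding g_def using t by (intro continuous_intros continuous_on_subset[OF y]) auto
      then have ga: "g absolutely_integrable_on {0..t}" by (rule absolutely_integrable_continuous_real)
      have Gg: "G (t, s) = g s" if "s \<in> {0..t} - {t}" for s
        using that t by (auto simp: G_def g_def Yy mult_ac)
      have "(\<lambda>s. G (t, s)) absolutely_integrable_on {0..t}"
        by (rule absolutely_integrable_spike[where S = "{t}", OF ga]) (use Gg in auto)
      moreover have "(\<lambda>s. G (t, s)) \<in> borel_measurable borel"
        using measurable_Pair2[OF Gm, of t] by simp
      ultimately have "(\<integral>s. G (t, s) \<partial>lborel) = integral {0..t} (\<lambda>s. G (t, s))"
        using has_bochner_integral_lborel_vanishing[of "\<lambda>s. G (t, s)" "{0..t}", OF _ _ Gz]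
        unfolding has_bochner_integral_iff by metis
      also have "\<dots> = integral {0..t} g"
        by (rule integral_spike[of "{t}"]) (use Gg in auto)
      also have "\<dots> = cnj (y t) * w t" by (simp add: g_def w_def)
      finally show ?thesis using t by simp
    next
      case False
      then have "(\<lambda>s. G (t, s)) = (\<lambda>_. 0)" by (auto simp: G_def)
      then show ?thesis using False by simp
    qed
    have cyw: "continuous_on {0..T} (\<lambda>t. cnj (y t) * w t)" by (intro continuous_intros y E)
    have "(\<lambda>t. indicator {0..T} t *\<^sub>R (cnj (y t) * w t)) absolutely_integrable_on {0..T}"
      by (rule absolutely_integrable_spike[where S = "{}", OF absolutely_integrable_continuous_real[OF cyw]]) auto
    from has_bochner_integral_lborel_vanishing[OF borel_measurable_continuous_on_indicator[OF _ cyw] this]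
    have "(\<integral>t. indicator {0..T} t *\<^sub>R (cnj (y t) * w t) \<partial>lborel) = integral {0..T} (\<lambda>t. indicator {0..T} t *\<^sub>R (cnj (y t) * w t))"
      by (simp add: has_bochner_integral_iff)
    also have "\<dots> = integral {0..T} (\<lambda>t. cnj (y t) * w t)"
      by (rule integral_cong) simp
    finally show ?thesis unfolding F1 Gs using E(2) by simp
  next
    case False
    then have "(\<lambda>x. F x r) = (\<lambda>x. 0)" by (auto simp: F_def fun_eq_iff)
    then show ?thesis by simp
  qed
  have kp: "(\<integral>r. F x r \<partial>lborel) = slanted_Gamma 1 * (k x *\<^sub>R (cnj (Y (fst x)) * Y (snd x)))" for x
  proof (cases "0 \<le> fst x \<and> fst x \<le> T \<and> 0 \<le> snd x \<and> snd x < fst x")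
    case True
    then have "F x = (\<lambda>r. (cnj (Y (fst x)) * Y (snd x)) * (indicator {0<..} r *\<^sub>R (exp (- slant * complex_of_real (r * (fst x - snd x))) * complex_of_real (r powr (- \<alpha>)))))"
      by (simp add: F_def)
    then have "(\<integral>r. F x r \<partial>lborel) = (cnj (Y (fst x)) * Y (snd x)) * slanted_Gamma (fst x - snd x)"
      by (simp only: slanted_Gamma_def integral_mult_right_zero)
    also have "slanted_Gamma (fst x - snd x) = k x *\<^sub>R slanted_Gamma 1"
      using True by (subst slanted_Gamma_scale) (auto simp: k_def case_prod_unfold)
    finally show ?thesis by (simp add: mult_ac)
  qed (auto simp: F_def k_def case_prod_unfold)
  define H where "H = (\<lambda>x. k x *\<^sub>R (cnj (Y (fst x)) * Y (snd x)))"
  have Hi: "integrable (lborel \<Otimes>\<^sub>M lborel) H"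
  proof (rule Bochner_Integration.integrable_bound)
    show "integrable (lborel \<Otimes>\<^sub>M lborel) (\<lambda>x. (M * M) * k x)" using ki by simp
    show "H \<in> borel_measurable (lborel \<Otimes>\<^sub>M lborel)" unfolding H_def by measurable
    have "k x * (norm (Y (fst x)) * norm (Y (snd x))) \<le> k x * (M * M)" for x
      using k0 YM M0 by (intro mult_left_mono mult_mono) auto
    then show "AE x in lborel \<Otimes>\<^sub>M lborel. norm (H x) \<le> norm (M * M * k x)"
      using k0 M0 by (intro AE_I2) (simp add: H_def norm_mult abs_mult mult_ac)
  qed
  have Hs: "(\<integral>s. H (t, s) \<partial>lborel) = indicator {0..T} t *\<^sub>R (cnj (y t) * integral {0..t} (\<lambda>s. (t - s) powr (\<alpha> - 1) *\<^sub>R y s))" for t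
  proof (cases "t \<in> {0..T}")
    case t: True
    define g where "g = (\<lambda>s. cnj (y t) * ((t - s) powr (\<alpha> - 1) *\<^sub>R y s))"
    have Hg: "H (t, s) = g s" if "s \<in> {0..t} - {}" for s
      using that t ks[of t s] by (auto simp: H_def g_def Yy)
    have "(\<lambda>s. (t - s) powr (\<alpha> - 1) *\<^sub>R (cnj (y t) * y s)) absolutely_integrable_on {0..t}"
      using t by (intro absolutely_integrable_scaleR_continuous absolutely_integrable_powr_Icc \<alpha>
          continuous_intros continuous_on_subset[OF y]) auto
    then have ga: "g absolutely_integrable_on {0..t}" by (simp add: g_def)
    have "(\<lambda>s. H (t, s)) absolutely_integrable_on {0..t}"
      by (rule absolutely_integrable_spike[where S = "{}", OF ga]) (use Hg in auto)
    moreover have "(\<lambda>s. H (t, s)) \<in> borel_measurable borel" unfolding H_def by measurable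
    ultimately have "(\<integral>s. H (t, s) \<partial>lborel) = integral {0..t} (\<lambda>s. H (t, s))"
      using has_bochner_integral_lborel_vanishing[of "\<lambda>s. H (t, s)" "{0..t}"] kz[of _ t] by (auto simp: has_bochner_integral_iff H_def)
    also have "\<dots> = integral {0..t} g"
      by (rule integral_spike[of "{}"]) (use Hg in auto)
    also have "\<dots> = cnj (y t) * integral {0..t} (\<lambda>s. (t - s) powr (\<alpha> - 1) *\<^sub>R y s)"
      unfolding g_def by (rule integral_mult_right)
    finally show ?thesis using t by simp
  next
    case False
    then have "(\<lambda>s. H (t, s)) = (\<lambda>_. 0)" by (auto simp: H_def k_def)
    then show ?thesis using False by simp
  qed
  have iH: "(\<integral>x. H x \<partial>lborel) = integral {0..T} (\<lambda>t. cnj (y t) * integral {0..t} (\<lambda>s. (t - s) powr (\<alpha> - 1) *\<^sub>R y s))"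
  proof -
    let ?h = "\<lambda>t. indicator {0..T} t *\<^sub>R (cnj (y t) * integral {0..t} (\<lambda>s. (t - s) powr (\<alpha> - 1) *\<^sub>R y s))"
    have "integrable lborel (\<lambda>t. \<integral>s. H (t, s) \<partial>lborel)"
      by (rule lborel_pair.integrable_fst'[OF Hi])
    then have h: "integrable lborel ?h" unfolding Hs .
    have "(\<integral>x. H x \<partial>lborel) = (\<integral>t. \<integral>s. H (t, s) \<partial>lborel \<partial>lborel)"
      unfolding lborel_prod[symmetric] by (rule lborel_pair.integral_fst'[OF Hi, symmetric])
    also have "\<dots> = integral\<^sup>L lborel ?h" unfolding Hs ..
    also have "\<dots> = integral UNIV ?h"
      using has_integral_integral_lborel[OF h] by (simp add: integral_unique)
    also have "?h = (\<lambda>t. if t \<in> {0..T} then (cnj (y t) * integral {0..t} (\<lambda>s. (t - s) powr (\<alpha> - 1) *\<^sub>R y s)) else 0)"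
      by (auto simp: indicator_def)
    finally show ?thesis unfolding integral_restrict_UNIV .
  qed
  have "(\<integral>r. \<integral>x. F x r \<partial>lborel \<partial>lborel) = (\<integral>x. \<integral>r. F x r \<partial>lborel \<partial>lborel)"
    by (rule lborel_pair.Fubini_integral[OF Fi])
  also have "\<dots> = slanted_Gamma 1 * (\<integral>x. H x \<partial>lborel)"
    unfolding kp H_def by (rule integral_mult_right_zero)
  finally have "Re (slanted_Gamma 1 * (\<integral>x. H x \<partial>lborel)) = Re (\<integral>r. \<integral>x. F x r \<partial>lborel \<partial>lborel)" by simp
  also have "\<dots> = (\<integral>r. Re (\<integral>x. F x r \<partial>lborel) \<partial>lborel)"
    by (rule integral_Re[symmetric]) (rule lborel_pair.integrable_snd[OF Fi])
  also have "\<dots> \<ge> 0" using B by (intro integral_nonneg_AE) auto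
  finally show ?thesis unfolding iH .
qed


text \<open>Pairing the equation with \<open>cnj y\<close> gives Q = -i (Gamma \<alpha> / l) (A -
  N), with Q the kernel form, N the mass of y and A its pairing with f. For g =
  \<open>slanted_Gamma 1\<close> the positivity of Re (g Q) becomes Im g N \<le> Im (g A), from
  which l has cancelled; for real g the mass N would have dropped out. The resulting constant, the
  square of |g| / Im g, is the same for all l and T.\<close>

lemma volterra_energy:
  obtains C where "0 < C"
    "\<And>y f l T. \<lbrakk>continuous_on {0..T} y; continuous_on {0..T} f; 0 \<le> T; 0 < l;
        \<And>t. t \<in> {0..T} \<Longrightarrow> y t = f t + (- \<i> * complex_of_real l) * frac_integral \<alpha> y t\<rbrakk>
      \<Longrightarrow> integral {0..T} (\<lambda>t. (cmod (y t))\<^sup>2) \<le> C * integral {0..T} (\<lambda>t. (cmod (f t))\<^sup>2)"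
proof
  define L where "L = cmod (slanted_Gamma 1) / Im (slanted_Gamma 1)"
  have Ip: "Im (slanted_Gamma 1) > 0" by (rule Im_slanted_Gamma_pos)
  then have "cmod (slanted_Gamma 1) > 0" by auto
  then show "0 < L\<^sup>2" using Ip by (simp add: L_def)
  fix y f :: "real \<Rightarrow> complex" and l T :: real
  assume y: "continuous_on {0..T} y" and f: "continuous_on {0..T} f" and T: "0 \<le> T" and l: "0 < l"
    and eq: "\<And>t. t \<in> {0..T} \<Longrightarrow> y t = f t + (- \<i> * complex_of_real l) * frac_integral \<alpha> y t"
  have G: "Gamma \<alpha> > 0" using \<alpha> by (intro Gamma_real_pos)
  define Q where "Q = integral {0..T} (\<lambda>t. cnj (y t) * integral {0..t} (\<lambda>s. (t - s) powr (\<alpha> - 1) *\<^sub>R y s))"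
  define A where "A = integral {0..T} (\<lambda>t. cnj (y t) * f t)"
  define N where "N = integral {0..T} (\<lambda>t. (cmod (y t))\<^sup>2)"
  define Nf where "Nf = integral {0..T} (\<lambda>t. (cmod (f t))\<^sup>2)"
  have iA: "(\<lambda>t. cnj (y t) * f t) integrable_on {0..T}"
    by (intro integrable_continuous_interval continuous_intros y f)
  have iN: "(\<lambda>t. (cmod (y t))\<^sup>2) integrable_on {0..T}"
    by (intro integrable_continuous_interval continuous_intros y)
  have iNf: "(\<lambda>t. (cmod (f t))\<^sup>2) integrable_on {0..T}"
    by (intro integrable_continuous_interval continuous_intros f)
  have iNc: "((\<lambda>t. complex_of_real ((cmod (y t))\<^sup>2)) has_integral complex_of_real N) {0..T}"
    unfolding N_def by (intro has_integral_of_real integrable_integral iN)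
  have "Q = integral {0..T} (\<lambda>t. (- \<i> * complex_of_real (Gamma \<alpha> / l)) * (cnj (y t) * f t - complex_of_real ((cmod (y t))\<^sup>2)))"
    unfolding Q_def
  proof (rule integral_cong)
    fix t assume t: "t \<in> {0..T}"
    have "integral {0..t} (\<lambda>s. (t - s) powr (\<alpha> - 1) *\<^sub>R y s) = complex_of_real (Gamma \<alpha>) * frac_integral \<alpha> y t"
      using G by (simp add: frac_integral_def scaleR_conv_of_real)
    also have "frac_integral \<alpha> y t = (- \<i> / complex_of_real l) * (f t - y t)"
    proof -
      have "f t - y t = (\<i> * complex_of_real l) * frac_integral \<alpha> y t" using eq[OF t] by simp
      then show ?thesis using l by simp
    qed
    finally show "cnj (y t) * integral {0..t} (\<lambda>s. (t - s) powr (\<alpha> - 1) *\<^sub>R y s)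
      = (- \<i> * complex_of_real (Gamma \<alpha> / l)) * (cnj (y t) * f t - complex_of_real ((cmod (y t))\<^sup>2))"
      by (simp only:) (simp add: algebra_simps complex_norm_square del: of_real_power)
  qed
  also have "\<dots> = (- \<i> * complex_of_real (Gamma \<alpha> / l)) * (A - complex_of_real N)"
    by (rule integral_unique[OF has_integral_mult_right[OF has_integral_diff[OF integrable_integral[OF iA, folded A_def] iNc]]])
  finally have Q: "Q = (- \<i> * complex_of_real (Gamma \<alpha> / l)) * (A - complex_of_real N)" .
  have "0 \<le> Re (slanted_Gamma 1 * Q)"
    unfolding Q_def by (rule frac_kernel_positive[OF y T])
  also have "Re (slanted_Gamma 1 * Q) = Re (complex_of_real (Gamma \<alpha> / l) * (- \<i> * (slanted_Gamma 1 * (A - complex_of_real N))))"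
    unfolding Q by (simp only: mult_ac)
  also have "\<dots> = Gamma \<alpha> / l * Im (slanted_Gamma 1 * (A - complex_of_real N))"
    by (simp add: Re_divide_of_real algebra_simps add_divide_distrib diff_divide_distrib del: of_real_divide)
  finally have "0 \<le> Im (slanted_Gamma 1 * (A - complex_of_real N))"
    using divide_pos_pos[OF G l] by (simp only: zero_le_mult_iff) linarith
  then have "Im (slanted_Gamma 1) * N \<le> Im (slanted_Gamma 1 * A)" by (simp add: algebra_simps)
  also have "\<dots> \<le> cmod (slanted_Gamma 1) * cmod A"
    using abs_Im_le_cmod[of "slanted_Gamma 1 * A"] by (simp add: norm_mult)
  finally have "N \<le> L * cmod A" using Ip by (simp add: L_def field_simps)
  \<comment> \<open>Young's inequality with the factor L placed on the side of f; the term N / 2 is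
    then absorbed on the left.\<close>
  also have "L * cmod A \<le> (N + L\<^sup>2 * Nf) / 2"
  proof -
    have L0: "L \<ge> 0" using Ip by (simp add: L_def)
    have "cmod (L *\<^sub>R A) \<le> (N + L\<^sup>2 * Nf) / 2"
    proof -
      have "L *\<^sub>R A = integral {0..T} (\<lambda>t. L *\<^sub>R (cnj (y t) * f t))" by (simp add: A_def)
      also have "cmod \<dots> \<le> integral {0..T} (\<lambda>t. ((cmod (y t))\<^sup>2 + L\<^sup>2 * (cmod (f t))\<^sup>2) / 2)"
      proof (rule integral_norm_bound_integral)
        show "(\<lambda>t. L *\<^sub>R (cnj (y t) * f t)) integrable_on {0..T}" by (intro integrable_cmul iA)
        show "(\<lambda>t. ((cmod (y t))\<^sup>2 + L\<^sup>2 * (cmod (f t))\<^sup>2) / 2) integrable_on {0..T}"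
          by (intro integrable_continuous_interval continuous_intros y f) auto
        fix t
        have "0 \<le> (cmod (y t) - L * cmod (f t))\<^sup>2" by simp
        then show "norm (L *\<^sub>R (cnj (y t) * f t)) \<le> ((cmod (y t))\<^sup>2 + L\<^sup>2 * (cmod (f t))\<^sup>2) / 2"
          using L0 by (simp add: norm_mult power2_diff power_mult_distrib algebra_simps)
      qed
      also have "\<dots> = (N + L\<^sup>2 * Nf) / 2"
        using iN iNf by (simp add: N_def Nf_def Henstock_Kurzweil_Integration.integral_add integrable_on_mult_right)
      finally show ?thesis .
    qed
    then show ?thesis using L0 by simp
  qed
  finally show "N \<le> L\<^sup>2 * Nf" by (simp add: field_simps)
qed

end

section \<open>Bounds for the scalar solution\<close>

text \<open>The derivative of t |F|^2 is |F|^2 + 2 (F \<bullet> G), because t F' = G. Integrated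
  over (0,T), its boundary term at 0 vanishes and the one at T is T |F(T)|^2, so mean squares of
  order T give a bound at T in which T itself has cancelled.\<close>

lemma pointwise_bound_from_mean_squares:
  fixes F G :: "real \<Rightarrow> complex"
  assumes F: "continuous_on {0..T} F" and G: "continuous_on {0..T} G" and T: "0 < T"
    and FG: "\<And>t. 0 < t \<Longrightarrow> t < T \<Longrightarrow> (F has_vector_derivative (1 / t) *\<^sub>R G t) (at t)"
    and A: "integral {0..T} (\<lambda>t. (cmod (F t))\<^sup>2) \<le> A * T"
    and B: "integral {0..T} (\<lambda>t. (cmod (G t))\<^sup>2) \<le> B * T"
  shows "(cmod (F T))\<^sup>2 \<le> 2 * A + B"
proof -
  have "((\<lambda>t. F t \<bullet> F t + 2 * (F t \<bullet> G t)) has_integral (T * (F T \<bullet> F T) - 0 * (F 0 \<bullet> F 0))) {0..T}"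
  proof (rule fundamental_theorem_of_calculus_interior)
    show "continuous_on {0..T} (\<lambda>t. t * (F t \<bullet> F t))" by (intro continuous_intros F)
    fix t assume t: "t \<in> {0<..<T}"
    have "((\<lambda>t. t * (F t \<bullet> F t)) has_derivative
        (\<lambda>h. t * (F t \<bullet> (h *\<^sub>R ((1 / t) *\<^sub>R G t)) + (h *\<^sub>R ((1 / t) *\<^sub>R G t)) \<bullet> F t) + h * (F t \<bullet> F t))) (at t)"
      by (intro has_derivative_mult has_derivative_inner has_derivative_ident
         FG[of t, unfolded has_vector_derivative_def]) (use t in auto)
    then show "((\<lambda>t. t * (F t \<bullet> F t)) has_vector_derivative F t \<bullet> F t + 2 * (F t \<bullet> G t)) (at t)"
      unfolding has_vector_derivative_def
      by (rule has_derivative_eq_rhs) (use t in \<open>auto simp: inner_commute algebra_simps\<close>)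
  qed (use T in auto)
  then have 1: "((\<lambda>t. F t \<bullet> F t + 2 * (F t \<bullet> G t)) has_integral (T * (cmod (F T))\<^sup>2)) {0..T}"
    by (simp add: power2_norm_eq_inner)
  have i: "(\<lambda>t. (cmod (F t))\<^sup>2) integrable_on {0..T}" "(\<lambda>t. (cmod (G t))\<^sup>2) integrable_on {0..T}"
    by (intro integrable_continuous_interval continuous_intros F G)+
  have "((\<lambda>t. 2 * (cmod (F t))\<^sup>2 + (cmod (G t))\<^sup>2) has_integral
      2 * integral {0..T} (\<lambda>t. (cmod (F t))\<^sup>2) + integral {0..T} (\<lambda>t. (cmod (G t))\<^sup>2)) {0..T}"
    by (intro has_integral_add has_integral_mult_right integrable_integral i)
  with 1 have "T * (cmod (F T))\<^sup>2 \<le> 2 * integral {0..T} (\<lambda>t. (cmod (F t))\<^sup>2) + integral {0..T} (\<lambda>t. (cmod (G t))\<^sup>2)"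
  proof (rule has_integral_le)
    fix t
    have "0 \<le> (F t - G t) \<bullet> (F t - G t)" by simp
    then show "F t \<bullet> F t + 2 * (F t \<bullet> G t) \<le> 2 * (cmod (F t))\<^sup>2 + (cmod (G t))\<^sup>2"
      unfolding power2_norm_eq_inner by (simp add: inner_diff_left inner_diff_right inner_commute)
  qed
  also have "\<dots> \<le> T * (2 * A + B)" using A B by (simp add: algebra_simps)
  finally show ?thesis using T by simp
qed

lemma cmod_sum2_sq: "(cmod (a + b))\<^sup>2 \<le> 2 * (cmod a)\<^sup>2 + 2 * (cmod b)\<^sup>2"
proof -
  have "(cmod (a + b))\<^sup>2 \<le> (cmod a + cmod b)\<^sup>2" by (intro power_mono norm_triangle_ineq) auto
  also have "\<dots> \<le> 2 * (cmod a)\<^sup>2 + 2 * (cmod b)\<^sup>2"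
    using zero_le_power2[of "cmod a - cmod b"] by (simp add: power2_sum power2_diff)
  finally show ?thesis .
qed

definition ml_sol :: "real \<Rightarrow> real \<Rightarrow> real \<Rightarrow> complex" where
  "ml_sol \<alpha> l t = ml_series \<alpha> (\<lambda>_. 1) (- \<i> * complex_of_real l) t"

text \<open>At t = 0 division by zero gives the value 0, whereas for l \<noteq> 0 the derivative of
  \<open>ml_sol\<close> is singular there like t^(\<alpha> - 1).\<close>

definition ml_sol_deriv :: "real \<Rightarrow> real \<Rightarrow> real \<Rightarrow> complex" where
  "ml_sol_deriv \<alpha> l t = (1 / t) *\<^sub>R ml_series \<alpha> (\<lambda>k. \<alpha> * real k) (- \<i> * complex_of_real l) t"

lemma ml_sol_eq_mittag_leffler:
  "ml_sol \<alpha> l t = mittag_leffler \<alpha> 1 (- \<i> * complex_of_real l * complex_of_real (t powr \<alpha>))"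
  by (simp add: ml_sol_def ml_series_eq_mittag_leffler)

context
  fixes \<alpha> :: real
  assumes \<alpha>: "0 < \<alpha>" "\<alpha> < 1"
begin

lemma ml_series_0: "ml_series \<alpha> b z 0 = complex_of_real (b 0)"
proof -
  have "(\<lambda>k. complex_of_real (b k / Gamma (\<alpha> * real k + 1)) * (z * complex_of_real (0 powr \<alpha>)) ^ k)
    = (\<lambda>k. if k = 0 then complex_of_real (b 0) else 0)"
    by (rule ext) (simp add: power_0_left)
  then show ?thesis
    unfolding ml_series_def using sums_unique[OF sums_single[of 0 "\<lambda>_. complex_of_real (b 0)"]]
    by (simp add: eq_commute)
qed

text \<open>The horizon T of the energy estimate is the very time at which the bound is wanted. The
  mean square of \<open>w\<close> is used twice: as that of t y' for the bound on \<open>y\<close>,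
  and together with that of \<open>v\<close> for the bound on \<open>w\<close> itself.\<close>

lemma ml_series_bounds:
  obtains C where "0 < C"
    "\<And>l t. 0 < l \<Longrightarrow> 0 \<le> t \<Longrightarrow> cmod (ml_series \<alpha> (\<lambda>_. 1) (- \<i> * complex_of_real l) t) \<le> C"
    "\<And>l t. 0 < l \<Longrightarrow> 0 \<le> t \<Longrightarrow> cmod (ml_series \<alpha> (\<lambda>k. \<alpha> * real k) (- \<i> * complex_of_real l) t) \<le> C"
proof -
  obtain C0 where C0: "0 < C0" and E:
    "\<And>y f l T. \<lbrakk>continuous_on {0..T} y; continuous_on {0..T} f; 0 \<le> T; 0 < l;
        \<And>t. t \<in> {0..T} \<Longrightarrow> y t = f t + (- \<i> * complex_of_real l) * frac_integral \<alpha> y t\<rbrakk>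
      \<Longrightarrow> integral {0..T} (\<lambda>t. (cmod (y t))\<^sup>2) \<le> C0 * integral {0..T} (\<lambda>t. (cmod (f t))\<^sup>2)"
    by (rule volterra_energy[OF \<alpha>]) blast
  \<comment> \<open>Successive mean square constants. For \<open>w\<close> the right-hand side
    \<alpha> (y - 1) has square at most 2 |y|^2 + 2; for \<open>v\<close> it is 2 \<alpha> w -
    \<alpha>^2 (y - 1), with square at most 8 |w|^2 + 4 |y|^2 + 4. \<open>C\<close> exceeds both 1 +
    2 C0 + K1 and 1 + 2 K1 + K2, the pointwise bounds after x \<le> 1 + x^2.\<close>
  define K1 where "K1 = C0 * (2 * C0 + 2)"
  define K2 where "K2 = C0 * (8 * K1 + 4 * C0 + 4)"
  define C where "C = 1 + 2 * C0 + 3 * K1 + K2"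
  have K: "K1 > 0" "K2 > 0" using C0 by (auto simp: K1_def K2_def intro!: mult_pos_pos add_pos_pos)
  have sq: "x \<le> 1 + A" if "x\<^sup>2 \<le> A" "0 \<le> x" for x A :: real
  proof -
    have "0 \<le> (x - 1/2)\<^sup>2" by simp
    then show ?thesis using that by (simp add: power2_diff power_divide)
  qed
  have main: "cmod (ml_series \<alpha> (\<lambda>_. 1) (- \<i> * complex_of_real l) T) \<le> C \<and>
     cmod (ml_series \<alpha> (\<lambda>k. \<alpha> * real k) (- \<i> * complex_of_real l) T) \<le> C" if l: "0 < l" and T: "0 < T" for l T
  proof -
    define y where "y = ml_series \<alpha> (\<lambda>_. 1) (- \<i> * complex_of_real l)"
    define w where "w = ml_series \<alpha> (\<lambda>k. \<alpha> * real k) (- \<i> * complex_of_real l)"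
    define v where "v = ml_series \<alpha> (\<lambda>k. (\<alpha> * real k) * (\<alpha> * real k)) (- \<i> * complex_of_real l)"
    note wb = weight_bounds[OF \<alpha>]
    have sub: "{0..T} \<subseteq> {0..}" by auto
    have cont: "continuous_on {0..T} y" "continuous_on {0..T} w" "continuous_on {0..T} v"
      unfolding y_def w_def v_def
      by (rule continuous_on_subset[OF continuous_on_ml_series[OF \<alpha> wb(1)] sub]
               continuous_on_subset[OF continuous_on_ml_series[OF \<alpha> wb(2)] sub]
               continuous_on_subset[OF continuous_on_ml_series[OF \<alpha> wb(3)] sub])+
    have Vy: "y t = 1 + (- \<i> * complex_of_real l) * frac_integral \<alpha> y t" if "t \<in> {0..T}" for t
      unfolding y_def by (rule ml_series_volterra(1)[OF \<alpha>]) (use that in simp)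
    have Vw: "w t = \<alpha> * (y t - 1) + (- \<i> * complex_of_real l) * frac_integral \<alpha> w t" if "t \<in> {0..T}" for t
      unfolding y_def w_def by (rule ml_series_volterra(2)[OF \<alpha>]) (use that in simp)
    have Vv: "v t = 2 * \<alpha> * w t - \<alpha>\<^sup>2 * (y t - 1) + (- \<i> * complex_of_real l) * frac_integral \<alpha> v t" if "t \<in> {0..T}" for t
      unfolding y_def w_def v_def using ml_series_volterra(3)[OF \<alpha>, of t "- \<i> * complex_of_real l"] that by simp
    have i: "(\<lambda>t. (cmod (y t))\<^sup>2) integrable_on {0..T}" "(\<lambda>t. (cmod (w t))\<^sup>2) integrable_on {0..T}"
      by (intro integrable_continuous_interval continuous_intros cont)+
    have i1: "((\<lambda>t. c) has_integral (c * T)) {0..T}" for c :: real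
      using has_integral_const_real[of c 0 T] T by (simp add: mult.commute)
    have "integral {0..T} (\<lambda>t. (cmod (y t))\<^sup>2) \<le> C0 * integral {0..T} (\<lambda>t. (cmod 1)\<^sup>2)"
      by (rule E[OF cont(1) _ less_imp_le[OF T] l Vy]) (intro continuous_intros)
    then have Y: "integral {0..T} (\<lambda>t. (cmod (y t))\<^sup>2) \<le> C0 * T"
      using T by simp
    have "integral {0..T} (\<lambda>t. (cmod (w t))\<^sup>2) \<le> C0 * integral {0..T} (\<lambda>t. (cmod (\<alpha> * (y t - 1)))\<^sup>2)"
      by (rule E[OF cont(2) _ less_imp_le[OF T] l Vw]) (intro continuous_intros cont)
    also have "integral {0..T} (\<lambda>t. (cmod (\<alpha> * (y t - 1)))\<^sup>2) \<le> 2 * integral {0..T} (\<lambda>t. (cmod (y t))\<^sup>2) + 2 * T"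
    proof (rule has_integral_le[OF integrable_integral])
      show "(\<lambda>t. (cmod (\<alpha> * (y t - 1)))\<^sup>2) integrable_on {0..T}"
        by (intro integrable_continuous_interval continuous_intros cont)
      show "((\<lambda>t. 2 * (cmod (y t))\<^sup>2 + 2) has_integral 2 * integral {0..T} (\<lambda>t. (cmod (y t))\<^sup>2) + 2 * T) {0..T}"
        by (intro has_integral_add has_integral_mult_right integrable_integral i i1)
      fix t
      have "(cmod (\<alpha> * (y t - 1)))\<^sup>2 \<le> (cmod (y t - 1))\<^sup>2"
        using \<alpha> by (intro power_mono) (auto simp: norm_mult intro!: mult_left_le_one_le)
      also have "\<dots> \<le> 2 * (cmod (y t))\<^sup>2 + 2"
        using cmod_sum2_sq[of "y t" "-1"] by simp
      finally show "(cmod (\<alpha> * (y t - 1)))\<^sup>2 \<le> 2 * (cmod (y t))\<^sup>2 + 2" .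
    qed
    also have "C0 * (2 * integral {0..T} (\<lambda>t. (cmod (y t))\<^sup>2) + 2 * T) \<le> C0 * (2 * (C0 * T) + 2 * T)"
      using Y C0 by (intro mult_left_mono) auto
    finally have W: "integral {0..T} (\<lambda>t. (cmod (w t))\<^sup>2) \<le> K1 * T"
      using C0 by (simp add: K1_def algebra_simps)
    have "integral {0..T} (\<lambda>t. (cmod (v t))\<^sup>2) \<le> C0 * integral {0..T} (\<lambda>t. (cmod (2 * \<alpha> * w t - \<alpha>\<^sup>2 * (y t - 1)))\<^sup>2)"
      by (rule E[OF cont(3) _ less_imp_le[OF T] l Vv]) (intro continuous_intros cont)
    also have "integral {0..T} (\<lambda>t. (cmod (2 * \<alpha> * w t - \<alpha>\<^sup>2 * (y t - 1)))\<^sup>2)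
        \<le> 8 * integral {0..T} (\<lambda>t. (cmod (w t))\<^sup>2) + 4 * integral {0..T} (\<lambda>t. (cmod (y t))\<^sup>2) + 4 * T"
    proof (rule has_integral_le[OF integrable_integral])
      show "(\<lambda>t. (cmod (2 * \<alpha> * w t - \<alpha>\<^sup>2 * (y t - 1)))\<^sup>2) integrable_on {0..T}"
        by (intro integrable_continuous_interval continuous_intros cont)
      show "((\<lambda>t. 8 * (cmod (w t))\<^sup>2 + 4 * (cmod (y t))\<^sup>2 + 4) has_integral
         8 * integral {0..T} (\<lambda>t. (cmod (w t))\<^sup>2) + 4 * integral {0..T} (\<lambda>t. (cmod (y t))\<^sup>2) + 4 * T) {0..T}"
        by (intro has_integral_add has_integral_mult_right integrable_integral i i1)
      fix t
      define p where "p = complex_of_real (2 * \<alpha>) * w t"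
      define q where "q = complex_of_real (\<alpha>\<^sup>2) * (y t - 1)"
      have a: "\<alpha>\<^sup>2 \<le> 1" using \<alpha> by (simp add: power_le_one)
      have "cmod p \<le> 2 * cmod (w t)" using \<alpha> by (simp add: p_def norm_mult mult_left_le_one_le)
      then have 1: "(cmod p)\<^sup>2 \<le> (2 * cmod (w t))\<^sup>2" by (rule power_mono) simp
      have "cmod q \<le> 1 * cmod (y t - 1)"
        unfolding q_def norm_mult norm_of_real using a by (intro mult_right_mono) auto
      then have 2: "(cmod q)\<^sup>2 \<le> (cmod (y t - 1))\<^sup>2" by (intro power_mono) auto
      have 3: "(cmod (y t - 1))\<^sup>2 \<le> 2 * (cmod (y t))\<^sup>2 + 2" using cmod_sum2_sq[of "y t" "-1"] by simp
      have "(cmod (p - q))\<^sup>2 \<le> 2 * (cmod p)\<^sup>2 + 2 * (cmod q)\<^sup>2" using cmod_sum2_sq[of p "- q"] by simp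
      also have "\<dots> \<le> 8 * (cmod (w t))\<^sup>2 + 4 * (cmod (y t))\<^sup>2 + 4"
      proof -
        have "(cmod p)\<^sup>2 \<le> 4 * (cmod (w t))\<^sup>2" using 1 by (simp add: power_mult_distrib)
        with 2 3 show ?thesis by linarith
      qed
      finally show "(cmod (2 * \<alpha> * w t - \<alpha>\<^sup>2 * (y t - 1)))\<^sup>2 \<le> 8 * (cmod (w t))\<^sup>2 + 4 * (cmod (y t))\<^sup>2 + 4"
        unfolding p_def q_def .
    qed
    also have "C0 * (8 * integral {0..T} (\<lambda>t. (cmod (w t))\<^sup>2) + 4 * integral {0..T} (\<lambda>t. (cmod (y t))\<^sup>2) + 4 * T)
       \<le> C0 * (8 * (K1 * T) + 4 * (C0 * T) + 4 * T)"
      using Y W C0 by (intro mult_left_mono) auto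
    finally have V: "integral {0..T} (\<lambda>t. (cmod (v t))\<^sup>2) \<le> K2 * T"
      using C0 by (simp add: K2_def algebra_simps)
    have dy: "(y has_vector_derivative (1 / t) *\<^sub>R w t) (at t)" if "0 < t" for t
      using has_vector_derivative_ml_series[OF \<alpha> wb(4) that] by (simp add: y_def w_def)
    have dw: "(w has_vector_derivative (1 / t) *\<^sub>R v t) (at t)" if "0 < t" for t
      using has_vector_derivative_ml_series[OF \<alpha> wb(5) that] by (simp add: v_def w_def)
    have "(cmod (y T))\<^sup>2 \<le> 2 * C0 + K1"
      by (rule pointwise_bound_from_mean_squares[OF cont(1,2) T dy Y W])
    from sq[OF this] have 1: "cmod (y T) \<le> C" using K C0 by (simp add: C_def)
    have "(cmod (w T))\<^sup>2 \<le> 2 * K1 + K2"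
      by (rule pointwise_bound_from_mean_squares[OF cont(2,3) T dw W V])
    from sq[OF this] have "cmod (w T) \<le> C" using K C0 by (simp add: C_def)
    with 1 show ?thesis by (simp add: y_def w_def)
  qed
  \<comment> \<open>The energy argument needs T > 0; at t = 0 only the constant term of the series
    survives.\<close>
  have zero: "cmod (ml_series \<alpha> (\<lambda>_. 1) z 0) \<le> C" "cmod (ml_series \<alpha> (\<lambda>k. \<alpha> * real k) z 0) \<le> C" for z
    using K C0 by (auto simp: C_def ml_series_0)
  show thesis
  proof (rule that[of C])
    show "0 < C" using K C0 by (auto simp: C_def)
    fix l t :: real assume "0 < l" "0 \<le> t"
    then show "cmod (ml_series \<alpha> (\<lambda>_. 1) (- \<i> * complex_of_real l) t) \<le> C"
        "cmod (ml_series \<alpha> (\<lambda>k. \<alpha> * real k) (- \<i> * complex_of_real l) t) \<le> C"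
      using main[of l t] zero by (cases "t = 0"; force)+
  qed
qed

lemma ml_sol_0 [simp]: "ml_sol \<alpha> l 0 = 1"
  by (simp add: ml_sol_def ml_series_0)

lemma continuous_on_ml_sol: "continuous_on {0..} (ml_sol \<alpha> l)"
  unfolding ml_sol_def[abs_def] by (rule continuous_on_ml_series[OF \<alpha> weight_bounds(1)[OF \<alpha>]])

lemma has_vector_derivative_ml_sol:
  "0 < t \<Longrightarrow> (ml_sol \<alpha> l has_vector_derivative ml_sol_deriv \<alpha> l t) (at t)"
  unfolding ml_sol_def[abs_def] ml_sol_deriv_def
  using has_vector_derivative_ml_series[OF \<alpha> weight_bounds(4)[OF \<alpha>], of t] by simp

lemma continuous_on_ml_sol_deriv: "continuous_on {0<..} (ml_sol_deriv \<alpha> l)"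
  unfolding ml_sol_deriv_def[abs_def]
  by (intro continuous_intros continuous_on_subset[OF continuous_on_ml_series[OF \<alpha> weight_bounds(2)[OF \<alpha>]]]) auto

lemma ml_sol_volterra:
  "0 \<le> t \<Longrightarrow> ml_sol \<alpha> l t = 1 + (- \<i> * complex_of_real l) * frac_integral \<alpha> (ml_sol \<alpha> l) t"
  unfolding ml_sol_def[abs_def] by (rule ml_series_volterra(1)[OF \<alpha>])

lemma ml_sol_caputo:
  assumes "0 < t" "0 < l"
  shows "(\<lambda>s. (t - s) powr (- \<alpha>) *\<^sub>R ml_sol_deriv \<alpha> l s) absolutely_integrable_on {0..t}"
    and "integral {0..t} (\<lambda>s. (t - s) powr (- \<alpha>) *\<^sub>R ml_sol_deriv \<alpha> l s)
      = Gamma (1 - \<alpha>) * (- \<i> * complex_of_real l) * ml_sol \<alpha> l t"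
  using ml_series_caputo[OF \<alpha> assms(1), of "- \<i> * complex_of_real l"] assms(2)
  by (simp_all add: ml_sol_deriv_def ml_sol_def)

text \<open>The third bound is stated for every r, because it has to dominate primitives in the
  Hilbert space; at r = t the Caputo identity turns it into the decay estimate. The interval is
  split at t / 2: below, the bound C / s on the derivative is not integrable, so parts are used;
  above, the derivative is at most 2 C / t and the singularity of the kernel at s = t is
  integrable.\<close>

lemma ml_sol_estimates:
  obtains C where "0 < C"
    "\<And>l t. 0 < l \<Longrightarrow> 0 \<le> t \<Longrightarrow> cmod (ml_sol \<alpha> l t) \<le> C"
    "\<And>l t. 0 < l \<Longrightarrow> 0 < t \<Longrightarrow> cmod (ml_sol_deriv \<alpha> l t) \<le> C / t"
    "\<And>l r t. 0 < l \<Longrightarrow> 0 < t \<Longrightarrow> 0 \<le> r \<Longrightarrow> r \<le> t \<Longrightarrow>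
        cmod (integral {0..r} (\<lambda>s. (t - s) powr (- \<alpha>) *\<^sub>R ml_sol_deriv \<alpha> l s)) \<le> C * t powr (- \<alpha>)"
    "\<And>l t. 0 < l \<Longrightarrow> 0 < t \<Longrightarrow> l * cmod (ml_sol \<alpha> l t) \<le> C * t powr (- \<alpha>)"
proof -
  obtain C where C: "0 < C"
    and C1: "\<And>l t. 0 < l \<Longrightarrow> 0 \<le> t \<Longrightarrow> cmod (ml_series \<alpha> (\<lambda>_. 1) (- \<i> * complex_of_real l) t) \<le> C"
    and C2: "\<And>l t. 0 < l \<Longrightarrow> 0 \<le> t \<Longrightarrow> cmod (ml_series \<alpha> (\<lambda>k. \<alpha> * real k) (- \<i> * complex_of_real l) t) \<le> C"
    by (rule ml_series_bounds) blast
  have b1: "cmod (ml_sol \<alpha> l t) \<le> C" if "0 < l" "0 \<le> t" for l t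
    unfolding ml_sol_def by (rule C1[OF that])
  have b2: "cmod (ml_sol_deriv \<alpha> l t) \<le> C / t" if "0 < l" "0 < t" for l t
    unfolding ml_sol_deriv_def using C2[OF that(1), of t] that by (simp add: divide_right_mono)
  \<comment> \<open>The 4 C comes from the half below t / 2, being 2 C times
    \<open>2 powr \<alpha>\<close> rounded up; 2 C / (1 - \<alpha>) comes from the half
    above.\<close>
  define C' where "C' = 4 * C + 2 * C / (1 - \<alpha>)"
  have C': "C' > 0" "C \<le> C'" using C \<alpha> by (auto simp: C'_def intro!: add_pos_nonneg add_increasing2)
  have b3: "cmod (integral {0..r} (\<lambda>s. (t - s) powr (- \<alpha>) *\<^sub>R ml_sol_deriv \<alpha> l s)) \<le> C' * t powr (- \<alpha>)"
    if l: "0 < l" and t: "0 < t" and r: "0 \<le> r" "r \<le> t" for l r t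
  proof -
    define h where "h = (\<lambda>s. (t - s) powr (- \<alpha>) *\<^sub>R ml_sol_deriv \<alpha> l s)"
    have hi: "h integrable_on {0..t}"
      using ml_sol_caputo(1)[OF t l] unfolding h_def by (rule set_lebesgue_integral_eq_integral(1))
    have half: "cmod (integral {0..r} h) \<le> 4 * C * t powr (- \<alpha>)" if r: "0 \<le> r" "r \<le> t / 2" for r
    proof -
      have sub: "{0..r} \<subseteq> {0..}" by auto
      note ce = continuous_on_subset[OF continuous_on_ml_sol sub]
      have cp: "continuous_on {0..r} (\<lambda>s. (t - s) powr b)" for b
        using t r by (intro continuous_intros) auto
      have dp: "((\<lambda>s. (t - s) powr (- \<alpha>)) has_field_derivative \<alpha> * (t - s) powr (- \<alpha> - 1)) (at s within X)" if "s < t" for s X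
        using that by (auto intro!: derivative_eq_intros simp: powr_diff)
      define g where "g = (\<lambda>s. (\<alpha> * (t - s) powr (- \<alpha> - 1)) *\<^sub>R ml_sol \<alpha> l s)"
      have "((\<lambda>s. (t - s) powr (- \<alpha>) *\<^sub>R ml_sol_deriv \<alpha> l s + (\<alpha> * (t - s) powr (- \<alpha> - 1)) *\<^sub>R ml_sol \<alpha> l s) has_integral
         ((t - r) powr (- \<alpha>) *\<^sub>R ml_sol \<alpha> l r - (t - 0) powr (- \<alpha>) *\<^sub>R ml_sol \<alpha> l 0)) {0..r}"
      proof (rule fundamental_theorem_of_calculus_interior)
        show "continuous_on {0..r} (\<lambda>s. (t - s) powr (- \<alpha>) *\<^sub>R ml_sol \<alpha> l s)"
          by (intro continuous_intros cp ce)
        fix s assume s: "s \<in> {0<..<r}"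
        show "((\<lambda>s. (t - s) powr (- \<alpha>) *\<^sub>R ml_sol \<alpha> l s) has_vector_derivative
            (t - s) powr (- \<alpha>) *\<^sub>R ml_sol_deriv \<alpha> l s + (\<alpha> * (t - s) powr (- \<alpha> - 1)) *\<^sub>R ml_sol \<alpha> l s) (at s)"
          by (rule has_vector_derivative_scaleR[OF dp has_vector_derivative_ml_sol]) (use s r t in auto)
      qed (use r in auto)
      moreover have gi: "(g has_integral integral {0..r} g) {0..r}"
        unfolding g_def by (intro integrable_integral integrable_continuous_interval continuous_intros cp ce)
      ultimately have "(h has_integral ((t - r) powr (- \<alpha>) *\<^sub>R ml_sol \<alpha> l r - t powr (- \<alpha>) *\<^sub>R ml_sol \<alpha> l 0) - integral {0..r} g) {0..r}"
        using has_integral_diff[OF _ gi] unfolding h_def g_def by force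
      then have e: "integral {0..r} h = ((t - r) powr (- \<alpha>) *\<^sub>R ml_sol \<alpha> l r - t powr (- \<alpha>) *\<^sub>R ml_sol \<alpha> l 0) - integral {0..r} g"
        by (rule integral_unique)
      have "((\<lambda>s. \<alpha> * (t - s) powr (- \<alpha> - 1)) has_integral (t - r) powr (- \<alpha>) - (t - 0) powr (- \<alpha>)) {0..r}"
        by (rule fundamental_theorem_of_calculus)
          (use r t dp in \<open>auto simp: has_real_derivative_iff_has_vector_derivative[symmetric]\<close>)
      then have hb: "((\<lambda>s. C * (\<alpha> * (t - s) powr (- \<alpha> - 1))) has_integral C * ((t - r) powr (- \<alpha>) - (t - 0) powr (- \<alpha>))) {0..r}"
        by (rule has_integral_mult_right)
      have nb: "norm (g s) \<le> C * (\<alpha> * (t - s) powr (- \<alpha> - 1))" if "s \<in> {0..r}" for s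
      proof -
        have "norm (g s) = (\<alpha> * (t - s) powr (- \<alpha> - 1)) * cmod (ml_sol \<alpha> l s)"
          using \<alpha> by (simp add: g_def abs_mult)
        also have "\<dots> \<le> (\<alpha> * (t - s) powr (- \<alpha> - 1)) * C"
          using b1[OF l, of s] that \<alpha> by (intro mult_left_mono) auto
        finally show ?thesis by (simp add: mult_ac)
      qed
      have gb: "cmod (integral {0..r} g) \<le> C * ((t - r) powr (- \<alpha>) - t powr (- \<alpha>))"
        using integral_norm_bound_integral[OF has_integral_integrable[OF gi] has_integral_integrable[OF hb] nb]
        unfolding integral_unique[OF hb] by simp
      have n1: "cmod ((t - r) powr (- \<alpha>) *\<^sub>R ml_sol \<alpha> l r) \<le> (t - r) powr (- \<alpha>) * C"
        using b1[OF l, of r] r by (simp add: mult_left_mono)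
      have n2: "cmod (t powr (- \<alpha>) *\<^sub>R ml_sol \<alpha> l 0) \<le> t powr (- \<alpha>) * C"
        using mult_left_mono[OF b1[OF l, of 0], of "t powr (- \<alpha>)"] by (simp del: ml_sol_0)
      have "cmod (integral {0..r} h) \<le> (t - r) powr (- \<alpha>) * C + t powr (- \<alpha>) * C + C * ((t - r) powr (- \<alpha>) - t powr (- \<alpha>))"
        unfolding e
        by (rule order_trans[OF norm_triangle_ineq4], rule add_mono[OF _ gb],
            rule order_trans[OF norm_triangle_ineq4], rule add_mono[OF n1 n2])
      \<comment> \<open>The kernel increases in s, so the bound for the integral of its derivative
        is a difference of end point values, and the one at 0 cancels the boundary term
        there.\<close>
      also have "\<dots> = 2 * C * (t - r) powr (- \<alpha>)" by (simp add: algebra_simps)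
      also have "(t - r) powr (- \<alpha>) \<le> (t / 2) powr (- \<alpha>)"
        using t r \<alpha> by (intro powr_mono2') auto
      also have "(t / 2) powr (- \<alpha>) = 2 powr \<alpha> * t powr (- \<alpha>)"
        using t by (simp add: powr_divide powr_minus field_simps)
      also have "2 powr \<alpha> \<le> (2::real) powr 1" using \<alpha> by (intro powr_mono) auto
      finally show ?thesis using C by (simp add: mult_right_mono mult_left_mono)
    qed
    show ?thesis
    proof (cases "r \<le> t / 2")
      case True
      then have "cmod (integral {0..r} h) \<le> 4 * C * t powr (- \<alpha>)" using half r by simp
      also have "\<dots> \<le> C' * t powr (- \<alpha>)"
        using C \<alpha> by (intro mult_right_mono) (auto simp: C'_def)
      finally show ?thesis unfolding h_def .
    next
      case False
      have hr: "h integrable_on {0..r}" "h integrable_on {t/2..r}"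
        using r False t by (auto intro: integrable_on_subinterval[OF hi])
      have split: "integral {0..t/2} h + integral {t/2..r} h = integral {0..r} h"
        using r False t hr by (intro Henstock_Kurzweil_Integration.integral_combine) auto
      have pw: "((\<lambda>s. (t - s) powr ((1 - \<alpha>) - 1)) has_integral (t - t/2) powr (1 - \<alpha>) / (1 - \<alpha>)) {t/2..t}"
        using \<alpha> t by (intro has_integral_powr_Icc) auto
      have "cmod (integral {t/2..r} h) \<le> integral {t/2..r} (\<lambda>s. (2 * C / t) * (t - s) powr (- \<alpha>))"
      proof (rule integral_norm_bound_integral[OF hr(2)])
        show "(\<lambda>s. 2 * C / t * (t - s) powr (- \<alpha>)) integrable_on {t/2..r}"
          using r integrable_on_subinterval[OF has_integral_integrable[OF pw], of "t/2" r]
          by (intro integrable_on_mult_right) auto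
        fix s assume s: "s \<in> {t/2..r}"
        have "cmod (ml_sol_deriv \<alpha> l s) \<le> C / s" using b2[OF l] s t by auto
        also have "\<dots> \<le> C / (t / 2)" using s t C by (intro divide_left_mono) auto
        finally have "(t - s) powr (- \<alpha>) * cmod (ml_sol_deriv \<alpha> l s) \<le> (t - s) powr (- \<alpha>) * (C / (t / 2))"
          by (intro mult_left_mono) auto
        then show "norm (h s) \<le> 2 * C / t * (t - s) powr (- \<alpha>)" by (simp add: h_def mult_ac)
      qed
      also have "\<dots> \<le> integral {t/2..t} (\<lambda>s. (2 * C / t) * (t - s) powr (- \<alpha>))"
        using r t C has_integral_integrable[OF pw] integrable_on_subinterval[OF has_integral_integrable[OF pw], of "t/2" r]
        by (intro integral_subset_le integrable_on_mult_right) auto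
      also have "\<dots> = (2 * C / t) * ((t/2) powr (1 - \<alpha>) / (1 - \<alpha>))"
      proof (rule integral_unique)
        have "t - t / 2 = t / 2" "1 - \<alpha> - 1 = - \<alpha>" by simp_all
        then show "((\<lambda>s. 2 * C / t * (t - s) powr (- \<alpha>)) has_integral 2 * C / t * ((t / 2) powr (1 - \<alpha>) / (1 - \<alpha>))) {t/2..t}"
          using has_integral_mult_right[OF pw, of "2 * C / t"] by (simp only:)
      qed
      also have "(t/2) powr (1 - \<alpha>) \<le> t powr (1 - \<alpha>)" using t \<alpha> by (intro powr_mono2) auto
      also have "(2 * C / t) * (t powr (1 - \<alpha>) / (1 - \<alpha>)) = 2 * C / (1 - \<alpha>) * t powr (- \<alpha>)"
        using t by (simp add: powr_diff powr_minus field_simps)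
      finally have 2: "cmod (integral {t/2..r} h) \<le> 2 * C / (1 - \<alpha>) * t powr (- \<alpha>)"
        using C t \<alpha> by (simp add: divide_right_mono mult_left_mono)
      have "cmod (integral {0..r} h) \<le> 4 * C * t powr (- \<alpha>) + 2 * C / (1 - \<alpha>) * t powr (- \<alpha>)"
        unfolding split[symmetric]
        by (rule order_trans[OF norm_triangle_ineq add_mono[OF half 2]]) (use t in auto)
      then show ?thesis unfolding h_def[symmetric] C'_def by (simp add: algebra_simps)
    qed
  qed
  have G: "Gamma (1 - \<alpha>) > 0" using \<alpha> by (intro Gamma_real_pos) auto
  have b4: "l * cmod (ml_sol \<alpha> l t) \<le> C' / Gamma (1 - \<alpha>) * t powr (- \<alpha>)" if l: "0 < l" and t: "0 < t" for l t
  proof -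
    have "cmod (Gamma (1 - \<alpha>) * (- \<i> * complex_of_real l) * ml_sol \<alpha> l t) \<le> C' * t powr (- \<alpha>)"
      using b3[OF l t, of t] t ml_sol_caputo(2)[OF t l] by simp
    then show ?thesis using G l by (simp add: norm_mult field_simps)
  qed
  define C'' where "C'' = C' + C' / Gamma (1 - \<alpha>)"
  have C'': "C' \<le> C''" "C' / Gamma (1 - \<alpha>) \<le> C''" using C' G by (auto simp: C''_def)
  show thesis
  proof (rule that[of C''])
    show "0 < C''" using C' C'' by linarith
    show "cmod (ml_sol \<alpha> l t) \<le> C''" if "0 < l" "0 \<le> t" for l t
      using b1[OF that] C' C'' by linarith
    show "cmod (ml_sol_deriv \<alpha> l t) \<le> C'' / t" if "0 < l" "0 < t" for l t
      by (rule order_trans[OF b2[OF that] divide_right_mono]) (use C' C'' that in auto)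
    show "cmod (integral {0..r} (\<lambda>s. (t - s) powr (- \<alpha>) *\<^sub>R ml_sol_deriv \<alpha> l s)) \<le> C'' * t powr (- \<alpha>)"
      if "0 < l" "0 < t" "0 \<le> r" "r \<le> t" for l r t
      by (rule order_trans[OF b3[OF that] mult_right_mono]) (use C'' in auto)
    show "l * cmod (ml_sol \<alpha> l t) \<le> C'' * t powr (- \<alpha>)" if "0 < l" "0 < t" for l t
      by (rule order_trans[OF b4[OF that] mult_right_mono]) (use C'' in auto)
  qed
qed

end

section \<open>Uniqueness for the scalar equation\<close>

lemma has_locally_integrable_derivative_mono:
  assumes "has_locally_integrable_derivative u u' t" "r \<le> t"
  shows "has_locally_integrable_derivative u u' r"
  unfolding has_locally_integrable_derivative_def
proof (intro ballI conjI)
  fix \<epsilon> assume e: "\<epsilon> \<in> {0<..r}"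
  then have e': "\<epsilon> \<in> {0<..t}" using assms(2) by auto
  have 1: "(\<lambda>s. norm (u' s)) integrable_on {\<epsilon>..t}"
    and 2: "\<And>q. q \<in> {\<epsilon>..t} \<Longrightarrow> (u' has_integral (u q - u \<epsilon>)) {\<epsilon>..q}"
    using assms(1) e' unfolding has_locally_integrable_derivative_def by auto
  show "(\<lambda>s. norm (u' s)) integrable_on {\<epsilon>..r}"
    by (rule integrable_on_subinterval[OF 1]) (use assms(2) in auto)
  fix q assume "q \<in> {\<epsilon>..r}"
  then show "(u' has_integral (u q - u \<epsilon>)) {\<epsilon>..q}" using assms(2) by (intro 2) auto
qed

lemma has_locally_integrable_derivativeD:
  assumes "has_locally_integrable_derivative u u' t" "0 < a" "a \<le> b" "b \<le> t"
  shows "(u' has_integral (u b - u a)) {a..b}" "(\<lambda>s. norm (u' s)) integrable_on {a..b}"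
proof -
  have a: "a \<in> {0<..t}" "b \<in> {a..t}" using assms by auto
  then show "(u' has_integral (u b - u a)) {a..b}"
    using assms(1) unfolding has_locally_integrable_derivative_def by blast
  have "(\<lambda>s. norm (u' s)) integrable_on {a..t}"
    using assms(1) a unfolding has_locally_integrable_derivative_def by blast
  then show "(\<lambda>s. norm (u' s)) integrable_on {a..b}"
    by (rule integrable_on_subinterval) (use assms in auto)
qed

text \<open>Lebesgue's differentiation theorem for the gauge integral: off a null set, f(x) is the
  limit of the means over [x, x + h], and these are all 0.\<close>

lemma integral_zero_imp_negligible:
  fixes h :: "real \<Rightarrow> 'b::euclidean_space"
  assumes "\<And>c d. a \<le> c \<Longrightarrow> c \<le> d \<Longrightarrow> d \<le> b \<Longrightarrow> (h has_integral 0) {c..d}"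
  shows "negligible {x \<in> {a..b}. h x \<noteq> 0}"
proof -
  define f where "f = (\<lambda>s. if s \<in> {a..b} then h s else 0)"
  have f0: "(f has_integral 0) (cbox c d)" for c d
  proof -
    have "(h has_integral 0) {max a c..min b d}"
      using assms[of "max a c" "min b d"] by (cases "max a c \<le> min b d") auto
    moreover have "{a..b} \<inter> cbox c d = {max a c..min b d}" by auto
    ultimately show ?thesis unfolding f_def has_integral_restrict_Int by simp
  qed
  then have "f integrable_on cbox c d" for c d by (auto simp: integrable_on_def)
  then obtain N where N: "negligible N"
    "\<And>x e. \<lbrakk>x \<notin> N; 0 < e\<rbrakk> \<Longrightarrow> \<exists>d>0. \<forall>h. 0 < h \<and> h < d \<longrightarrow>
        norm (integral (cbox x (x + h *\<^sub>R One)) f /\<^sub>R h ^ DIM(real) - f x) < e"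
    by (rule integrable_ccontinuous_explicit) blast
  have fz: "f x = 0" if x: "x \<notin> N" for x
  proof (rule ccontr)
    assume "f x \<noteq> 0"
    then obtain d where d: "d > 0" "\<And>h. 0 < h \<Longrightarrow> h < d \<Longrightarrow>
        norm (integral (cbox x (x + h *\<^sub>R One)) f /\<^sub>R h ^ DIM(real) - f x) < norm (f x)"
      using N(2)[OF x, of "norm (f x)"] by auto
    from d(2)[of "d / 2"] d(1) show False
      using integral_unique[OF f0] by simp
  qed
  show ?thesis
  proof (rule negligible_subset[OF N(1)], rule subsetI, rule ccontr)
    fix x assume "x \<in> {x \<in> {a..b}. h x \<noteq> 0}" "x \<notin> N"
    then show False using fz[of x] by (simp add: f_def)
  qed
qed

text \<open>The derivative is tested only on intervals away from 0, so (0,t] is exhausted by the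
  countably many [t / (n + 1), t].\<close>

lemma locally_integrable_derivative_unique:
  fixes u :: "real \<Rightarrow> 'b::euclidean_space"
  assumes "has_locally_integrable_derivative u g t" "has_locally_integrable_derivative u g' t"
  shows "negligible {s \<in> {0<..t}. g s \<noteq> g' s}"
proof (rule negligible_subset)
  let ?N = "\<lambda>n::nat. {s \<in> {t / (real n + 1)..t}. g s - g' s \<noteq> 0}"
  have neg: "negligible (?N n)" for n
    proof (rule integral_zero_imp_negligible)
      fix c d assume cd: "t / (real n + 1) \<le> c" "c \<le> d" "d \<le> t"
      show "((\<lambda>s. g s - g' s) has_integral 0) {c..d}"
      proof (cases "0 < c")
        case True
        show ?thesis
          using has_integral_diff[OF has_locally_integrable_derivativeD(1)[OF assms(1) True cd(2,3)]
            has_locally_integrable_derivativeD(1)[OF assms(2) True cd(2,3)]] by simp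
      next
        case False
        \<comment> \<open>A degenerate situation: c \<le> 0 forces t \<le> 0, and then [c,d] is a
          single point.\<close>
        then have t0: "t \<le> 0"
          using cd(1) divide_pos_pos[of t "real n + 1"] by linarith
        have "t * real n \<le> 0" using t0 by (simp add: mult_nonpos_nonneg)
        then have "t \<le> t / (real n + 1)" by (simp add: pos_le_divide_eq algebra_simps)
        then have "c = d" using cd by simp
        then show ?thesis by (simp add: has_integral_refl)
      qed
    qed
  show "negligible (\<Union>n. ?N n)"
  proof (rule negligible_countable_Union)
    show "countable (range ?N)" by simp
    fix S assume "S \<in> range ?N"
    then obtain n where "S = ?N n" by blast
    then show "negligible S" by (simp only: neg)
  qed
  show "{s \<in> {0<..t}. g s \<noteq> g' s} \<subseteq> (\<Union>n. ?N n)"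
  proof
    fix s assume s: "s \<in> {s \<in> {0<..t}. g s \<noteq> g' s}"
    obtain n :: nat where "t / s < real n" using reals_Archimedean2 by blast
    then have "t / (real n + 1) \<le> s" using s by (simp add: field_simps)
    then show "s \<in> (\<Union>n. ?N n)" using s by auto
  qed
qed

text \<open>The witness for the derivative in \<open>has_caputo_derivative\<close> may change with
  t. Almost everywhere uniqueness replaces it by one fixed \<open>g\<close>, valid up to a later
  time r, so that a single function serves all earlier t.\<close>

lemma has_caputo_derivative_cong_derivative:
  fixes u :: "real \<Rightarrow> 'b::euclidean_space"
  assumes "has_caputo_derivative \<alpha> u d t" "has_locally_integrable_derivative u g r" "t \<le> r" and \<alpha>: "\<alpha> < 1"
  shows "((\<lambda>s. (t - s) powr (- \<alpha>) *\<^sub>R g s) has_integral Gamma (1 - \<alpha>) *\<^sub>R d) {0..t}"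
proof -
  obtain u' where u': "has_locally_integrable_derivative u u' t"
    "(\<lambda>s. (t - s) powr (- \<alpha>) *\<^sub>R u' s) integrable_on {0..t}"
    "d = (1 / Gamma (1 - \<alpha>)) *\<^sub>R integral {0..t} (\<lambda>s. (t - s) powr (- \<alpha>) *\<^sub>R u' s)"
    using assms(1) unfolding has_caputo_derivative_def by blast
  have G: "Gamma (1 - \<alpha>) > 0" using \<alpha> by (intro Gamma_real_pos) auto
  have "((\<lambda>s. (t - s) powr (- \<alpha>) *\<^sub>R u' s) has_integral Gamma (1 - \<alpha>) *\<^sub>R d) {0..t}"
    using integrable_integral[OF u'(2)] G unfolding u'(3) by simp
  then show ?thesis
  proof (rule has_integral_spike[rotated 2])
    show "negligible (insert 0 {s \<in> {0<..t}. u' s \<noteq> g s})"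
      unfolding negligible_insert
      by (rule locally_integrable_derivative_unique[OF u'(1) has_locally_integrable_derivative_mono[OF assms(2,3)]])
  qed auto
qed

lemma has_caputo_derivative_unique:
  fixes u :: "real \<Rightarrow> 'b::euclidean_space"
  assumes "has_caputo_derivative \<alpha> u d t" "has_caputo_derivative \<alpha> u d' t" and \<alpha>: "\<alpha> < 1"
  shows "d = d'"
proof -
  obtain u' where u': "has_locally_integrable_derivative u u' t"
    using assms(1) unfolding has_caputo_derivative_def by blast
  have "Gamma (1 - \<alpha>) > 0" using \<alpha> by (intro Gamma_real_pos) auto
  with has_integral_unique[OF has_caputo_derivative_cong_derivative[OF assms(1) u' order_refl \<alpha>]
      has_caputo_derivative_cong_derivative[OF assms(2) u' order_refl \<alpha>]]
  show ?thesis by simp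
qed

text \<open>The second mean value theorem, for the real and imaginary parts, replaces integration by parts
  in the gauge integral, where \<open>g\<close> need not be a derivative at any given point.\<close>

lemma integral_mono_weight_bound:
  fixes h :: "real \<Rightarrow> real" and g :: "real \<Rightarrow> complex"
  assumes g: "g integrable_on {a..b}" and ab: "a \<le> b"
    and h: "\<And>x y. \<lbrakk>a \<le> x; x \<le> y; y \<le> b\<rbrakk> \<Longrightarrow> h x \<le> h y" and h0: "0 \<le> h a"
    and M: "\<And>c. c \<in> {a..b} \<Longrightarrow> cmod (integral {a..c} g) \<le> M" "\<And>c. c \<in> {a..b} \<Longrightarrow> cmod (integral {c..b} g) \<le> M"
  shows "cmod (integral {a..b} (\<lambda>x. h x *\<^sub>R g x)) \<le> 4 * (h b * M)"
proof -
  have sub: "g integrable_on {c..d}" if "a \<le> c" "d \<le> b" for c d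
    by (rule integrable_on_subinterval[OF g]) (use that in auto)
  have M0: "M \<ge> 0" using M(1)[of a] ab norm_ge_zero order_trans by (metis atLeastAtMost_iff order_refl)
  have hb: "h a \<le> h b" using h ab by simp
  \<comment> \<open>Two end point terms, each at most \<open>h b * M\<close>, for the real and again
    for the imaginary part: hence the factor 4.\<close>
  have part: "\<exists>I. ((\<lambda>x. h x * p (g x)) has_integral I) {a..b} \<and> \<bar>I\<bar> \<le> 2 * (h b * M)"
    if p: "bounded_linear p" "\<And>z. \<bar>p z\<bar> \<le> cmod z" for p :: "complex \<Rightarrow> real"
  proof -
    have pi: "(p \<circ> g) integrable_on {a..b}" by (rule integrable_linear[OF g p(1)])
    obtain c where c: "c \<in> {a..b}"
      "((\<lambda>x. h x * (p \<circ> g) x) has_integral (h a * integral {a..c} (p \<circ> g) + h b * integral {c..b} (p \<circ> g))) {a..b}"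
      by (rule second_mean_value_theorem_full[OF pi ab h]) auto
    have 1: "integral {a..c} (p \<circ> g) = p (integral {a..c} g)" "integral {c..b} (p \<circ> g) = p (integral {c..b} g)"
      using c(1) by (auto intro!: integral_linear sub p(1))
    have "\<bar>h a * p (integral {a..c} g)\<bar> \<le> h b * M"
      unfolding abs_mult using order_trans[OF p(2) M(1)[OF c(1)]] h0 hb M0 by (intro mult_mono) auto
    moreover have "\<bar>h b * p (integral {c..b} g)\<bar> \<le> h b * M"
      unfolding abs_mult using order_trans[OF p(2) M(2)[OF c(1)]] h0 hb M0 by (intro mult_mono) auto
    ultimately show ?thesis using c(2) unfolding 1 by (intro exI conjI) (auto simp: o_def)
  qed
  obtain I J where I: "((\<lambda>x. h x * Re (g x)) has_integral I) {a..b}" "\<bar>I\<bar> \<le> 2 * (h b * M)"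
    and J: "((\<lambda>x. h x * Im (g x)) has_integral J) {a..b}" "\<bar>J\<bar> \<le> 2 * (h b * M)"
    using part[OF bounded_linear_Re abs_Re_le_cmod] part[OF bounded_linear_Im abs_Im_le_cmod] by blast
  have "((\<lambda>x. complex_of_real (h x * Re (g x)) + \<i> * complex_of_real (h x * Im (g x))) has_integral complex_of_real I + \<i> * complex_of_real J) {a..b}"
    by (intro has_integral_add has_integral_mult_right has_integral_of_real I J)
  moreover have "(\<lambda>x. complex_of_real (h x * Re (g x)) + \<i> * complex_of_real (h x * Im (g x))) = (\<lambda>x. h x *\<^sub>R g x)"
    by (auto simp: complex_eq_iff)
  ultimately have "integral {a..b} (\<lambda>x. h x *\<^sub>R g x) = complex_of_real I + \<i> * complex_of_real J"
    by (simp add: integral_unique)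
  also have "cmod \<dots> \<le> \<bar>I\<bar> + \<bar>J\<bar>"
    by (rule order_trans[OF norm_triangle_ineq]) (simp add: norm_mult)
  finally show ?thesis using I(2) J(2) by linarith
qed

text \<open>Fubini on the triangle a \<le> s \<le> \<tau> \<le> b: the integral of (\<tau> -
  s)^(-\<alpha>) (b - \<tau>)^(\<alpha> - 1) over \<tau> in [s,b] has the same value
  \<open>Beta (1 - \<alpha>) \<alpha>\<close> for every s < b, because the two exponents add up to
  -1.\<close>

lemma abel_inversion_real:
  fixes g :: "real \<Rightarrow> real"
  assumes \<alpha>: "0 < \<alpha>" "\<alpha> < 1" and g: "g absolutely_integrable_on {a..b}" and ab: "a < b"
  shows "((\<lambda>\<tau>. (b - \<tau>) powr (\<alpha> - 1) * integral {a..\<tau>} (\<lambda>s. (\<tau> - s) powr (- \<alpha>) * g s)) has_integral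
     Beta (1 - \<alpha>) \<alpha> * integral {a..b} g) {a..b}"
proof -
  have "(\<lambda>x. indicator {a..b} x * g x) \<in> borel_measurable (completion lborel)"
    using borel_measurable_integrable[OF g[unfolded set_integrable_def]] by simp
  \<comment> \<open>A Borel representative of g, since Fubini takes place over
    \<open>lborel\<close>; the null set where the two differ is removed by spikes below.\<close>
  then obtain g1 where g1: "g1 \<in> borel_measurable lborel" "AE x in lborel. indicator {a..b} x * g x = g1 x"
    using completion_ex_borel_measurable_real by blast
  define h where "h = (\<lambda>x. indicator {a..b} x * g1 x)"
  have hm[measurable]: "h \<in> borel_measurable borel" using g1(1) unfolding h_def by measurable
  have "AE x in lborel. x \<in> {a..b} \<longrightarrow> h x = g x"
    using g1(2) by eventually_elim (auto simp: h_def indicator_def)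
  then have "AE x in lebesgue. x \<in> {a..b} \<longrightarrow> h x = g x" by (rule AE_completion)
  then obtain N where N: "negligible N" "\<And>x. x \<in> {a..b} \<Longrightarrow> x \<notin> N \<Longrightarrow> h x = g x"
    unfolding eventually_ae_filter negligible_iff_null_sets by auto
  have ha: "h absolutely_integrable_on {a..b}"
    by (rule absolutely_integrable_spike[OF g N(1)]) (use N in auto)
  have hz: "h x = 0" if "x \<notin> {a..b}" for x using that by (simp add: h_def)
  have hb: "has_bochner_integral lborel h (integral {a..b} h)"
    by (rule has_bochner_integral_lborel_vanishing[OF hm ha hz])
  have hg: "integral {a..b} h = integral {a..b} g"
    by (rule integral_spike[OF N(1)]) (use N in auto)
  define k where "k = (\<lambda>s \<tau>. if a \<le> s \<and> s \<le> \<tau> \<and> \<tau> \<le> b then (\<tau> - s) powr (- \<alpha>) * (b - \<tau>) powr (\<alpha> - 1) else 0)"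
  have km[measurable]: "case_prod k \<in> borel_measurable (borel \<Otimes>\<^sub>M borel)" unfolding k_def by measurable
  have k0: "k s \<tau> \<ge> 0" for s \<tau> by (simp add: k_def)
  have kb: "has_bochner_integral lborel (k s) (Beta (1 - \<alpha>) \<alpha>)" if s: "a \<le> s" "s < b" for s
  proof -
    have "0 < 1 - \<alpha>" using \<alpha> by simp
    have "((\<lambda>\<tau>. (\<tau> - s) powr ((1 - \<alpha>) - 1) * (b - \<tau>) powr (\<alpha> - 1)) has_integral
          (b - s) powr ((1 - \<alpha>) + \<alpha> - 1) * Beta (1 - \<alpha>) \<alpha>) {s..b}"
      by (rule has_integral_Beta_Icc) (use s \<alpha> in auto)
    then have "(k s has_integral Beta (1 - \<alpha>) \<alpha>) {s..b}"
      using s by (intro has_integral_eq[of _ _ "k s"]) (auto simp: k_def)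
    moreover from this have "k s absolutely_integrable_on {s..b}"
      using k0 by (intro nonnegative_absolutely_integrable_1) (auto simp: integrable_on_def)
    moreover have "k s \<in> borel_measurable borel"
      using measurable_Pair2[OF km, of s] by simp
    moreover have "k s x = 0" if "x \<notin> {s..b}" for x using that by (auto simp: k_def)
    ultimately show ?thesis
      using has_bochner_integral_lborel_vanishing[of "k s" "{s..b}"] by (metis integral_unique)
  qed
  have AEb: "AE s in lborel. s \<noteq> b" by (rule AE_lborel_singleton)
  define F where "F = (\<lambda>s \<tau>. h s * k s \<tau>)"
  have Fm[measurable]: "case_prod F \<in> borel_measurable (borel \<Otimes>\<^sub>M borel)" unfolding F_def by measurable
  have Fs: "integrable lborel (F s) \<and> (\<integral>\<tau>. F s \<tau> \<partial>lborel) = h s * Beta (1 - \<alpha>) \<alpha> \<and>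
      (\<integral>\<tau>. norm (F s \<tau>) \<partial>lborel) = norm (h s) * Beta (1 - \<alpha>) \<alpha>" if "s \<noteq> b" for s
  proof (cases "s \<in> {a..b}")
    case True
    then have "has_bochner_integral lborel (k s) (Beta (1 - \<alpha>) \<alpha>)" using that by (intro kb) auto
    then show ?thesis
      unfolding F_def using k0 by (simp add: has_bochner_integral_iff abs_mult)
  next
    case False
    then show ?thesis unfolding F_def using hz[of s] by simp
  qed
  have Fi: "integrable (lborel \<Otimes>\<^sub>M lborel) (case_prod F)"
  proof (rule lborel_pair.Fubini_integrable)
    have "integrable lborel (\<lambda>s. norm (h s) * Beta (1 - \<alpha>) \<alpha>)"
      using hb by (intro integrable_mult_left integrable_norm) (simp add: has_bochner_integral_iff)
    then show "integrable lborel (\<lambda>s. \<integral>\<tau>. norm (case_prod F (s, \<tau>)) \<partial>lborel)"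
      by (rule integrable_cong_AE_imp) (use AEb Fs in \<open>auto elim!: eventually_mono\<close>)
    show "AE s in lborel. integrable lborel (\<lambda>\<tau>. case_prod F (s, \<tau>))"
      using AEb by eventually_elim (use Fs in auto)
  qed measurable
  have "(\<integral>\<tau>. \<integral>s. F s \<tau> \<partial>lborel \<partial>lborel) = (\<integral>s. \<integral>\<tau>. F s \<tau> \<partial>lborel \<partial>lborel)"
    by (rule lborel_pair.Fubini_integral[OF Fi])
  also have "\<dots> = (\<integral>s. h s * Beta (1 - \<alpha>) \<alpha> \<partial>lborel)"
    by (rule integral_cong_AE) (use AEb Fs in \<open>auto elim!: eventually_mono\<close>)
  also have "\<dots> = Beta (1 - \<alpha>) \<alpha> * integral {a..b} g"
    using hb hg by (simp add: has_bochner_integral_iff)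
  finally have I: "(\<integral>\<tau>. \<integral>s. F s \<tau> \<partial>lborel \<partial>lborel) = Beta (1 - \<alpha>) \<alpha> * integral {a..b} g" .
  have "integrable lborel (\<lambda>\<tau>. \<integral>s. F s \<tau> \<partial>lborel)"
    by (rule lborel_pair.integrable_snd[OF Fi])
  from has_integral_integral_lborel[OF this]
  have H: "((\<lambda>\<tau>. \<integral>s. F s \<tau> \<partial>lborel) has_integral Beta (1 - \<alpha>) \<alpha> * integral {a..b} g) UNIV"
    unfolding I .
  have "AE \<tau> in lborel. integrable lborel (\<lambda>s. F s \<tau>)"
    by (rule lborel_pair.AE_integrable_snd[OF Fi])
  then have "AE \<tau> in lebesgue. integrable lborel (\<lambda>s. F s \<tau>)" by (rule AE_completion)
  then obtain N' where N': "negligible N'" "\<And>\<tau>. \<tau> \<notin> N' \<Longrightarrow> integrable lborel (\<lambda>s. F s \<tau>)"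
    unfolding eventually_ae_filter negligible_iff_null_sets by auto
  let ?R = "\<lambda>\<tau>. (b - \<tau>) powr (\<alpha> - 1) * integral {a..\<tau>} (\<lambda>s. (\<tau> - s) powr (- \<alpha>) * g s)"
  have "((\<lambda>\<tau>. if \<tau> \<in> {a..b} then ?R \<tau> else 0) has_integral Beta (1 - \<alpha>) \<alpha> * integral {a..b} g) UNIV"
  proof (rule has_integral_spike[OF N'(1) _ H])
    fix \<tau> assume \<tau>: "\<tau> \<in> UNIV - N'"
    show "(if \<tau> \<in> {a..b} then ?R \<tau> else 0) = (\<integral>s. F s \<tau> \<partial>lborel)"
    proof (cases "\<tau> \<in> {a..b}")
      case True
      have "(\<integral>s. F s \<tau> \<partial>lborel) = integral UNIV (\<lambda>s. F s \<tau>)"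
        using has_integral_integral_lborel[OF N'(2)[of \<tau>]] \<tau> by (simp add: integral_unique)
      also have "\<dots> = integral {a..\<tau>} (\<lambda>s. F s \<tau>)"
      proof -
        have e: "(\<lambda>s. F s \<tau>) = (\<lambda>s. if s \<in> {a..\<tau>} then F s \<tau> else 0)"
          by (auto simp: F_def k_def)
        show ?thesis by (subst e) (rule integral_restrict_UNIV)
      qed
      also have "\<dots> = integral {a..\<tau>} (\<lambda>s. (b - \<tau>) powr (\<alpha> - 1) * ((\<tau> - s) powr (- \<alpha>) * g s))"
        by (rule integral_spike[OF N(1)]) (use True N(2) in \<open>auto simp: F_def k_def\<close>)
      also have "\<dots> = ?R \<tau>" by (rule integral_mult_right)
      finally show ?thesis using True by (simp only: if_True)
    next
      case False
      then have z: "(\<lambda>s. F s \<tau>) = (\<lambda>_. 0)" by (auto simp: F_def k_def)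
      show ?thesis unfolding z using False by auto
    qed
  qed
  then show ?thesis unfolding has_integral_restrict_UNIV .
qed

lemma AE_lebesgue_on_negligible:
  assumes "AE x in lebesgue_on S. P x" "S \<in> sets lebesgue"
  obtains N where "negligible N" "\<And>x. x \<in> S \<Longrightarrow> x \<notin> N \<Longrightarrow> P x"
proof -
  have "AE x in lebesgue. x \<in> S \<longrightarrow> P x"
    using assms by (subst AE_restrict_space_iff[symmetric]) auto
  then obtain N where "N \<in> null_sets lebesgue" "{x \<in> space lebesgue. \<not> (x \<in> S \<longrightarrow> P x)} \<subseteq> N"
    unfolding eventually_ae_filter by blast
  then show thesis by (intro that[of N]) (auto simp: negligible_iff_null_sets)
qed

text \<open>The condition t < T leaves room for a later time at which the equation holds, and the
  derivative found there serves throughout (0,t]. The factor \<open>Gamma (1 - \<alpha>)\<close> of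
  the Caputo integral cancels against one of the two factors of
  \<open>Beta (1 - \<alpha>) \<alpha>\<close>; the other is the normalisation of
  \<open>frac_integral\<close>.\<close>

lemma caputo_imp_volterra:
  fixes y :: "real \<Rightarrow> complex"
  assumes \<alpha>: "0 < \<alpha>" "\<alpha> < 1" and y: "continuous_on {0..T} y"
    and ae: "AE t in lebesgue_on {0<..<T}. has_caputo_derivative \<alpha> y (z * y t) t"
    and t: "0 \<le> t" "t < T"
  shows "y t = y 0 + z * frac_integral \<alpha> y t"
proof (cases "t = 0")
  case True
  then show ?thesis by (simp add: frac_integral_def)
next
  case False
  with t have t0: "0 < t" by simp
  obtain N where N: "negligible N" "\<And>x. x \<in> {0<..<T} \<Longrightarrow> x \<notin> N \<Longrightarrow> has_caputo_derivative \<alpha> y (z * y x) x"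
    using AE_lebesgue_on_negligible[OF ae] by auto
  have "\<not> negligible {t<..<T}"
    using t by (intro open_not_negligible) auto
  then have "\<not> {t<..<T} \<subseteq> N" using N(1) negligible_subset by blast
  then obtain t1 where t1: "t < t1" "t1 < T" "t1 \<notin> N" by (auto simp: subset_eq)
  then have "has_caputo_derivative \<alpha> y (z * y t1) t1" using t0 by (intro N(2)) auto
  then obtain g where g: "has_locally_integrable_derivative y g t1"
    unfolding has_caputo_derivative_def by blast
  define G where "G = Gamma (1 - \<alpha>)"
  have G: "G > 0" unfolding G_def using \<alpha> by (intro Gamma_real_pos) auto
  have Ga: "Gamma \<alpha> > 0" using \<alpha> by (intro Gamma_real_pos)
  have cap: "((\<lambda>s. (\<tau> - s) powr (- \<alpha>) *\<^sub>R g s) has_integral G *\<^sub>R (z * y \<tau>)) {0..\<tau>}" if "0 < \<tau>" "\<tau> \<le> t" "\<tau> \<notin> N" for \<tau>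
    unfolding G_def using that t1 t by (intro has_caputo_derivative_cong_derivative[OF N(2) g _ \<alpha>(2)]) auto
  have yt: "continuous_on {0..t} y" using t by (intro continuous_on_subset[OF y]) auto
  define k where "k = (\<lambda>\<tau>. (t - \<tau>) powr (\<alpha> - 1))"
  have kyi: "(\<lambda>\<tau>. k \<tau> *\<^sub>R y \<tau>) integrable_on {0..t}"
    unfolding k_def
    by (intro set_lebesgue_integral_eq_integral(1) absolutely_integrable_scaleR_continuous absolutely_integrable_powr_Icc \<alpha> yt)
  define B where "B = Beta (1 - \<alpha>) \<alpha>"
  have B: "B = G * Gamma \<alpha>" by (simp add: B_def Beta_def G_def)
  have Bp: "B > 0" using G Ga by (simp add: B)
  \<comment> \<open>The integral over $[0,\tau]$ is cut at \<open>\<epsilon>\<close>. Beyond \<open>\<epsilon>\<close> the derivative is Lebesgue integrable and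
    Fubini applies; the part before \<open>\<epsilon>\<close>, where it may be only conditionally integrable, is small
    because \<open>y\<close> is continuous at \<open>0\<close>.\<close>
  have near: "cmod (B *\<^sub>R (y t - y \<epsilon>) - (G * z) * integral {\<epsilon>..t} (\<lambda>\<tau>. k \<tau> *\<^sub>R y \<tau>)) \<le> 8 * \<eta> * B"
    if eps: "0 < \<epsilon>" "\<epsilon> < t" and eta: "\<And>s. s \<in> {0..\<epsilon>} \<Longrightarrow> cmod (y s - y 0) \<le> \<eta>" for \<epsilon> \<eta>
  proof -
    have gi: "(g has_integral (y d - y c)) {c..d}" if "0 < c" "c \<le> d" "d \<le> t" for c d
      by (rule has_locally_integrable_derivativeD[OF g]) (use that t1 in auto)
    have ga: "g absolutely_integrable_on {\<epsilon>..t}"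
      by (rule absolutely_integrable_onI[OF has_integral_integrable[OF gi] has_locally_integrable_derivativeD(2)[OF g]])
        (use eps t1 in auto)
    \<comment> \<open>On [x,\<epsilon>] every integral of g is a difference of values of y, hence at
      most 2 \<eta>, and the weight increases in s up to (\<tau> - \<epsilon>)^(-\<alpha>); the mean
      value bound is 4 times the product. It extends to x = 0 because the indefinite gauge integral
      is continuous.\<close>
    have tail: "cmod (integral {0..\<epsilon>} (\<lambda>s. (\<tau> - s) powr (- \<alpha>) *\<^sub>R g s)) \<le> 8 * \<eta> * (\<tau> - \<epsilon>) powr (- \<alpha>)"
      if \<tau>: "\<epsilon> < \<tau>" "\<tau> \<le> t" "\<tau> \<notin> N" for \<tau>
    proof -
      let ?f = "\<lambda>s. (\<tau> - s) powr (- \<alpha>) *\<^sub>R g s"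
      have "?f integrable_on {0..\<tau>}"
        by (rule has_integral_integrable[OF cap[of \<tau>]]) (use \<tau> eps in auto)
      then have fi: "?f integrable_on {0..\<epsilon>}" by (rule integrable_on_subinterval) (use \<tau> in auto)
      have cont: "continuous_on (closure {0<..\<epsilon>}) (\<lambda>x. integral {x..\<epsilon>} ?f)"
        using eps indefinite_integral_continuous_1'[OF fi] by (simp add: closure_greaterThanAtMost)
      show ?thesis
      proof (rule continuous_on_closure_norm_le[OF cont])
        show "0 \<in> closure {0<..\<epsilon>}" using eps by (simp add: closure_greaterThanAtMost)
        show "\<forall>x\<in>{0<..\<epsilon>}. norm (integral {x..\<epsilon>} ?f) \<le> 8 * \<eta> * (\<tau> - \<epsilon>) powr (- \<alpha>)"
        proof
          fix x assume x: "x \<in> {0<..\<epsilon>}"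
          have diff: "cmod (integral {c..d} g) \<le> 2 * \<eta>" if "x \<le> c" "c \<le> d" "d \<le> \<epsilon>" for c d
          proof -
            have "integral {c..d} g = (y d - y 0) - (y c - y 0)"
              using gi[of c d] that x eps by (simp add: integral_unique)
            also have "cmod \<dots> \<le> \<eta> + \<eta>"
              by (rule order_trans[OF norm_triangle_ineq4 add_mono]) (use eta that x in auto)
            finally show ?thesis by simp
          qed
          have "cmod (integral {x..\<epsilon>} ?f) \<le> 4 * ((\<tau> - \<epsilon>) powr (- \<alpha>) * (2 * \<eta>))"
          proof (rule integral_mono_weight_bound)
            show "g integrable_on {x..\<epsilon>}"
              by (rule has_integral_integrable[OF gi]) (use x eps in auto)
            show "(\<tau> - p) powr (- \<alpha>) \<le> (\<tau> - q) powr (- \<alpha>)" if "x \<le> p" "p \<le> q" "q \<le> \<epsilon>" for p q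
              using that \<tau> \<alpha> by (intro powr_mono2') auto
          qed (use x diff in auto)
          then show "norm (integral {x..\<epsilon>} ?f) \<le> 8 * \<eta> * (\<tau> - \<epsilon>) powr (- \<alpha>)" by (simp add: mult_ac)
        qed
      qed
    qed
    let ?K = "\<lambda>\<tau>. integral {\<epsilon>..\<tau>} (\<lambda>s. (\<tau> - s) powr (- \<alpha>) *\<^sub>R g s)"
    have Ki: "(\<lambda>s. (\<tau> - s) powr (- \<alpha>) *\<^sub>R g s) integrable_on {\<epsilon>..\<tau>}" if "\<epsilon> < \<tau>" "\<tau> \<le> t" "\<tau> \<notin> N" for \<tau>
      by (rule integrable_on_subinterval[OF has_integral_integrable[OF cap[of \<tau>]]]) (use that eps in auto)
    have K: "cmod (?K \<tau> - (G * z) * y \<tau>) \<le> 8 * \<eta> * (\<tau> - \<epsilon>) powr (- \<alpha>)" if "\<epsilon> < \<tau>" "\<tau> \<le> t" "\<tau> \<notin> N" for \<tau>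
    proof -
      have "integral {0..\<epsilon>} (\<lambda>s. (\<tau> - s) powr (- \<alpha>) *\<^sub>R g s) + ?K \<tau> = integral {0..\<tau>} (\<lambda>s. (\<tau> - s) powr (- \<alpha>) *\<^sub>R g s)"
        by (rule Henstock_Kurzweil_Integration.integral_combine[OF _ _ has_integral_integrable[OF cap[of \<tau>]]])
          (use that eps in auto)
      also have "\<dots> = G *\<^sub>R (z * y \<tau>)"
        by (rule integral_unique[OF cap]) (use that eps in auto)
      finally have "?K \<tau> - (G * z) * y \<tau> = - integral {0..\<epsilon>} (\<lambda>s. (\<tau> - s) powr (- \<alpha>) *\<^sub>R g s)"
        by (simp add: scaleR_conv_of_real algebra_simps)
      then show ?thesis using tail[OF that] by (simp only: norm_minus_cancel)
    qed
    have gRe: "(\<lambda>s. Re (g s)) absolutely_integrable_on {\<epsilon>..t}" and gIm: "(\<lambda>s. Im (g s)) absolutely_integrable_on {\<epsilon>..t}"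
      using absolutely_integrable_linear[OF ga bounded_linear_Re] absolutely_integrable_linear[OF ga bounded_linear_Im]
      by (simp_all add: o_def)
    have gI: "integral {\<epsilon>..t} g = y t - y \<epsilon>" using gi[of \<epsilon> t] eps by (simp add: integral_unique)
    have gin: "g integrable_on {\<epsilon>..t}" by (rule has_integral_integrable[OF gi]) (use eps in auto)
    let ?KR = "\<lambda>\<tau>. integral {\<epsilon>..\<tau>} (\<lambda>s. (\<tau> - s) powr (- \<alpha>) * Re (g s))"
    let ?KI = "\<lambda>\<tau>. integral {\<epsilon>..\<tau>} (\<lambda>s. (\<tau> - s) powr (- \<alpha>) * Im (g s))"
    have "((\<lambda>\<tau>. complex_of_real (k \<tau> * ?KR \<tau>) + \<i> * complex_of_real (k \<tau> * ?KI \<tau>)) has_integral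
       complex_of_real (B * integral {\<epsilon>..t} (\<lambda>s. Re (g s))) + \<i> * complex_of_real (B * integral {\<epsilon>..t} (\<lambda>s. Im (g s)))) {\<epsilon>..t}"
      unfolding k_def B_def
      by (intro has_integral_add has_integral_mult_right has_integral_of_real abel_inversion_real \<alpha> gRe gIm eps)
    also have "complex_of_real (B * integral {\<epsilon>..t} (\<lambda>s. Re (g s))) + \<i> * complex_of_real (B * integral {\<epsilon>..t} (\<lambda>s. Im (g s))) = B *\<^sub>R (y t - y \<epsilon>)"
      unfolding gI[symmetric] using integral_linear[OF gin bounded_linear_Re] integral_linear[OF gin bounded_linear_Im]
      by (simp add: complex_eq_iff o_def)
    finally have X: "((\<lambda>\<tau>. complex_of_real (k \<tau> * ?KR \<tau>) + \<i> * complex_of_real (k \<tau> * ?KI \<tau>)) has_integral B *\<^sub>R (y t - y \<epsilon>)) {\<epsilon>..t}" .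
    have W: "((\<lambda>\<tau>. (G * z) * (k \<tau> *\<^sub>R y \<tau>)) has_integral (G * z) * integral {\<epsilon>..t} (\<lambda>\<tau>. k \<tau> *\<^sub>R y \<tau>)) {\<epsilon>..t}"
      by (intro has_integral_mult_right integrable_integral integrable_on_subinterval[OF kyi]) (use eps in auto)
    \<comment> \<open>The estimate of the integrand is available only off \<epsilon> and N; setting
      D to 0 there makes the bound hold on the whole interval.\<close>
    define D where "D = (\<lambda>\<tau>. if \<tau> \<in> insert \<epsilon> N then 0 else k \<tau> *\<^sub>R (?K \<tau> - (G * z) * y \<tau>))"
    have D: "(D has_integral B *\<^sub>R (y t - y \<epsilon>) - (G * z) * integral {\<epsilon>..t} (\<lambda>\<tau>. k \<tau> *\<^sub>R y \<tau>)) {\<epsilon>..t}"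
    proof (rule has_integral_spike[OF _ _ has_integral_diff[OF X W]])
      show "negligible (insert \<epsilon> N)" using N(1) by simp
      fix \<tau> assume \<tau>: "\<tau> \<in> {\<epsilon>..t} - insert \<epsilon> N"
      then have i: "(\<lambda>s. (\<tau> - s) powr (- \<alpha>) *\<^sub>R g s) integrable_on {\<epsilon>..\<tau>}" by (intro Ki) auto
      have "?K \<tau> = complex_of_real (?KR \<tau>) + \<i> * complex_of_real (?KI \<tau>)"
        using integral_linear[OF i bounded_linear_Re] integral_linear[OF i bounded_linear_Im]
        by (simp add: complex_eq_iff o_def)
      then show "D \<tau> = complex_of_real (k \<tau> * ?KR \<tau>) + \<i> * complex_of_real (k \<tau> * ?KI \<tau>) - (G * z) * (k \<tau> *\<^sub>R y \<tau>)"
        using \<tau> by (simp add: D_def scaleR_conv_of_real algebra_simps)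
    qed
    have "((\<lambda>\<tau>. (\<tau> - \<epsilon>) powr ((1 - \<alpha>) - 1) * (t - \<tau>) powr (\<alpha> - 1)) has_integral (t - \<epsilon>) powr ((1 - \<alpha>) + \<alpha> - 1) * B) {\<epsilon>..t}"
      unfolding B_def by (rule has_integral_Beta_Icc) (use eps \<alpha> in auto)
    then have Bd: "((\<lambda>\<tau>. 8 * \<eta> * ((\<tau> - \<epsilon>) powr (- \<alpha>) * k \<tau>)) has_integral 8 * \<eta> * B) {\<epsilon>..t}"
      using eps by (intro has_integral_mult_right) (simp add: k_def)
    have Dn: "norm (D \<tau>) \<le> 8 * \<eta> * ((\<tau> - \<epsilon>) powr (- \<alpha>) * k \<tau>)" if \<tau>: "\<tau> \<in> {\<epsilon>..t}" for \<tau>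
    proof (cases "\<tau> \<in> insert \<epsilon> N")
      case True
      have "0 \<le> \<eta>" using eta[of 0] eps by simp
      then show ?thesis using True by (simp add: D_def k_def)
    next
      case False
      then have "cmod (?K \<tau> - (G * z) * y \<tau>) \<le> 8 * \<eta> * (\<tau> - \<epsilon>) powr (- \<alpha>)" using \<tau> by (intro K) auto
      then have "k \<tau> * cmod (?K \<tau> - (G * z) * y \<tau>) \<le> k \<tau> * (8 * \<eta> * (\<tau> - \<epsilon>) powr (- \<alpha>))"
        by (rule mult_left_mono) (simp add: k_def)
      moreover have "norm (D \<tau>) = k \<tau> * cmod (?K \<tau> - (G * z) * y \<tau>)"
        using False by (simp add: D_def k_def)
      ultimately show ?thesis by (simp add: mult_ac)
    qed
    show ?thesis
      using integral_norm_bound_integral[OF has_integral_integrable[OF D] has_integral_integrable[OF Bd] Dn]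
      unfolding integral_unique[OF D] integral_unique[OF Bd] .
  qed
  \<comment> \<open>Up to a factor, the defect of the Volterra equation on [\<epsilon>,t]. It is
    continuous at \<epsilon> = 0, and the cut estimate makes its limit there 0.\<close>
  define P where "P = (\<lambda>\<epsilon>. B *\<^sub>R (y t - y \<epsilon>) - (G * z) * integral {\<epsilon>..t} (\<lambda>\<tau>. k \<tau> *\<^sub>R y \<tau>))"
  have cP: "continuous_on {0..t} P"
    unfolding P_def by (intro continuous_intros yt indefinite_integral_continuous_1' kyi)
  have "(P \<longlongrightarrow> P 0) (at 0 within {0..t})"
    using cP t0 by (simp add: continuous_on_def)
  then have "(P \<longlongrightarrow> P 0) (at_right 0)"
    using t0 by (simp add: at_within_Icc_at_right)
  moreover have "(P \<longlongrightarrow> 0) (at_right 0)"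
  proof (rule tendstoI)
    fix e :: real assume e: "e > 0"
    \<comment> \<open>With this choice 8 \<eta> B equals e / 2.\<close>
    define \<eta> where "\<eta> = e / (16 * B)"
    have \<eta>: "\<eta> > 0" using e Bp by (simp add: \<eta>_def)
    have "(y \<longlongrightarrow> y 0) (at 0 within {0..t})" using yt t0 by (simp add: continuous_on_def)
    then have "\<forall>\<^sub>F s in at_right 0. dist (y s) (y 0) < \<eta>"
      using t0 \<eta> by (simp add: at_within_Icc_at_right tendsto_iff)
    then obtain b where b: "b > 0" "\<And>s. 0 < s \<Longrightarrow> s < b \<Longrightarrow> dist (y s) (y 0) < \<eta>"
      unfolding eventually_at_right_field by auto
    show "\<forall>\<^sub>F \<epsilon> in at_right 0. dist (P \<epsilon>) 0 < e"
      unfolding eventually_at_right_field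
    proof (intro exI conjI allI impI)
      show "0 < min b t" using b t0 by simp
      fix \<epsilon> assume eps: "0 < \<epsilon>" "\<epsilon> < min b t"
      have "cmod (y s - y 0) \<le> \<eta>" if "s \<in> {0..\<epsilon>}" for s
        using b(2)[of s] that eps \<eta> by (cases "s = 0") (auto simp: dist_norm)
      then have "cmod (P \<epsilon>) \<le> 8 * \<eta> * B"
        unfolding P_def by (intro near) (use eps in auto)
      also have "\<dots> < e" using e Bp by (simp add: \<eta>_def)
      finally show "dist (P \<epsilon>) 0 < e" by simp
    qed
  qed
  ultimately have "P 0 = 0"
    by (rule tendsto_unique[OF trivial_limit_at_right_real])
  then have "complex_of_real G * (complex_of_real (Gamma \<alpha>) * (y t - y 0) - z * integral {0..t} (\<lambda>\<tau>. k \<tau> *\<^sub>R y \<tau>)) = 0"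
    by (simp add: P_def B scaleR_conv_of_real algebra_simps)
  then have "complex_of_real (Gamma \<alpha>) * (y t - y 0) = z * integral {0..t} (\<lambda>\<tau>. k \<tau> *\<^sub>R y \<tau>)"
    using G by simp
  then show ?thesis
    using Ga by (simp add: frac_integral_def k_def scaleR_conv_of_real field_simps)
qed

text \<open>Progression in steps of length \<delta>: if y vanishes up to a = n \<delta>, the maximum
  M of |y| over [a,t], attained at r, receives a contribution from [a,r] only and is at most c
  (\<delta>^\<alpha> / \<alpha>) M. That factor is less than 1, so M vanishes.\<close>

lemma volterra_homogeneous_zero:
  fixes y :: "real \<Rightarrow> complex"
  assumes \<alpha>: "0 < \<alpha>" "\<alpha> < 1" and y: "continuous_on {0..T} y"
    and eq: "\<And>t. 0 \<le> t \<Longrightarrow> t < T \<Longrightarrow> y t = z * frac_integral \<alpha> y t"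
    and t: "0 \<le> t" "t < T"
  shows "y t = 0"
proof -
  have Ga: "Gamma \<alpha> > 0" using \<alpha> by (intro Gamma_real_pos)
  define c where "c = cmod z / Gamma \<alpha>"
  have c: "c \<ge> 0" using Ga by (simp add: c_def)
  \<comment> \<open>Chosen so that c \<delta>^\<alpha> / \<alpha> equals c / (2 (c + 1)); the added
    1 covers c = 0.\<close>
  define \<delta> where "\<delta> = (\<alpha> / (2 * (c + 1))) powr (1 / \<alpha>)"
  have \<delta>: "\<delta> > 0" using \<alpha> c by (simp add: \<delta>_def)
  have "\<delta> powr \<alpha> = \<alpha> / (2 * (c + 1))" using \<alpha> c by (simp add: \<delta>_def powr_powr)
  then have "c * (\<delta> powr \<alpha> / \<alpha>) = c / (2 * (c + 1))" using \<alpha> by (simp only:) simp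
  also have "\<dots> < 1" using c by (simp add: divide_less_eq)
  finally have \<delta>c: "c * (\<delta> powr \<alpha> / \<alpha>) < 1" .
  have main: "\<forall>t. 0 \<le> t \<and> t < T \<and> t \<le> real n * \<delta> \<longrightarrow> y t = 0" for n
  proof (induction n)
    case 0
    show ?case
    proof (intro allI impI)
      fix t assume "0 \<le> t \<and> t < T \<and> t \<le> real 0 * \<delta>"
      then have "t = 0" "t < T" by auto
      then show "y t = 0" using eq[of 0] by (simp add: frac_integral_def)
    qed
  next
    case (Suc n)
    show ?case
    proof (intro allI impI)
      fix t assume t: "0 \<le> t \<and> t < T \<and> t \<le> real (Suc n) * \<delta>"
      define a where "a = real n * \<delta>"
      have a: "a \<ge> 0" using \<delta> by (simp add: a_def)
      show "y t = 0"
      proof (cases "t \<le> a")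
        case True
        then show ?thesis using Suc t by (simp add: a_def)
      next
        case False
        have cy: "continuous_on {a..t} (\<lambda>s. cmod (y s))"
          using a t by (intro continuous_intros continuous_on_subset[OF y]) auto
        obtain r where r: "r \<in> {a..t}" "\<And>s. s \<in> {a..t} \<Longrightarrow> cmod (y s) \<le> cmod (y r)"
          using continuous_attains_sup[OF compact_Icc _ cy] False by auto
        define M where "M = cmod (y r)"
        have r0: "0 \<le> r" "r < T" "a \<le> r" using r(1) a t by auto
        have yi: "(\<lambda>s. (r - s) powr (\<alpha> - 1) *\<^sub>R y s) integrable_on {0..r}"
          using r0 by (intro set_lebesgue_integral_eq_integral(1) absolutely_integrable_scaleR_continuous
              absolutely_integrable_powr_Icc \<alpha> continuous_on_subset[OF y]) auto
        have "integral {0..a} (\<lambda>s. (r - s) powr (\<alpha> - 1) *\<^sub>R y s) = integral {0..a} (\<lambda>s. 0)"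
          by (rule integral_cong) (use Suc r0 in \<open>auto simp: a_def\<close>)
        then have "integral {0..r} (\<lambda>s. (r - s) powr (\<alpha> - 1) *\<^sub>R y s) = integral {a..r} (\<lambda>s. (r - s) powr (\<alpha> - 1) *\<^sub>R y s)"
          using Henstock_Kurzweil_Integration.integral_combine[OF a r0(3) yi] by simp
        also have "cmod \<dots> \<le> integral {a..r} (\<lambda>s. (r - s) powr (\<alpha> - 1) * M)"
        proof (rule integral_norm_bound_integral)
          show "(\<lambda>s. (r - s) powr (\<alpha> - 1) *\<^sub>R y s) integrable_on {a..r}"
            by (rule integrable_on_subinterval[OF yi]) (use a in auto)
          show "(\<lambda>s. (r - s) powr (\<alpha> - 1) * M) integrable_on {a..r}"
            by (intro integrable_on_mult_left has_integral_integrable[OF has_integral_powr_Icc] \<alpha> r0)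
          fix s assume "s \<in> {a..r}"
          then show "norm ((r - s) powr (\<alpha> - 1) *\<^sub>R y s) \<le> (r - s) powr (\<alpha> - 1) * M"
            using r unfolding M_def norm_scaleR by (intro mult_mono) auto
        qed
        also have "\<dots> = (r - a) powr \<alpha> / \<alpha> * M"
          by (rule integral_unique[OF has_integral_mult_left[OF has_integral_powr_Icc[OF \<alpha>(1) r0(3)]]])
        also have "\<dots> \<le> \<delta> powr \<alpha> / \<alpha> * M"
        proof -
          have "(r - a) powr \<alpha> \<le> \<delta> powr \<alpha>"
            using r(1) t \<alpha> by (intro powr_mono2) (auto simp: a_def algebra_simps)
          then show ?thesis using \<alpha> by (intro mult_right_mono divide_right_mono) (auto simp: M_def)
        qed
        finally have I: "cmod (integral {0..r} (\<lambda>s. (r - s) powr (\<alpha> - 1) *\<^sub>R y s)) \<le> \<delta> powr \<alpha> / \<alpha> * M" .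
        have "M = c * cmod (integral {0..r} (\<lambda>s. (r - s) powr (\<alpha> - 1) *\<^sub>R y s))"
          unfolding M_def using Ga by (subst eq[OF r0(1,2)]) (simp add: frac_integral_def norm_mult c_def)
        also have "\<dots> \<le> c * (\<delta> powr \<alpha> / \<alpha> * M)" by (rule mult_left_mono[OF I c])
        finally have "M * (1 - c * (\<delta> powr \<alpha> / \<alpha>)) \<le> 0" by (simp add: algebra_simps)
        then have "M \<le> 0" using \<delta>c by (simp add: mult_le_0_iff)
        moreover have "cmod (y t) \<le> M" unfolding M_def by (rule r(2)) (use False in auto)
        ultimately have "cmod (y t) \<le> 0" by linarith
        then show ?thesis by simp
      qed
    qed
  qed
  obtain n :: nat where "t / \<delta> < real n" using reals_Archimedean2 by blast
  then have "t \<le> real n * \<delta>" using \<delta> by (simp add: field_simps)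
  with main[of n] t show ?thesis by blast
qed

text \<open>The difference of the two sides solves the homogeneous Volterra equation on [0,T); the
  time T itself is reached by continuity.\<close>

lemma caputo_scalar_unique:
  fixes y :: "real \<Rightarrow> complex"
  assumes \<alpha>: "0 < \<alpha>" "\<alpha> < 1" and y: "continuous_on {0..T} y"
    and ae: "AE t in lebesgue_on {0<..<T}. has_caputo_derivative \<alpha> y ((- \<i> * complex_of_real l) * y t) t"
    and T: "0 < T" and t: "t \<in> {0..T}"
  shows "y t = y 0 * ml_sol \<alpha> l t"
proof -
  have e: "continuous_on {0..b} (ml_sol \<alpha> l)" for b
    by (rule continuous_on_subset[OF continuous_on_ml_sol[OF \<alpha>]]) auto
  define v where "v = (\<lambda>t. y t - y 0 * ml_sol \<alpha> l t)"
  have v: "continuous_on {0..T} v" unfolding v_def by (intro continuous_intros y e)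
  have vq: "v t = (- \<i> * complex_of_real l) * frac_integral \<alpha> v t" if t: "0 \<le> t" "t < T" for t
  proof -
    have yt: "continuous_on {0..t} y" using t by (intro continuous_on_subset[OF y]) auto
    have i: "(\<lambda>s. (t - s) powr (\<alpha> - 1) *\<^sub>R y s) integrable_on {0..t}"
       "(\<lambda>s. (t - s) powr (\<alpha> - 1) *\<^sub>R ml_sol \<alpha> l s) integrable_on {0..t}"
      by (intro set_lebesgue_integral_eq_integral(1) absolutely_integrable_scaleR_continuous
              absolutely_integrable_powr_Icc \<alpha> yt e)+
    have "((\<lambda>s. (t - s) powr (\<alpha> - 1) *\<^sub>R y s - y 0 * ((t - s) powr (\<alpha> - 1) *\<^sub>R ml_sol \<alpha> l s)) has_integral
       integral {0..t} (\<lambda>s. (t - s) powr (\<alpha> - 1) *\<^sub>R y s) - y 0 * integral {0..t} (\<lambda>s. (t - s) powr (\<alpha> - 1) *\<^sub>R ml_sol \<alpha> l s)) {0..t}"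
      by (intro has_integral_diff has_integral_mult_right integrable_integral i)
    then have "integral {0..t} (\<lambda>s. (t - s) powr (\<alpha> - 1) *\<^sub>R v s)
       = integral {0..t} (\<lambda>s. (t - s) powr (\<alpha> - 1) *\<^sub>R y s) - y 0 * integral {0..t} (\<lambda>s. (t - s) powr (\<alpha> - 1) *\<^sub>R ml_sol \<alpha> l s)"
      by (intro integral_unique) (simp add: v_def scaleR_diff_right)
    then have f: "frac_integral \<alpha> v t = frac_integral \<alpha> y t - y 0 * frac_integral \<alpha> (ml_sol \<alpha> l) t"
      by (simp add: frac_integral_def scaleR_diff_right)
    have 1: "y t = y 0 + (- \<i> * complex_of_real l) * frac_integral \<alpha> y t"
      by (rule caputo_imp_volterra[OF \<alpha> y ae t])
    have 2: "ml_sol \<alpha> l t = 1 + (- \<i> * complex_of_real l) * frac_integral \<alpha> (ml_sol \<alpha> l) t"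
      by (rule ml_sol_volterra[OF \<alpha> t(1)])
    have "v t = (y 0 + (- \<i> * complex_of_real l) * frac_integral \<alpha> y t) - y 0 * (1 + (- \<i> * complex_of_real l) * frac_integral \<alpha> (ml_sol \<alpha> l) t)"
      unfolding v_def using 1 2 by simp
    also have "\<dots> = (- \<i> * complex_of_real l) * frac_integral \<alpha> v t"
      unfolding f by (simp add: algebra_simps)
    finally show ?thesis .
  qed
  have z: "v t = 0" if "t \<in> {0..<T}" for t
    using volterra_homogeneous_zero[OF \<alpha> v vq] that by auto
  have "v t = 0"
  proof (rule continuous_constant_on_closure[of "{0..<T}" v 0])
    show "continuous_on (closure {0..<T}) v" using v T by (simp add: closure_atLeastLessThan)
    show "t \<in> closure {0..<T}" using t T by (simp add: closure_atLeastLessThan)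
  qed (rule z)
  then show ?thesis by (simp add: v_def)
qed

section \<open>Orthonormal expansions and the scale $H_s$\<close>

lemma cinner_scaleC_right: "cinner x (c *\<^sub>C y) = cnj c * cinner (x::'a::chilbert_space) y"
  by (metis cinner_commute cinner_scaleC_left complex_cnj_mult)

lemma cinner_self: "cinner x x = complex_of_real ((norm (x::'a::chilbert_space))\<^sup>2)"
proof -
  have "cinner x x = cnj (cinner x x)" by (rule cinner_commute)
  then have "Im (cinner x x) = 0" by (simp add: complex_eq_iff)
  moreover have "Re (cinner x x) = (norm x)\<^sup>2"
    by (simp add: power2_norm_eq_inner inner_eq_Re_cinner)
  ultimately show ?thesis by (simp add: complex_eq_iff)
qed

lemma norm_scaleC: "norm (c *\<^sub>C x) = cmod c * norm (x::'a::chilbert_space)"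
proof -
  have "complex_of_real ((norm (c *\<^sub>C x))\<^sup>2) = c * cnj c * cinner x x"
    unfolding cinner_self[symmetric] by (simp add: cinner_scaleC_left cinner_scaleC_right)
  also have "\<dots> = complex_of_real ((cmod c * norm x)\<^sup>2)"
    unfolding cinner_self by (simp add: complex_norm_square[symmetric] power_mult_distrib)
  finally have "(norm (c *\<^sub>C x))\<^sup>2 = (cmod c * norm x)\<^sup>2"
    by (simp only: of_real_eq_iff)
  then show ?thesis by (rule power2_eq_imp_eq) auto
qed

text \<open>Multiplying x by a unimodular c makes the inner product real and nonnegative, which
  reduces the claim to the inequality for \<open>inner\<close>.\<close>

lemma cinner_Cauchy_Schwarz: "cmod (cinner x y) \<le> norm x * norm (y::'a::chilbert_space)"
proof (cases "cinner x y = 0")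
  case False
  define c where "c = cnj (cinner x y) / cmod (cinner x y)"
  have "cmod c = 1" using False by (simp add: c_def norm_divide)
  have "complex_of_real (cmod (cinner x y)) = c * cinner x y"
    using False by (simp add: c_def complex_norm_square[symmetric] power2_eq_square mult.commute)
  then have "cmod (cinner x y) = Re (cinner (c *\<^sub>C x) y)"
    by (metis Re_complex_of_real cinner_scaleC_left)
  also have "\<dots> \<le> norm (c *\<^sub>C x) * norm y"
    unfolding inner_eq_Re_cinner[symmetric] by (rule norm_cauchy_schwarz)
  finally show ?thesis using \<open>cmod c = 1\<close> by (simp add: norm_scaleC)
qed simp

lemma cinner_scaleR_left: "cinner (r *\<^sub>R x) (y::'a::chilbert_space) = r *\<^sub>R cinner x y"
  unfolding scaleR_scaleC[of r x] cinner_scaleC_left by (rule scaleR_conv_of_real[symmetric])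

lemma bounded_linear_cinner_left: "bounded_linear (\<lambda>x. cinner x (y::'a::chilbert_space))"
proof (rule bounded_linear_intro)
qed (auto simp: cinner_add_left cinner_scaleR_left intro: cinner_Cauchy_Schwarz)

lemma cinner_zero_left [simp]: "cinner 0 (y::'a::chilbert_space) = 0"
  by (rule linear_0[OF bounded_linear.linear[OF bounded_linear_cinner_left]])

lemma cinner_diff_left: "cinner (x - z) (y::'a::chilbert_space) = cinner x y - cinner z y"
  by (rule linear_diff[OF bounded_linear.linear[OF bounded_linear_cinner_left]])

lemma cinner_minus_left: "cinner (- x) (y::'a::chilbert_space) = - cinner x y"
  by (rule linear_neg[OF bounded_linear.linear[OF bounded_linear_cinner_left]])

lemma cinner_sum_left: "cinner (sum f S) (y::'a::chilbert_space) = (\<Sum>k\<in>S. cinner (f k) y)"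
  by (rule linear_sum[OF bounded_linear.linear[OF bounded_linear_cinner_left]])

lemma has_integral_cinner_left:
  fixes f :: "real \<Rightarrow> 'a::chilbert_space"
  assumes "(f has_integral I) S"
  shows "((\<lambda>s. cinner (f s) p) has_integral cinner I p) S"
  using has_integral_linear[OF assms bounded_linear_cinner_left] by (simp add: o_def)

text \<open>A bounded functional commutes with the gauge integral. The integrability of the modulus
  is recovered from the majorant \<open>norm (u' s) * norm p\<close>.\<close>

lemma has_caputo_derivative_cinner:
  fixes u :: "real \<Rightarrow> 'a::chilbert_space"
  assumes "has_caputo_derivative \<alpha> u d t"
  shows "has_caputo_derivative \<alpha> (\<lambda>t. cinner (u t) p) (cinner d p) t"
proof -
  obtain u' where t: "0 < t" and u': "has_locally_integrable_derivative u u' t"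
    "(\<lambda>s. (t - s) powr (- \<alpha>) *\<^sub>R u' s) integrable_on {0..t}"
    "d = (1 / Gamma (1 - \<alpha>)) *\<^sub>R integral {0..t} (\<lambda>s. (t - s) powr (- \<alpha>) *\<^sub>R u' s)"
    using assms unfolding has_caputo_derivative_def by blast
  have I: "((\<lambda>s. (t - s) powr (- \<alpha>) *\<^sub>R cinner (u' s) p) has_integral
      cinner (integral {0..t} (\<lambda>s. (t - s) powr (- \<alpha>) *\<^sub>R u' s)) p) {0..t}"
    using has_integral_cinner_left[OF integrable_integral[OF u'(2)], of p] by (simp add: cinner_scaleR_left)
  have "has_locally_integrable_derivative (\<lambda>t. cinner (u t) p) (\<lambda>s. cinner (u' s) p) t"
    unfolding has_locally_integrable_derivative_def
  proof (intro ballI conjI)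
    fix \<epsilon> assume e: "\<epsilon> \<in> {0<..t}"
    have 1: "((\<lambda>s. cinner (u' s) p) has_integral cinner (u q) p - cinner (u \<epsilon>) p) {\<epsilon>..q}" if "q \<in> {\<epsilon>..t}" for q
      using has_integral_cinner_left[OF has_locally_integrable_derivativeD(1)[OF u'(1), of \<epsilon> q], of p] that e
      by (simp add: cinner_diff_left)
    then show "((\<lambda>s. cinner (u' s) p) has_integral cinner (u q) p - cinner (u \<epsilon>) p) {\<epsilon>..q}" if "q \<in> {\<epsilon>..t}" for q
      using that by blast
    have n: "(\<lambda>s. norm (u' s)) integrable_on {\<epsilon>..t}"
      using has_locally_integrable_derivativeD(2)[OF u'(1), of \<epsilon> t] e by simp
    have "(\<lambda>s. cinner (u' s) p) absolutely_integrable_on {\<epsilon>..t}"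
    proof (rule absolutely_integrable_integrable_bound)
      show "(\<lambda>s. norm (u' s) * norm p) integrable_on {\<epsilon>..t}" by (rule integrable_on_mult_left[OF n])
      show "(\<lambda>s. cinner (u' s) p) integrable_on {\<epsilon>..t}"
        by (rule has_integral_integrable[OF 1]) (use e in simp)
    qed (rule cinner_Cauchy_Schwarz)
    then show "(\<lambda>s. norm (cinner (u' s) p)) integrable_on {\<epsilon>..t}"
      unfolding absolutely_integrable_on_def by blast
  qed
  then show ?thesis
    unfolding has_caputo_derivative_def
    using t has_integral_integrable[OF I] integral_unique[OF I] u'(3)
    by (intro conjI exI[of _ "\<lambda>s. cinner (u' s) p"]) (auto simp: cinner_scaleR_left)
qed

text \<open>The differentiation argument behind scalar uniqueness is finite-dimensional; testing
  with the vector d - d' itself brings the claim back to it.\<close>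

lemma has_caputo_derivative_unique_hilbert:
  fixes u :: "real \<Rightarrow> 'a::chilbert_space"
  assumes "has_caputo_derivative \<alpha> u d t" "has_caputo_derivative \<alpha> u d' t" "\<alpha> < 1"
  shows "d = d'"
proof -
  have "cinner (d - d') (d - d') = 0"
    unfolding cinner_diff_left
    using has_caputo_derivative_unique[OF has_caputo_derivative_cinner[OF assms(1)] has_caputo_derivative_cinner[OF assms(2)] assms(3)]
    by simp
  then show ?thesis by (simp add: cinner_self)
qed

lemma caputo_derivative_eq:
  fixes u :: "real \<Rightarrow> 'a::chilbert_space"
  assumes "has_caputo_derivative \<alpha> u d t" "\<alpha> < 1"
  shows "caputo_derivative \<alpha> u t = d"
  unfolding caputo_derivative_def
  using assms has_caputo_derivative_unique_hilbert by blast

section \<open>Expansions in an orthonormal basis\<close>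

locale orthonormal_basis =
  fixes phi :: "nat \<Rightarrow> 'a::chilbert_space"
  assumes orthonormal: "cinner (phi m) (phi n) = (if m = n then 1 else 0)"
    and total: "closure (cspan (range phi)) = UNIV"
begin

definition series :: "(nat \<Rightarrow> complex) \<Rightarrow> 'a" where
  "series c = (\<Sum>n. c n *\<^sub>C phi n)"

lemma norm_sum_sq:
  assumes "finite S"
  shows "(norm (\<Sum>k\<in>S. c k *\<^sub>C phi k))\<^sup>2 = (\<Sum>k\<in>S. (cmod (c k))\<^sup>2)"
proof -
  let ?s = "\<Sum>k\<in>S. c k *\<^sub>C phi k"
  have k: "cinner ?s (phi j) = (if j \<in> S then c j else 0)" for j
    using assms by (simp add: cinner_sum_left cinner_scaleC_left orthonormal if_distrib[of "\<lambda>x. _ * x"] sum.delta cong: if_cong)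
  have "cinner ?s ?s = (\<Sum>j\<in>S. c j * cinner (phi j) ?s)"
    by (simp add: cinner_sum_left cinner_scaleC_left)
  also have "\<dots> = (\<Sum>j\<in>S. complex_of_real ((cmod (c j))\<^sup>2))"
  proof (rule sum.cong)
    fix j assume "j \<in> S"
    then have "cinner (phi j) ?s = cnj (c j)" using k[of j] cinner_commute[of "phi j" ?s] by simp
    then show "c j * cinner (phi j) ?s = complex_of_real ((cmod (c j))\<^sup>2)"
      by (simp only: complex_norm_square)
  qed simp
  finally show ?thesis unfolding cinner_self of_real_sum[symmetric] of_real_eq_iff .
qed

lemma series_sums:
  assumes c: "summable (\<lambda>n. (cmod (c n))\<^sup>2)"
  shows "(\<lambda>n. c n *\<^sub>C phi n) sums series c"
proof -
  have "summable (\<lambda>n. c n *\<^sub>C phi n)"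
    unfolding summable_Cauchy
  proof (intro allI impI)
    fix e :: real assume e: "e > 0"
    then obtain N where N: "\<And>m n. m \<ge> N \<Longrightarrow> norm (\<Sum>k=m..<n. (cmod (c k))\<^sup>2) < e\<^sup>2"
      using c unfolding summable_Cauchy by (meson zero_less_power)
    show "\<exists>N. \<forall>m\<ge>N. \<forall>n. norm (\<Sum>k=m..<n. c k *\<^sub>C phi k) < e"
    proof (intro exI allI impI)
      fix m n assume "N \<le> m"
      then have "(norm (\<Sum>k=m..<n. c k *\<^sub>C phi k))\<^sup>2 < e\<^sup>2"
        using N[of m n] by (simp add: norm_sum_sq sum_nonneg)
      then show "norm (\<Sum>k=m..<n. c k *\<^sub>C phi k) < e"
        using e by (simp add: power_less_imp_less_base)
    qed
  qed
  then show ?thesis unfolding series_def by (rule summable_sums)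
qed

lemma series_coeff:
  assumes c: "summable (\<lambda>n. (cmod (c n))\<^sup>2)"
  shows "cinner (series c) (phi n) = c n"
proof -
  have "(\<lambda>k. cinner (c k *\<^sub>C phi k) (phi n)) sums cinner (series c) (phi n)"
    by (rule bounded_linear.sums[OF bounded_linear_cinner_left series_sums[OF c]])
  moreover have "(\<lambda>k. cinner (c k *\<^sub>C phi k) (phi n)) = (\<lambda>k. if k = n then c k else 0)"
    by (auto simp: cinner_scaleC_left orthonormal)
  ultimately show ?thesis using sums_single[of n c] sums_unique2 by metis
qed

text \<open>The vectors orthogonal to x - y form a closed subspace that contains the basis.
  Identities between Hilbert space valued integrals are later reduced to scalar ones in this
  way.\<close>

lemma eqI_coeff:
  assumes "\<And>n. cinner x (phi n) = cinner y (phi n)"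
  shows "x = y"
proof -
  define T where "T = {z. cinner z (x - y) = 0}"
  have "cinner (phi n) (x - y) = 0" for n
    using assms[of n] cinner_commute[of "phi n" "x - y"] by (simp add: cinner_diff_left)
  then have "range phi \<subseteq> T" by (auto simp: T_def)
  moreover have "csubspace T"
    unfolding complex_vector.subspace_def by (auto simp: T_def cinner_add_left cinner_scaleC_left)
  ultimately have "cspan (range phi) \<subseteq> T"
    by (rule complex_vector.span_minimal)
  moreover have "closed T"
  proof -
    have "continuous_on UNIV (\<lambda>z. cinner z (x - y))"
      by (rule linear_continuous_on[OF bounded_linear_cinner_left])
    moreover have "T = (\<lambda>z. cinner z (x - y)) -` {0}" by (auto simp: T_def)
    ultimately show ?thesis using continuous_closed_vimage by (metis closed_singleton continuous_on_eq_continuous_at open_UNIV UNIV_I)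
  qed
  ultimately have "closure (cspan (range phi)) \<subseteq> T" by (rule closure_minimal)
  then have "x - y \<in> T" using total by auto
  then show ?thesis by (simp add: T_def cinner_self)
qed

text \<open>A partial sum P of the expansion satisfies <P,u> = |P|^2, so Cauchy-Schwarz gives |P|
  \<le> |u|.\<close>

lemma bessel: "summable (\<lambda>n. (cmod (cinner u (phi n)))\<^sup>2)"
proof (rule bounded_imp_summable[where B = "(norm u)\<^sup>2"])
  fix n
  define P where "P = (\<Sum>k\<le>n. cinner u (phi k) *\<^sub>C phi k)"
  define S where "S = (\<Sum>k\<le>n. (cmod (cinner u (phi k)))\<^sup>2)"
  have nP: "(norm P)\<^sup>2 = S" unfolding P_def S_def by (rule norm_sum_sq) simp
  have "cinner P u = complex_of_real S"
    unfolding P_def S_def cinner_sum_left of_real_sum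
    by (rule sum.cong) (auto simp: cinner_scaleC_left complex_norm_square cinner_commute[of "phi _" u] simp del: of_real_power)
  then have "S \<le> norm P * norm u"
    using cinner_Cauchy_Schwarz[of P u] by simp
  then have "(norm P)\<^sup>2 \<le> norm P * norm u" using nP by simp
  then have "norm P \<le> norm u"
    by (cases "norm P = 0") (auto simp: power2_eq_square)
  then show "(\<Sum>k\<le>n. (cmod (cinner u (phi k)))\<^sup>2) \<le> (norm u)\<^sup>2"
    using power_mono[of "norm P" "norm u" 2] nP by (simp add: S_def)
qed simp

lemma series_expansion: "series (\<lambda>n. cinner u (phi n)) = u"
  by (rule eqI_coeff) (simp add: series_coeff bessel)

lemma norm_series:
  assumes c: "summable (\<lambda>n. (cmod (c n))\<^sup>2)"
  shows "(\<Sum>n. (cmod (c n))\<^sup>2) = (norm (series c))\<^sup>2"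
proof -
  have "(\<lambda>n. (norm (\<Sum>k<n. c k *\<^sub>C phi k))\<^sup>2) \<longlonglongrightarrow> (norm (series c))\<^sup>2"
    by (intro tendsto_intros series_sums[OF c, unfolded sums_def])
  then have "(\<lambda>n. (cmod (c n))\<^sup>2) sums (norm (series c))\<^sup>2"
    unfolding sums_def by (simp add: norm_sum_sq)
  then show ?thesis by (rule sums_unique[symmetric])
qed

lemma cinner_sums: "(\<lambda>n. cinner x (phi n) * cnj (cinner y (phi n))) sums cinner x y"
proof -
  have "(\<lambda>n. cinner x (phi n) *\<^sub>C phi n) sums x"
    using series_sums[OF bessel[of x]] by (simp add: series_expansion)
  from bounded_linear.sums[OF bounded_linear_cinner_left this, of y]
  show ?thesis by (simp add: cinner_scaleC_left cinner_commute[of "phi _" y])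
qed

end

section \<open>Diagonal operators on the scale H_s\<close>

locale hilbert_scale = orthonormal_basis phi for phi :: "nat \<Rightarrow> 'a::chilbert_space" +
  fixes lam :: "nat \<Rightarrow> real"
  assumes lam0: "0 < lam 0" and lam_mono: "mono lam"
begin

lemma lam_pos: "0 < lam n"
  using lam0 monoD[OF lam_mono, of 0 n] by simp

lemma Hs_0: "u \<in> Hs lam phi 0"
  using bessel[of u] lam_pos by (simp add: Hs_def less_imp_neq[symmetric])

lemma Hs_norm_0: "Hs_norm lam phi 0 u = norm u"
proof -
  have "(\<Sum>n. (cmod (cinner u (phi n)))\<^sup>2) = (norm u)\<^sup>2"
    using norm_series[OF bessel[of u]] by (simp add: series_expansion)
  then show ?thesis using lam_pos by (simp add: Hs_norm_def less_imp_neq[symmetric])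
qed

lemma Hs_norm_zero [simp]: "Hs_norm lam phi s 0 = 0"
  by (simp add: Hs_norm_def)

lemma Hs_norm_nonneg: "u \<in> Hs lam phi s \<Longrightarrow> 0 \<le> Hs_norm lam phi s u"
  unfolding Hs_norm_def Hs_def by (intro real_sqrt_ge_zero suminf_nonneg) auto

lemma multiplier_term:
  assumes "lam n powr \<rho> * cmod m \<le> K * lam n powr \<sigma>"
  shows "lam n powr (2 * \<rho>) * (cmod (c * m))\<^sup>2 \<le> K\<^sup>2 * (lam n powr (2 * \<sigma>) * (cmod c)\<^sup>2)"
proof -
  have p: "lam n powr (2 * r) = (lam n powr r)\<^sup>2" for r
    by (simp add: powr_add[symmetric] power2_eq_square)
  have "(lam n powr \<rho> * cmod m)\<^sup>2 \<le> (K * lam n powr \<sigma>)\<^sup>2"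
    by (rule power_mono[OF assms]) simp
  then have "(cmod c)\<^sup>2 * (lam n powr \<rho> * cmod m)\<^sup>2 \<le> (cmod c)\<^sup>2 * (K * lam n powr \<sigma>)\<^sup>2"
    by (rule mult_left_mono) simp
  then show ?thesis unfolding p norm_mult power_mult_distrib by (simp only: mult_ac)
qed

text \<open>Every solution operator is diagonal in the basis, and the condition on the symbol m
  makes it a map from H_\<sigma> to H_\<rho> of norm at most K. The unweighted squares, which decide
  whether \<open>series c\<close> converges, are summable because
  \<open>lam n \<ge> lam 0 > 0\<close> and \<rho> \<ge> 0.\<close>

lemma multiplier:
  assumes u0: "u0 \<in> Hs lam phi \<sigma>" and \<rho>: "0 \<le> \<rho>" and K: "0 \<le> K"
    and m: "\<And>n. lam n powr \<rho> * cmod (m n) \<le> K * lam n powr \<sigma>"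
  defines "c \<equiv> \<lambda>n. cinner u0 (phi n) * m n"
  shows "summable (\<lambda>n. (cmod (c n))\<^sup>2)"
    and "summable (\<lambda>n. lam n powr (2 * \<rho>) * (cmod (c n))\<^sup>2)"
    and "series c \<in> Hs lam phi \<rho>"
    and "Hs_norm lam phi \<rho> (series c) \<le> K * Hs_norm lam phi \<sigma> u0"
proof -
  have su: "summable (\<lambda>n. lam n powr (2 * \<sigma>) * (cmod (cinner u0 (phi n)))\<^sup>2)"
    using u0 by (simp add: Hs_def)
  have t: "lam n powr (2 * \<rho>) * (cmod (c n))\<^sup>2 \<le> K\<^sup>2 * (lam n powr (2 * \<sigma>) * (cmod (cinner u0 (phi n)))\<^sup>2)" for n
    unfolding c_def by (rule multiplier_term[OF m])
  show s2: "summable (\<lambda>n. lam n powr (2 * \<rho>) * (cmod (c n))\<^sup>2)"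
    by (rule summable_comparison_test'[OF summable_mult[OF su, of "K\<^sup>2"], of 0]) (use t in auto)
  show s1: "summable (\<lambda>n. (cmod (c n))\<^sup>2)"
  proof (rule summable_comparison_test'[OF summable_mult[OF s2, of "1 / lam 0 powr (2 * \<rho>)"], of 0])
    fix n
    have "lam 0 powr (2 * \<rho>) \<le> lam n powr (2 * \<rho>)"
      using \<rho> lam0 monoD[OF lam_mono, of 0 n] by (intro powr_mono2) auto
    then have "lam 0 powr (2 * \<rho>) * (cmod (c n))\<^sup>2 \<le> lam n powr (2 * \<rho>) * (cmod (c n))\<^sup>2"
      by (rule mult_right_mono) simp
    then show "norm ((cmod (c n))\<^sup>2) \<le> 1 / lam 0 powr (2 * \<rho>) * (lam n powr (2 * \<rho>) * (cmod (c n))\<^sup>2)"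
      using lam0 by (simp add: field_simps)
  qed
  note fc = series_coeff[OF s1]
  show "series c \<in> Hs lam phi \<rho>" using s2 by (simp add: Hs_def fc)
  have "(\<Sum>n. lam n powr (2 * \<rho>) * (cmod (c n))\<^sup>2) \<le> (\<Sum>n. K\<^sup>2 * (lam n powr (2 * \<sigma>) * (cmod (cinner u0 (phi n)))\<^sup>2))"
    by (rule suminf_le[OF t s2 summable_mult[OF su]])
  also have "\<dots> = K\<^sup>2 * (\<Sum>n. lam n powr (2 * \<sigma>) * (cmod (cinner u0 (phi n)))\<^sup>2)"
    by (rule suminf_mult[OF su])
  finally have "sqrt (\<Sum>n. lam n powr (2 * \<rho>) * (cmod (c n))\<^sup>2) \<le> sqrt (K\<^sup>2 * (\<Sum>n. lam n powr (2 * \<sigma>) * (cmod (cinner u0 (phi n)))\<^sup>2))"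
    by (rule real_sqrt_le_mono)
  then show "Hs_norm lam phi \<rho> (series c) \<le> K * Hs_norm lam phi \<sigma> u0"
    using K by (simp add: Hs_norm_def fc real_sqrt_mult)
qed

text \<open>Dominated convergence for series (Tannery), with K^2 times the series of the squared
  H_\<sigma> norm of u0 as majorant.\<close>

lemma multiplier_series_tendsto:
  assumes u0: "u0 \<in> Hs lam phi \<sigma>"
    and m: "\<forall>\<^sub>F r in F. \<forall>n. lam n powr \<rho> * cmod (m r n) \<le> K * lam n powr \<sigma>"
    and lim: "\<And>n. ((\<lambda>r. m r n) \<longlongrightarrow> l n) F"
  shows "((\<lambda>r. \<Sum>n. lam n powr (2 * \<rho>) * (cmod (cinner u0 (phi n) * m r n))\<^sup>2) \<longlongrightarrow>
     (\<Sum>n. lam n powr (2 * \<rho>) * (cmod (cinner u0 (phi n) * l n))\<^sup>2)) F"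
proof (cases "F = bot")
  case False
  have su: "summable (\<lambda>n. lam n powr (2 * \<sigma>) * (cmod (cinner u0 (phi n)))\<^sup>2)"
    using u0 by (simp add: Hs_def)
  have ev: "eventually (\<lambda>(n, r). norm (lam n powr (2 * \<rho>) * (cmod (cinner u0 (phi n) * m r n))\<^sup>2)
       \<le> K\<^sup>2 * (lam n powr (2 * \<sigma>) * (cmod (cinner u0 (phi n)))\<^sup>2)) (at_top \<times>\<^sub>F F)"
  proof -
    have "eventually (\<lambda>x. True \<and> (\<forall>n. lam n powr \<rho> * cmod (m (snd x) n) \<le> K * lam n powr \<sigma>)) ((at_top :: nat filter) \<times>\<^sub>F F)"
      using eventually_prodI[OF eventually_True[of "at_top :: nat filter"] m] by simp
    then show ?thesis
    proof eventually_elim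
      case (elim x)
      then show ?case using multiplier_term[of "fst x" \<rho> "m (snd x) (fst x)" K \<sigma> "cinner u0 (phi (fst x))"]
        by (simp add: case_prod_unfold)
    qed
  qed
  have L: "((\<lambda>r. lam n powr (2 * \<rho>) * (cmod (cinner u0 (phi n) * m r n))\<^sup>2) \<longlongrightarrow>
      lam n powr (2 * \<rho>) * (cmod (cinner u0 (phi n) * l n))\<^sup>2) F" for n
    by (intro tendsto_intros lim)
  show ?thesis
    by (rule tannerys_theorem[THEN conjunct2, THEN conjunct2, OF L ev summable_mult[OF su] False])
qed simp

text \<open>The constant K may depend on t and hold only locally, since the symbol of the Caputo
  derivative has no uniform bound near t = 0. Continuity of the norm is recorded separately, for the
  measurability in the L^2 statements.\<close>

lemma multiplier_continuous:
  assumes u0: "u0 \<in> Hs lam phi \<sigma>" and \<rho>: "0 \<le> \<rho>"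
    and m: "\<And>t. t \<in> I \<Longrightarrow> \<exists>K\<ge>0. (\<forall>n. lam n powr \<rho> * cmod (m t n) \<le> K * lam n powr \<sigma>) \<and>
        (\<forall>\<^sub>F r in at t within I. \<forall>n. lam n powr \<rho> * cmod (m r n) \<le> K * lam n powr \<sigma>)"
    and cont: "\<And>n. continuous_on I (\<lambda>t. m t n)"
  shows "Hs_continuous_on lam phi \<rho> I (\<lambda>t. series (\<lambda>n. cinner u0 (phi n) * m t n))"
    and "continuous_on I (\<lambda>t. Hs_norm lam phi \<rho> (series (\<lambda>n. cinner u0 (phi n) * m t n)))"
proof -
  let ?V = "\<lambda>t. series (\<lambda>n. cinner u0 (phi n) * m t n)"
  have lim: "((\<lambda>r. m r n) \<longlongrightarrow> m t n) (at t within I)" if "t \<in> I" for t n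
    using cont[of n] that by (simp add: continuous_on_def)
  have co: "cinner (?V t) (phi n) = cinner u0 (phi n) * m t n" if t: "t \<in> I" for t n
  proof -
    obtain K where K: "K \<ge> 0" "\<And>n. lam n powr \<rho> * cmod (m t n) \<le> K * lam n powr \<sigma>" using m[OF t] by blast
    show ?thesis by (rule series_coeff[OF multiplier(1)[OF u0 \<rho> K]])
  qed
  have inI: "\<forall>\<^sub>F r in at t within I. r \<in> I" for t
    by (simp add: eventually_at_filter)
  show "Hs_continuous_on lam phi \<rho> I ?V"
    unfolding Hs_continuous_on_def
  proof (intro conjI ballI)
    fix t assume t: "t \<in> I"
    obtain K where K: "K \<ge> 0" "\<And>n. lam n powr \<rho> * cmod (m t n) \<le> K * lam n powr \<sigma>"
      and K': "\<forall>\<^sub>F r in at t within I. \<forall>n. lam n powr \<rho> * cmod (m r n) \<le> K * lam n powr \<sigma>" using m[OF t] by blast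
    show "?V t \<in> Hs lam phi \<rho>" by (rule multiplier(3)[OF u0 \<rho> K])
    \<comment> \<open>The convergence is applied to the symbol \<open>m r n - m t n\<close>, which
      is bounded with 2 K and tends to 0 for each n.\<close>
    have "((\<lambda>r. \<Sum>n. lam n powr (2 * \<rho>) * (cmod (cinner u0 (phi n) * (m r n - m t n)))\<^sup>2) \<longlongrightarrow>
       (\<Sum>n. lam n powr (2 * \<rho>) * (cmod (cinner u0 (phi n) * 0))\<^sup>2)) (at t within I)"
    proof (rule multiplier_series_tendsto[OF u0, where K = "2 * K"])
      show "\<forall>\<^sub>F r in at t within I. \<forall>n. lam n powr \<rho> * cmod (m r n - m t n) \<le> (2 * K) * lam n powr \<sigma>"
        using K'
      proof eventually_elim
        case (elim r)
        show ?case
        proof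
          fix n
          have "lam n powr \<rho> * cmod (m r n - m t n) \<le> lam n powr \<rho> * (cmod (m r n) + cmod (m t n))"
            by (intro mult_left_mono norm_triangle_ineq4) auto
          then show "lam n powr \<rho> * cmod (m r n - m t n) \<le> (2 * K) * lam n powr \<sigma>"
            using elim[rule_format, of n] K(2)[of n] by (simp add: algebra_simps)
        qed
      qed
      show "((\<lambda>r. m r n - m t n) \<longlongrightarrow> 0) (at t within I)" for n
        using lim[OF t, of n] by (simp add: LIM_zero)
    qed
    then have T: "((\<lambda>r. sqrt (\<Sum>n. lam n powr (2 * \<rho>) * (cmod (cinner u0 (phi n) * (m r n - m t n)))\<^sup>2)) \<longlongrightarrow> sqrt 0) (at t within I)"
      by (intro tendsto_real_sqrt) simp
    have E: "\<forall>\<^sub>F r in at t within I. sqrt (\<Sum>n. lam n powr (2 * \<rho>) * (cmod (cinner u0 (phi n) * (m r n - m t n)))\<^sup>2)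
        = Hs_norm lam phi \<rho> (?V r - ?V t)"
      using inI by eventually_elim (simp add: Hs_norm_def cinner_diff_left co t right_diff_distrib)
    show "((\<lambda>r. Hs_norm lam phi \<rho> (?V r - ?V t)) \<longlongrightarrow> 0) (at t within I)"
      using T unfolding tendsto_cong[OF E] by simp
  qed
  show "continuous_on I (\<lambda>t. Hs_norm lam phi \<rho> (?V t))"
    unfolding continuous_on_def
  proof
    fix t assume t: "t \<in> I"
    obtain K where K: "K \<ge> 0" "\<And>n. lam n powr \<rho> * cmod (m t n) \<le> K * lam n powr \<sigma>"
      and K': "\<forall>\<^sub>F r in at t within I. \<forall>n. lam n powr \<rho> * cmod (m r n) \<le> K * lam n powr \<sigma>" using m[OF t] by blast
    have T: "((\<lambda>r. sqrt (\<Sum>n. lam n powr (2 * \<rho>) * (cmod (cinner u0 (phi n) * m r n))\<^sup>2)) \<longlongrightarrow>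
       sqrt (\<Sum>n. lam n powr (2 * \<rho>) * (cmod (cinner u0 (phi n) * m t n))\<^sup>2)) (at t within I)"
      by (intro tendsto_real_sqrt multiplier_series_tendsto[OF u0 K' lim[OF t]])
    have E: "\<forall>\<^sub>F r in at t within I. sqrt (\<Sum>n. lam n powr (2 * \<rho>) * (cmod (cinner u0 (phi n) * m r n))\<^sup>2)
        = Hs_norm lam phi \<rho> (?V r)"
      using inI by eventually_elim (simp add: Hs_norm_def co)
    have N: "sqrt (\<Sum>n. lam n powr (2 * \<rho>) * (cmod (cinner u0 (phi n) * m t n))\<^sup>2) = Hs_norm lam phi \<rho> (?V t)"
      by (simp add: Hs_norm_def co[OF t])
    show "((\<lambda>t. Hs_norm lam phi \<rho> (?V t)) \<longlongrightarrow> Hs_norm lam phi \<rho> (?V t)) (at t within I)"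
      using T unfolding tendsto_cong[OF E] N .
  qed
qed

lemma Hs_continuous_on_0: "Hs_continuous_on lam phi 0 I f \<longleftrightarrow> continuous_on I f"
  by (simp add: Hs_continuous_on_def Hs_0 Hs_norm_0 continuous_on_def tendsto_norm_zero_iff LIM_zero_iff)

lemma Hs_continuous_on_cong:
  assumes "\<And>t. t \<in> I \<Longrightarrow> f t = g t"
  shows "Hs_continuous_on lam phi s I f \<longleftrightarrow> Hs_continuous_on lam phi s I g"
proof -
  have "((\<lambda>r. Hs_norm lam phi s (f r - f t)) \<longlongrightarrow> 0) (at t within I) \<longleftrightarrow>
     ((\<lambda>r. Hs_norm lam phi s (g r - g t)) \<longlongrightarrow> 0) (at t within I)" if "t \<in> I" for t
    by (rule tendsto_cong) (use that assms in \<open>auto simp: eventually_at_filter\<close>)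
  then show ?thesis using assms by (simp add: Hs_continuous_on_def)
qed

lemma Hs_continuous_on_subset:
  assumes "Hs_continuous_on lam phi s I f" "J \<subseteq> I"
  shows "Hs_continuous_on lam phi s J f"
  using assms unfolding Hs_continuous_on_def by (meson subsetD tendsto_within_subset)

text \<open>Sampling f on the grid of mesh 1 / (k + 1) gives simple functions that converge by
  continuity. Grid points may lie beyond T, so continuity is asked on all of (0, \<infinity>). The
  squared bound is a multiple of t^(-\<alpha>), integrable at 0 as \<alpha> < 1.\<close>

lemma Hs_L2_of_continuous:
  assumes f: "Hs_continuous_on lam phi s {0<..} f"
    and n: "continuous_on {0<..} (\<lambda>t. Hs_norm lam phi s (f t))"
    and b: "\<And>t. 0 < t \<Longrightarrow> Hs_norm lam phi s (f t) \<le> K * t powr (- \<alpha> / 2)"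
    and \<alpha>: "\<alpha> < 1" and K: "0 \<le> K" and T: "0 < T"
  shows "Hs_L2 lam phi s T f" and "Hs_L2_norm lam phi s T f \<le> K * sqrt (T powr (1 - \<alpha>) / (1 - \<alpha>))"
proof -
  let ?M = "lebesgue_on {0<..<T}"
  have S: "{0<..<T} \<in> sets lebesgue" by simp
  have hp: "((\<lambda>t. t powr (- \<alpha>)) has_integral (T powr (1 - \<alpha>) / (1 - \<alpha>))) {0<..<T}"
    using has_integral_powr_from_0[of "- \<alpha>" T] \<alpha> T by (simp add: has_integral_Icc_iff_Ioo add.commute)
  then have "(\<lambda>t. t powr (- \<alpha>)) absolutely_integrable_on {0<..<T}"
    by (intro nonnegative_absolutely_integrable_1) (auto simp: has_integral_integrable)
  then have ip: "integrable ?M (\<lambda>t. t powr (- \<alpha>))" by (rule absolutely_integrable_imp_integrable) simp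
  have pw: "(Hs_norm lam phi s (f t))\<^sup>2 \<le> K\<^sup>2 * t powr (- \<alpha>)" if "t \<in> {0<..<T}" for t
  proof -
    have "(Hs_norm lam phi s (f t))\<^sup>2 \<le> (K * t powr (- \<alpha> / 2))\<^sup>2"
      using b[of t] that f by (intro power_mono Hs_norm_nonneg) (auto simp: Hs_continuous_on_def)
    also have "\<dots> = K\<^sup>2 * t powr (- \<alpha>)"
      using that by (simp add: power_mult_distrib powr_power)
    finally show ?thesis .
  qed
  have im: "integrable ?M (\<lambda>t. (Hs_norm lam phi s (f t))\<^sup>2)"
  proof (rule Bochner_Integration.integrable_bound[OF integrable_mult_right[OF ip, of "K\<^sup>2"]])
    show "(\<lambda>t. (Hs_norm lam phi s (f t))\<^sup>2) \<in> borel_measurable ?M"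
      by (intro continuous_imp_measurable_on_sets_lebesgue S continuous_intros continuous_on_subset[OF n]) auto
    show "AE t in ?M. norm ((Hs_norm lam phi s (f t))\<^sup>2) \<le> norm (K\<^sup>2 * t powr (- \<alpha>))"
      using pw by (intro AE_I2) (auto simp: abs_mult)
  qed
  \<comment> \<open>rounding up keeps the sample points positive, where \<open>f\<close> is defined\<close>
  define q where "q = (\<lambda>(k::nat) t. (real_of_int \<lfloor>(real k + 1) * t\<rfloor> + 1) / (real k + 1))"
  have qp: "q k t > 0" if "t > 0" for k t
    using that unfolding q_def by (intro divide_pos_pos add_nonneg_pos) auto
  have qb: "\<bar>q k t - t\<bar> \<le> 1 / (real k + 1)" for k t
  proof -
    have "q k t - t = (real_of_int \<lfloor>(real k + 1) * t\<rfloor> + 1 - (real k + 1) * t) / (real k + 1)"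
      by (simp add: q_def diff_divide_distrib)
    moreover have "\<bar>real_of_int \<lfloor>(real k + 1) * t\<rfloor> + 1 - (real k + 1) * t\<bar> \<le> 1" by linarith
    ultimately show ?thesis by (simp add: divide_right_mono)
  qed
  have ql: "(\<lambda>k. q k t) \<longlonglongrightarrow> t" for t
  proof (rule LIM_zero_cancel, rule Lim_null_comparison)
    show "\<forall>\<^sub>F k in sequentially. norm (q k t - t) \<le> 1 / (real k + 1)" using qb by simp
    show "(\<lambda>k. 1 / (real k + 1)) \<longlonglongrightarrow> 0" using LIMSEQ_inverse_real_of_nat by (simp add: inverse_eq_divide add.commute)
  qed
  have qs: "simple_function ?M (q k)" for k
  proof (rule simple_function_borel_measurable)
    have "q k \<in> borel_measurable borel" unfolding q_def by measurable
    then show "q k \<in> borel_measurable ?M"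
      by (intro measurable_restrict_space1 measurable_completion) simp
    have "q k ` space ?M \<subseteq> (\<lambda>j. (real_of_int j + 1) / (real k + 1)) ` {0..\<lfloor>(real k + 1) * T\<rfloor>}"
    proof
      fix x assume "x \<in> q k ` space ?M"
      then obtain t where t: "0 < t" "t < T" "x = q k t" by auto
      then have "(real k + 1) * t \<le> (real k + 1) * T" by (intro mult_left_mono) auto
      then have "\<lfloor>(real k + 1) * t\<rfloor> \<in> {0..\<lfloor>(real k + 1) * T\<rfloor>}" using t by (auto intro: floor_mono)
      then show "x \<in> (\<lambda>j. (real_of_int j + 1) / (real k + 1)) ` {0..\<lfloor>(real k + 1) * T\<rfloor>}"
        using t(3) unfolding q_def by blast
    qed
    then show "finite (q k ` space ?M)" by (rule finite_subset) simp
  qed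
  show "Hs_L2 lam phi s T f"
    unfolding Hs_L2_def
  proof (intro conjI exI[of _ "\<lambda>k t. f (q k t)"] allI)
    fix k
    show "simple_function ?M (\<lambda>t. f (q k t))" by (rule simple_function_compose1[OF qs])
    show "(\<lambda>t. f (q k t)) ` {0<..<T} \<subseteq> Hs lam phi s"
      using f qp by (auto simp: Hs_continuous_on_def)
  next
    show "AE t in ?M. f t \<in> Hs lam phi s \<and> (\<lambda>k. Hs_norm lam phi s (f (q k t) - f t)) \<longlonglongrightarrow> 0"
    proof (rule AE_I2)
      fix t assume "t \<in> space ?M"
      then have t: "0 < t" by simp
      have "continuous (at t within {0<..}) (\<lambda>r. Hs_norm lam phi s (f r - f t))"
        using f t by (simp add: continuous_within Hs_continuous_on_def)
      from continuous_within_tendsto_compose'[OF this _ ql] qp[OF t]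
      have "(\<lambda>k. Hs_norm lam phi s (f (q k t) - f t)) \<longlonglongrightarrow> Hs_norm lam phi s (f t - f t)"
        by auto
      then show "f t \<in> Hs lam phi s \<and> (\<lambda>k. Hs_norm lam phi s (f (q k t) - f t)) \<longlonglongrightarrow> 0"
        using f t by (simp add: Hs_continuous_on_def)
    qed
  qed (rule im)
  have "(LINT t|?M. (Hs_norm lam phi s (f t))\<^sup>2) \<le> (LINT t|?M. K\<^sup>2 * t powr (- \<alpha>))"
    by (rule integral_mono[OF im integrable_mult_right[OF ip]]) (use pw in auto)
  also have "\<dots> = K\<^sup>2 * (T powr (1 - \<alpha>) / (1 - \<alpha>))"
    using lebesgue_integral_eq_integral[OF ip S] integral_unique[OF hp] by simp
  finally have "Hs_L2_norm lam phi s T f \<le> sqrt (K\<^sup>2 * (T powr (1 - \<alpha>) / (1 - \<alpha>)))"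
    unfolding Hs_L2_norm_def by (rule real_sqrt_le_mono)
  then show "Hs_L2_norm lam phi s T f \<le> K * sqrt (T powr (1 - \<alpha>) / (1 - \<alpha>))"
    unfolding real_sqrt_mult real_sqrt_abs using K by simp
qed

end

section \<open>The solution in the Hilbert space\<close>

text \<open>The scalar bounds enter with one constant for all l > 0, so that C is fixed before any
  datum is chosen; \<open>ml_sol_estimates\<close> supplies it.\<close>

locale fractional_evolution = hilbert_scale phi lam
  for phi :: "nat \<Rightarrow> 'a::chilbert_space" and lam +
  fixes \<alpha> C :: real
  assumes \<alpha>: "0 < \<alpha>" "\<alpha> < 1" and C: "0 < C"
    and sol_bound: "\<And>l t. 0 < l \<Longrightarrow> 0 \<le> t \<Longrightarrow> cmod (ml_sol \<alpha> l t) \<le> C"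
    and deriv_bound: "\<And>l t. 0 < l \<Longrightarrow> 0 < t \<Longrightarrow> cmod (ml_sol_deriv \<alpha> l t) \<le> C / t"
    and primitive_bound: "\<And>l r t. 0 < l \<Longrightarrow> 0 < t \<Longrightarrow> 0 \<le> r \<Longrightarrow> r \<le> t \<Longrightarrow>
        cmod (integral {0..r} (\<lambda>s. (t - s) powr (- \<alpha>) *\<^sub>R ml_sol_deriv \<alpha> l s)) \<le> C * t powr (- \<alpha>)"
    and decay: "\<And>l t. 0 < l \<Longrightarrow> 0 < t \<Longrightarrow> l * cmod (ml_sol \<alpha> l t) \<le> C * t powr (- \<alpha>)"
begin

definition sol :: "'a \<Rightarrow> real \<Rightarrow> 'a" where
  "sol u0 t = series (\<lambda>n. cinner u0 (phi n) * ml_sol \<alpha> (lam n) t)"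

text \<open>The candidate for the Caputo derivative. At t = 0 its coefficients are square summable
  only for data in H_1; for smoother data it continues the derivative to t = 0.\<close>

definition dsol :: "'a \<Rightarrow> real \<Rightarrow> 'a" where
  "dsol u0 t = series (\<lambda>n. cinner u0 (phi n) * (- \<i> * complex_of_real (lam n) * ml_sol \<alpha> (lam n) t))"

lemma multiplier_continuous_uniform:
  assumes u0: "u0 \<in> Hs lam phi \<sigma>" and \<rho>: "0 \<le> \<rho>" and K: "0 \<le> K"
    and m: "\<And>t n. t \<in> I \<Longrightarrow> lam n powr \<rho> * cmod (m t n) \<le> K * lam n powr \<sigma>"
    and cont: "\<And>n. continuous_on I (\<lambda>t. m t n)"
  shows "Hs_continuous_on lam phi \<rho> I (\<lambda>t. series (\<lambda>n. cinner u0 (phi n) * m t n))"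
proof (rule multiplier_continuous(1)[OF u0 \<rho> _ cont])
  fix t assume "t \<in> I"
  then show "\<exists>K\<ge>0. (\<forall>n. lam n powr \<rho> * cmod (m t n) \<le> K * lam n powr \<sigma>) \<and>
        (\<forall>\<^sub>F r in at t within I. \<forall>n. lam n powr \<rho> * cmod (m r n) \<le> K * lam n powr \<sigma>)"
    using K m by (intro exI[of _ K]) (auto simp: eventually_at_filter)
qed

text \<open>The bound at t / 2 serves the whole neighbourhood r > t / 2, because the power of t in
  it is nonincreasing.\<close>

lemma multiplier_continuous_pos:
  assumes u0: "u0 \<in> Hs lam phi \<sigma>" and \<rho>: "0 \<le> \<rho>" and K: "0 \<le> K" and b: "0 \<le> b"
    and m: "\<And>t n. 0 < t \<Longrightarrow> lam n powr \<rho> * cmod (m t n) \<le> (K * t powr (- b)) * lam n powr \<sigma>"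
    and cont: "\<And>n. continuous_on {0<..} (\<lambda>t. m t n)"
  shows "Hs_continuous_on lam phi \<rho> {0<..} (\<lambda>t. series (\<lambda>n. cinner u0 (phi n) * m t n))"
    and "continuous_on {0<..} (\<lambda>t. Hs_norm lam phi \<rho> (series (\<lambda>n. cinner u0 (phi n) * m t n)))"
proof -
  have *: "\<exists>K\<ge>0. (\<forall>n. lam n powr \<rho> * cmod (m t n) \<le> K * lam n powr \<sigma>) \<and>
        (\<forall>\<^sub>F r in at t within {0<..}. \<forall>n. lam n powr \<rho> * cmod (m r n) \<le> K * lam n powr \<sigma>)"
    if "t \<in> {0<..}" for t
  proof -
    have t: "0 < t" using that by simp
    have near: "lam n powr \<rho> * cmod (m r n) \<le> (K * (t / 2) powr (- b)) * lam n powr \<sigma>" if "t / 2 < r" for r n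
    proof -
      have "r powr (- b) \<le> (t / 2) powr (- b)" using that t b by (intro powr_mono2') auto
      then have "(K * r powr (- b)) * lam n powr \<sigma> \<le> (K * (t / 2) powr (- b)) * lam n powr \<sigma>"
        using K by (intro mult_right_mono mult_left_mono) auto
      moreover have "lam n powr \<rho> * cmod (m r n) \<le> (K * r powr (- b)) * lam n powr \<sigma>"
        by (rule m) (use that t in simp)
      ultimately show ?thesis by linarith
    qed
    have "\<forall>\<^sub>F r in at t within {0<..}. t / 2 < r"
      using t by (intro order_tendstoD(1)[OF tendsto_ident_at]) simp
    then have "\<forall>\<^sub>F r in at t within {0<..}. \<forall>n. lam n powr \<rho> * cmod (m r n) \<le> (K * (t / 2) powr (- b)) * lam n powr \<sigma>"
      by eventually_elim (use near in blast)
    moreover have "\<forall>n. lam n powr \<rho> * cmod (m t n) \<le> (K * (t / 2) powr (- b)) * lam n powr \<sigma>"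
      using near[of t] t by simp
    ultimately show ?thesis using K by (intro exI[of _ "K * (t / 2) powr (- b)"]) auto
  qed
  show "Hs_continuous_on lam phi \<rho> {0<..} (\<lambda>t. series (\<lambda>n. cinner u0 (phi n) * m t n))"
    by (rule multiplier_continuous(1)[OF u0 \<rho> * cont])
  show "continuous_on {0<..} (\<lambda>t. Hs_norm lam phi \<rho> (series (\<lambda>n. cinner u0 (phi n) * m t n)))"
    by (rule multiplier_continuous(2)[OF u0 \<rho> * cont])
qed

section \<open>Symbol bounds for the solution and its Caputo derivative\<close>

lemma sol_cont: "continuous_on {0<..} (\<lambda>t. ml_sol \<alpha> l t)" "continuous_on {0..b} (\<lambda>t. ml_sol \<alpha> l t)"
  by (rule continuous_on_subset[OF continuous_on_ml_sol[OF \<alpha>]], auto)+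

lemma sol_multiplier: "0 \<le> t \<Longrightarrow> lam n powr \<sigma> * cmod (ml_sol \<alpha> (lam n) t) \<le> C * lam n powr \<sigma>"
  using mult_left_mono[OF sol_bound[OF lam_pos], of t "lam n powr \<sigma>" n] by (simp add: mult.commute)

lemma dsol_multiplier_norm:
  "lam n powr \<sigma> * cmod (- \<i> * complex_of_real (lam n) * ml_sol \<alpha> (lam n) t) = lam n powr (\<sigma> + 1) * cmod (ml_sol \<alpha> (lam n) t)"
  using lam_pos[of n] by (simp add: norm_mult powr_add)

lemma decay_multiplier:
  assumes "0 < t"
  shows "lam n powr (\<sigma> + 1) * cmod (ml_sol \<alpha> (lam n) t) \<le> (C * t powr (- \<alpha>)) * lam n powr \<sigma>"
proof -
  have "lam n powr \<sigma> * (lam n * cmod (ml_sol \<alpha> (lam n) t)) \<le> lam n powr \<sigma> * (C * t powr (- \<alpha>))"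
    by (rule mult_left_mono[OF decay[OF lam_pos assms]]) simp
  then show ?thesis using lam_pos[of n] by (simp add: powr_add mult_ac)
qed

text \<open>The geometric mean of decay and boundedness: \<lambda> |y|^2 = (\<lambda> |y|) |y| is at
  most C^2 t^(-\<alpha>). Half a power of \<lambda> thus costs t^(-\<alpha>/2), which is square
  integrable at 0.\<close>

lemma half_decay_multiplier:
  assumes t: "0 < t"
  shows "lam n powr (\<sigma> + 1) * cmod (ml_sol \<alpha> (lam n) t) \<le> (C * t powr (- (\<alpha> / 2))) * lam n powr (\<sigma> + 1/2)"
proof -
  let ?e = "cmod (ml_sol \<alpha> (lam n) t)"
  have "lam n powr (1/2) * ?e \<le> C * t powr (- (\<alpha> / 2))"
  proof (rule power2_le_imp_le)
    have "(lam n powr (1/2) * ?e)\<^sup>2 = (lam n * ?e) * ?e"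
      using lam_pos[of n] by (simp add: power_mult_distrib powr_power power2_eq_square[of ?e])
    also have "\<dots> \<le> (C * t powr (- \<alpha>)) * C"
      by (rule mult_mono[OF decay[OF lam_pos t] sol_bound[OF lam_pos less_imp_le[OF t]]]) (use C in auto)
    also have "\<dots> = (C * t powr (- (\<alpha> / 2)))\<^sup>2"
      using t by (simp add: power_mult_distrib powr_power power2_eq_square[of C])
    finally show "(lam n powr (1/2) * ?e)\<^sup>2 \<le> (C * t powr (- (\<alpha> / 2)))\<^sup>2" .
  qed (use C in simp)
  then have "lam n powr (\<sigma> + 1/2) * (lam n powr (1/2) * ?e) \<le> lam n powr (\<sigma> + 1/2) * (C * t powr (- (\<alpha> / 2)))"
    by (rule mult_left_mono) simp
  moreover have "lam n powr (\<sigma> + 1) = lam n powr (\<sigma> + 1/2) * lam n powr (1/2)"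
    unfolding powr_add[symmetric] by (rule arg_cong[where f = "\<lambda>x. lam n powr x"]) simp
  ultimately show ?thesis by (simp add: mult_ac)
qed

lemma sol_continuous:
  assumes "u0 \<in> Hs lam phi \<sigma>" "0 \<le> \<sigma>"
  shows "Hs_continuous_on lam phi \<sigma> {0..T} (sol u0)"
  unfolding sol_def[abs_def] using C
  by (intro multiplier_continuous_uniform[OF assms, of C] sol_multiplier sol_cont) auto

lemma sol_norm:
  assumes "u0 \<in> Hs lam phi \<sigma>" "0 \<le> \<sigma>" "0 \<le> t"
  shows "Hs_norm lam phi \<sigma> (sol u0 t) \<le> C * Hs_norm lam phi \<sigma> u0"
  unfolding sol_def using C assms(3) by (intro multiplier(4)[OF assms(1,2)] sol_multiplier) auto

lemma sol_0: "sol u0 0 = u0"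
  using \<alpha> by (simp add: sol_def series_expansion)

lemma sol_coeff: "0 \<le> t \<Longrightarrow> cinner (sol u0 t) (phi n) = cinner u0 (phi n) * ml_sol \<alpha> (lam n) t"
  unfolding sol_def
  by (rule series_coeff[OF multiplier(1)[OF Hs_0 order_refl less_imp_le[OF C] sol_multiplier]])

lemma dsol_multiplier:
  "0 < t \<Longrightarrow> lam n powr \<sigma> * cmod (- \<i> * complex_of_real (lam n) * ml_sol \<alpha> (lam n) t) \<le> (C * t powr (- \<alpha>)) * lam n powr \<sigma>"
  unfolding dsol_multiplier_norm by (rule decay_multiplier)

lemma decay_const_nonneg: "0 \<le> C * t powr (- \<alpha>)"
  using C by simp

lemma dsol_coeff:
  "0 < t \<Longrightarrow> cinner (dsol u0 t) (phi n) = cinner u0 (phi n) * (- \<i> * complex_of_real (lam n) * ml_sol \<alpha> (lam n) t)"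
  unfolding dsol_def
  by (rule series_coeff[OF multiplier(1)[OF Hs_0 order_refl decay_const_nonneg dsol_multiplier]])

lemma sol_sums:
  assumes "0 \<le> t"
  shows "(\<lambda>n. (cinner u0 (phi n) * ml_sol \<alpha> (lam n) t) *\<^sub>C phi n) sums sol u0 t"
  unfolding sol_def
  by (rule series_sums[OF multiplier(1)[OF Hs_0 order_refl less_imp_le[OF C] sol_multiplier[OF assms]]])

text \<open>All integrals are identified coefficient by coefficient. On [a,b] with a > 0 the symbols
  of the derivative are bounded by C / a. Up to 0 only the primitives \<open>p n\<close> are under
  control, by a bound C t^(-\<alpha>) common to all n and r, and this uniformity makes their series
  continuous on the closed interval.\<close>

lemma sol_has_caputo_derivative:
  assumes t: "0 < t"
  shows "has_caputo_derivative \<alpha> (sol u0) (dsol u0 t) t"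
proof -
  define c where "c = (\<lambda>n. cinner u0 (phi n))"
  define U' where "U' = (\<lambda>s. series (\<lambda>n. c n * ml_sol_deriv \<alpha> (lam n) s))"
  define p where "p = (\<lambda>n r. integral {0..r} (\<lambda>s. (t - s) powr (- \<alpha>) *\<^sub>R ml_sol_deriv \<alpha> (lam n) s))"
  \<comment> \<open>\<open>P\<close> is a primitive of \<open>W\<close> that is continuous up to both end points, so the fundamental theorem
    of calculus gives the improper integral over $[0,t]$ at once.\<close>
  define P where "P = (\<lambda>r. series (\<lambda>n. c n * p n r))"
  define W where "W = (\<lambda>s. (t - s) powr (- \<alpha>) *\<^sub>R U' s)"
  \<comment> \<open>In H the symbol condition is used with exponent 0, and
    \<open>lam n powr 0\<close> is 1 only for nonzero \<open>lam n\<close>.\<close>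
  have lam_ne: "lam n \<noteq> 0" for n using lam_pos[of n] by simp
  have dmult: "lam n powr 0 * cmod (ml_sol_deriv \<alpha> (lam n) s) \<le> C / a * lam n powr 0" if "0 < a" "a \<le> s" for a s n
  proof -
    have "cmod (ml_sol_deriv \<alpha> (lam n) s) \<le> C / s" by (rule deriv_bound[OF lam_pos]) (use that in simp)
    also have "\<dots> \<le> C / a" using that C by (intro divide_left_mono) auto
    finally show ?thesis using lam_ne by simp
  qed
  have U'c: "cinner (U' s) (phi n) = c n * ml_sol_deriv \<alpha> (lam n) s" if "0 < s" for s n
    unfolding U'_def c_def
    by (intro series_coeff multiplier(1)[OF Hs_0 order_refl, of "C / s"] dmult) (use that C in auto)
  have dcont: "continuous_on {a..b} (ml_sol_deriv \<alpha> l)" if "0 < a" for a b l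
    by (rule continuous_on_subset[OF continuous_on_ml_sol_deriv[OF \<alpha>]]) (use that in auto)
  have U'cont: "continuous_on {a..b} U'" if a: "0 < a" for a b
  proof -
    have "Hs_continuous_on lam phi 0 {a..b} U'"
      unfolding U'_def c_def
      by (intro multiplier_continuous_uniform[OF Hs_0 order_refl, of "C / a"] dmult dcont) (use a C in auto)
    then show ?thesis by (simp add: Hs_continuous_on_0)
  qed
  have U'int: "(U' has_integral (sol u0 b - sol u0 a)) {a..b}" if ab: "0 < a" "a \<le> b" for a b
  proof -
    have i: "(U' has_integral integral {a..b} U') {a..b}"
      by (intro integrable_integral integrable_continuous_interval U'cont ab)
    have "integral {a..b} U' = sol u0 b - sol u0 a"
    proof (rule eqI_coeff)
      fix n
      have "(ml_sol_deriv \<alpha> (lam n) has_integral ml_sol \<alpha> (lam n) b - ml_sol \<alpha> (lam n) a) {a..b}"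
        by (rule fundamental_theorem_of_calculus[OF ab(2)])
          (use ab in \<open>auto intro!: has_vector_derivative_at_within has_vector_derivative_ml_sol[OF \<alpha>]\<close>)
      then have "((\<lambda>s. c n * ml_sol_deriv \<alpha> (lam n) s) has_integral c n * (ml_sol \<alpha> (lam n) b - ml_sol \<alpha> (lam n) a)) {a..b}"
        by (rule has_integral_mult_right)
      then have "((\<lambda>s. cinner (U' s) (phi n)) has_integral c n * (ml_sol \<alpha> (lam n) b - ml_sol \<alpha> (lam n) a)) {a..b}"
        by (rule has_integral_eq[rotated]) (use U'c ab in auto)
      from has_integral_unique[OF has_integral_cinner_left[OF i] this]
      show "cinner (integral {a..b} U') (phi n) = cinner (sol u0 b - sol u0 a) (phi n)"
        using ab by (simp add: cinner_diff_left sol_coeff c_def algebra_simps)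
    qed
    then show ?thesis using i by simp
  qed
  have loc: "has_locally_integrable_derivative (sol u0) U' t"
    unfolding has_locally_integrable_derivative_def
  proof (intro ballI conjI)
    fix \<epsilon> assume e: "\<epsilon> \<in> {0<..t}"
    show "(\<lambda>s. norm (U' s)) integrable_on {\<epsilon>..t}"
      by (intro integrable_continuous_interval continuous_on_norm U'cont) (use e in auto)
    fix r assume "r \<in> {\<epsilon>..t}"
    then show "(U' has_integral (sol u0 r - sol u0 \<epsilon>)) {\<epsilon>..r}"
      by (intro U'int) (use e in auto)
  qed
  have hi: "(\<lambda>s. (t - s) powr (- \<alpha>) *\<^sub>R ml_sol_deriv \<alpha> (lam n) s) integrable_on {0..t}" for n
    by (rule set_lebesgue_integral_eq_integral(1)[OF ml_sol_caputo(1)[OF \<alpha> t lam_pos]])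
  have pmult: "lam n powr 0 * cmod (p n r) \<le> (C * t powr (- \<alpha>)) * lam n powr 0" if "r \<in> {0..t}" for r n
    unfolding p_def using primitive_bound[OF lam_pos t, of r n] that lam_ne by simp
  have Ct: "0 \<le> C * t powr (- \<alpha>)" using C by simp
  have Pc: "cinner (P r) (phi n) = c n * p n r" if "r \<in> {0..t}" for r n
    unfolding P_def c_def
    by (intro series_coeff multiplier(1)[OF Hs_0 order_refl Ct] pmult that)
  have pcont: "continuous_on {0..t} (\<lambda>r. p n r)" for n
    unfolding p_def by (rule indefinite_integral_continuous_1[OF hi])
  have Pcont: "continuous_on {0..t} P"
  proof -
    have "Hs_continuous_on lam phi 0 {0..t} P"
      unfolding P_def c_def
      by (intro multiplier_continuous_uniform[OF Hs_0 order_refl Ct] pmult pcont)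
    then show ?thesis by (simp add: Hs_continuous_on_0)
  qed
  have Wcont: "continuous_on {a..b} W" if "0 < a" "b < t" for a b
    unfolding W_def by (intro continuous_intros U'cont) (use that in auto)
  have Wint: "integral {a..b} W = P b - P a" if ab: "0 < a" "a \<le> b" "b < t" for a b
  proof (rule eqI_coeff)
    fix n
    let ?h = "\<lambda>s. (t - s) powr (- \<alpha>) *\<^sub>R ml_sol_deriv \<alpha> (lam n) s"
    have i: "(W has_integral integral {a..b} W) {a..b}"
      by (intro integrable_integral integrable_continuous_interval Wcont ab)
    have hab: "?h integrable_on {a..b}" "?h integrable_on {0..b}"
      by (rule integrable_on_subinterval[OF hi], use ab in simp)+
    have "p n a + integral {a..b} ?h = p n b"
      unfolding p_def using ab by (intro Henstock_Kurzweil_Integration.integral_combine hab) auto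
    then have "(?h has_integral p n b - p n a) {a..b}"
      using integrable_integral[OF hab(1)] by (simp add: algebra_simps flip: \<open>_ = p n b\<close>)
    then have "((\<lambda>s. c n * ?h s) has_integral c n * (p n b - p n a)) {a..b}"
      by (rule has_integral_mult_right)
    then have "((\<lambda>s. cinner (W s) (phi n)) has_integral c n * (p n b - p n a)) {a..b}"
      by (rule has_integral_eq[rotated]) (use U'c ab in \<open>auto simp: W_def cinner_scaleR_left\<close>)
    from has_integral_unique[OF has_integral_cinner_left[OF i] this]
    show "cinner (integral {a..b} W) (phi n) = cinner (P b - P a) (phi n)"
      using ab by (simp add: cinner_diff_left Pc algebra_simps)
  qed
  have "(W has_integral (P t - P 0)) {0..t}"
  proof (rule fundamental_theorem_of_calculus_interior[OF less_imp_le[OF t] Pcont])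
    fix r assume r: "r \<in> {0<..<t}"
    \<comment> \<open>A compact neighbourhood of r inside (0,t): W is continuous there, whereas it
      may be singular at both end points.\<close>
    define a b where "a = r / 2" and "b = (r + t) / 2"
    have ab: "0 < a" "a < r" "r < b" "b < t" using r by (auto simp: a_def b_def)
    have "((\<lambda>u. integral {a..u} W) has_vector_derivative W r) (at r within {a..b})"
      by (rule integral_has_vector_derivative[OF Wcont]) (use ab in auto)
    then have "((\<lambda>u. P a + integral {a..u} W) has_vector_derivative W r) (at r within {a..b})"
      by (auto intro!: derivative_eq_intros)
    then have "(P has_vector_derivative W r) (at r within {a..b})"
      by (rule has_vector_derivative_transform[rotated 2]) (use ab Wint in auto)
    moreover have "at r within {a..b} = at r" using ab by (intro at_within_interior) auto
    ultimately show "(P has_vector_derivative W r) (at r)" by simp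
  qed
  moreover have "P 0 = 0" by (simp add: P_def p_def series_def complex_vector.scale_zero_left)
  moreover have "P t = Gamma (1 - \<alpha>) *\<^sub>R dsol u0 t"
  proof (rule eqI_coeff)
    fix n
    show "cinner (P t) (phi n) = cinner (Gamma (1 - \<alpha>) *\<^sub>R dsol u0 t) (phi n)"
      using t ml_sol_caputo(2)[OF \<alpha> t lam_pos, of n]
      by (simp add: Pc dsol_coeff cinner_scaleR_left p_def c_def scaleR_conv_of_real)
  qed
  ultimately have "(W has_integral Gamma (1 - \<alpha>) *\<^sub>R dsol u0 t) {0..t}" by simp
  moreover have "Gamma (1 - \<alpha>) > 0" using \<alpha> by (intro Gamma_real_pos) auto
  ultimately show ?thesis
    unfolding has_caputo_derivative_def W_def
    using t loc by (intro conjI exI[of _ U']) (auto simp: has_integral_integrable integral_unique)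
qed

lemma caputo_derivative_sol: "0 < t \<Longrightarrow> caputo_derivative \<alpha> (sol u0) t = dsol u0 t"
  by (rule caputo_derivative_eq[OF sol_has_caputo_derivative \<alpha>(2)])

lemma dsol_continuous_pos:
  assumes "u0 \<in> Hs lam phi s" "0 \<le> s"
  shows "Hs_continuous_on lam phi s {0<..} (dsol u0)"
  unfolding dsol_def[abs_def]
  by (rule multiplier_continuous_pos(1)[OF assms less_imp_le[OF C] less_imp_le[OF \<alpha>(1)] dsol_multiplier])
    ((assumption | intro continuous_intros sol_cont)+)

lemma dsol_norm:
  assumes "u0 \<in> Hs lam phi s" "0 \<le> s" "0 < t"
  shows "Hs_norm lam phi s (dsol u0 t) \<le> C / t powr \<alpha> * Hs_norm lam phi s u0"
proof -
  have "Hs_norm lam phi s (dsol u0 t) \<le> (C * t powr (- \<alpha>)) * Hs_norm lam phi s u0"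
    unfolding dsol_def
    by (rule multiplier(4)[OF assms(1,2) decay_const_nonneg dsol_multiplier[OF assms(3)]])
  then show ?thesis by (simp add: powr_minus divide_inverse)
qed

text \<open>The factor \<lambda> in the symbol is paid for by the smoother datum instead of by decay
  in t, so no negative power of t appears and continuity reaches t = 0.\<close>

lemma dsol_continuous_regular:
  assumes "u0 \<in> Hs lam phi (s + 1)" "0 \<le> s"
  shows "Hs_continuous_on lam phi s {0..T} (dsol u0)"
  unfolding dsol_def[abs_def]
proof (rule multiplier_continuous_uniform[OF assms, of C])
  show "lam n powr s * cmod (- \<i> * complex_of_real (lam n) * ml_sol \<alpha> (lam n) t) \<le> C * lam n powr (s + 1)"
    if "t \<in> {0..T}" for t n
    unfolding dsol_multiplier_norm by (rule sol_multiplier) (use that in simp)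
qed (use C in \<open>auto intro!: continuous_intros sol_cont\<close>)

lemma dsol_norm_regular:
  assumes "u0 \<in> Hs lam phi (s + 1)" "0 \<le> s" "0 \<le> t"
  shows "Hs_norm lam phi s (dsol u0 t) \<le> C * Hs_norm lam phi (s + 1) u0"
  unfolding dsol_def
proof (rule multiplier(4)[OF assms(1,2) less_imp_le[OF C]])
  show "lam n powr s * cmod (- \<i> * complex_of_real (lam n) * ml_sol \<alpha> (lam n) t) \<le> C * lam n powr (s + 1)" for n
    unfolding dsol_multiplier_norm by (rule sol_multiplier[OF assms(3)])
qed

text \<open>Both norms lead to the same symbol \<lambda>^(s+1) |y|, as the derivative contributes
  one factor \<lambda>. The constant in B is C times the L^2(0,T) norm of t^(-\<alpha>/2).\<close>

lemma L2_estimates: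
  assumes u0: "u0 \<in> Hs lam phi (s + 1/2)" and s: "0 \<le> s" and T: "0 < T"
  defines "B \<equiv> C * sqrt (T powr (1 - \<alpha>) / (1 - \<alpha>)) * Hs_norm lam phi (s + 1/2) u0"
  shows "Hs_L2 lam phi (s + 1) T (sol u0)" "Hs_L2_norm lam phi (s + 1) T (sol u0) \<le> B"
    and "Hs_L2 lam phi s T (caputo_derivative \<alpha> (sol u0))" "Hs_L2_norm lam phi s T (caputo_derivative \<alpha> (sol u0)) \<le> B"
proof -
  define K where "K = C * Hs_norm lam phi (s + 1/2) u0"
  have K: "0 \<le> K" using C Hs_norm_nonneg[OF u0] by (simp add: K_def)
  have B: "B = K * sqrt (T powr (1 - \<alpha>) / (1 - \<alpha>))" by (simp add: B_def K_def)
  have s1: "0 \<le> s + 1" using s by simp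
  have a2: "0 \<le> \<alpha> / 2" using \<alpha> by simp
  have C0: "0 \<le> C" using C by simp
  have e: "- (\<alpha> / 2) = - \<alpha> / 2" by simp
  have Ce: "0 \<le> C * t powr (- (\<alpha> / 2))" for t using C by simp
  have m1: "lam n powr (s + 1) * cmod (ml_sol \<alpha> (lam n) t) \<le> (C * t powr (- (\<alpha> / 2))) * lam n powr (s + 1/2)"
    if "0 < t" for t n by (rule half_decay_multiplier[OF that])
  have m2: "lam n powr s * cmod (- \<i> * complex_of_real (lam n) * ml_sol \<alpha> (lam n) t) \<le> (C * t powr (- (\<alpha> / 2))) * lam n powr (s + 1/2)"
    if "0 < t" for t n unfolding dsol_multiplier_norm by (rule half_decay_multiplier[OF that])
  have c2: "continuous_on {0<..} (\<lambda>t. - \<i> * complex_of_real (lam n) * ml_sol \<alpha> (lam n) t)" for n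
    by (intro continuous_intros sol_cont)
  have b1: "Hs_norm lam phi (s + 1) (sol u0 t) \<le> K * t powr (- \<alpha> / 2)" if "0 < t" for t
    using multiplier(4)[OF u0 s1 Ce m1[OF that]] unfolding sol_def K_def e by (simp add: mult_ac)
  have b2: "Hs_norm lam phi s (dsol u0 t) \<le> K * t powr (- \<alpha> / 2)" if "0 < t" for t
    using multiplier(4)[OF u0 s Ce m2[OF that]] unfolding dsol_def K_def e by (simp add: mult_ac)
  have h1: "Hs_continuous_on lam phi (s + 1) {0<..} (sol u0)"
      "continuous_on {0<..} (\<lambda>t. Hs_norm lam phi (s + 1) (sol u0 t))"
    unfolding sol_def[abs_def] by (rule multiplier_continuous_pos[OF u0 s1 C0 a2 m1 sol_cont(1)]; assumption)+
  have h2: "Hs_continuous_on lam phi s {0<..} (dsol u0)"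
      "continuous_on {0<..} (\<lambda>t. Hs_norm lam phi s (dsol u0 t))"
    unfolding dsol_def[abs_def] by (rule multiplier_continuous_pos[OF u0 s C0 a2 m2 c2]; assumption)+
  have eq: "caputo_derivative \<alpha> (sol u0) t = dsol u0 t" if "t \<in> {0<..}" for t
    using that by (simp add: caputo_derivative_sol)
  have h2': "Hs_continuous_on lam phi s {0<..} (caputo_derivative \<alpha> (sol u0))"
    by (rule iffD2[OF Hs_continuous_on_cong[OF eq] h2(1)])
  have h3': "continuous_on {0<..} (\<lambda>t. Hs_norm lam phi s (caputo_derivative \<alpha> (sol u0) t))"
    using h2(2) by (rule continuous_on_eq) (simp add: eq)
  have b2': "Hs_norm lam phi s (caputo_derivative \<alpha> (sol u0) t) \<le> K * t powr (- \<alpha> / 2)" if "0 < t" for t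
    using b2[OF that] eq[of t] that by simp
  show "Hs_L2 lam phi (s + 1) T (sol u0)" "Hs_L2_norm lam phi (s + 1) T (sol u0) \<le> B"
    unfolding B by (rule Hs_L2_of_continuous[OF h1 _ \<alpha>(2) K T], rule b1, assumption)+
  show "Hs_L2 lam phi s T (caputo_derivative \<alpha> (sol u0))" "Hs_L2_norm lam phi s T (caputo_derivative \<alpha> (sol u0)) \<le> B"
    unfolding B by (rule Hs_L2_of_continuous[OF h2' h3' _ \<alpha>(2) K T], rule b2', assumption)+
qed

section \<open>The equation in H and uniqueness of weak solutions\<close>

lemma self_adjoint_cinner:
  assumes "self_adjoint_operator D A" "x \<in> D" "y \<in> D"
  shows "cinner (A x) y = cinner x (A y)"
  using assms unfolding self_adjoint_operator_def by blast

text \<open>The adjoint decides membership in D. With z = -i times \<open>dsol u0 t\<close>,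
  Parseval's identity gives <A x, u(t)> = <x, z> for all x in D, because the two coefficient series
  agree term by term; self-adjointness then yields u(t) in D and A u(t) = z, without a description
  of D by coefficients.\<close>

lemma sol_in_domain:
  assumes sa: "self_adjoint_operator D A" and eb: "neg_eigenbasis D A lam phi" and t: "0 < t"
  shows "sol u0 t \<in> D \<and> \<i> *\<^sub>C dsol u0 t + A (sol u0 t) = 0"
proof -
  define z where "z = - (\<i> *\<^sub>C dsol u0 t)"
  have phiD: "phi n \<in> D" "A (phi n) = complex_of_real (- lam n) *\<^sub>C phi n" for n
  proof -
    have "phi n \<in> D" "- A (phi n) = complex_of_real (lam n) *\<^sub>C phi n"
      using eb unfolding neg_eigenbasis_def by auto
    moreover from this(2) have "A (phi n) = - (complex_of_real (lam n) *\<^sub>C phi n)"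
      by (metis minus_minus)
    ultimately show "phi n \<in> D" "A (phi n) = complex_of_real (- lam n) *\<^sub>C phi n"
      by (simp_all add: complex_vector.scale_minus_left)
  qed
  have zc: "cinner z (phi n) = - complex_of_real (lam n) * cinner (sol u0 t) (phi n)" for n
  proof -
    have ii: "\<i> * (\<i> * x) = - x" for x :: complex by (simp flip: mult.assoc)
    show ?thesis
      using t by (simp add: z_def cinner_minus_left cinner_scaleC_left dsol_coeff sol_coeff mult_ac ii)
  qed
  have "cinner (A x) (sol u0 t) = cinner x z" if x: "x \<in> D" for x
  proof -
    have "cinner (A x) (phi n) = - complex_of_real (lam n) * cinner x (phi n)" for n
      using self_adjoint_cinner[OF sa x phiD(1)[of n]] unfolding phiD(2) cinner_scaleC_right by simp
    then have e: "(\<lambda>n. cinner (A x) (phi n) * cnj (cinner (sol u0 t) (phi n))) = (\<lambda>n. cinner x (phi n) * cnj (cinner z (phi n)))"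
      by (simp add: zc mult_ac)
    show ?thesis by (rule sums_unique2[OF cinner_sums[of "A x" "sol u0 t", unfolded e] cinner_sums[of x z]])
  qed
  then have "sol u0 t \<in> D \<and> z = A (sol u0 t)"
    using sa unfolding self_adjoint_operator_def by blast
  then show ?thesis by (auto simp: z_def add_eq_0_iff)
qed

text \<open>For a competitor v, symmetry moves A from v(t) onto the eigenvector, so A is never
  applied to the expansion of v term by term. Scalar uniqueness then fixes every
  coefficient.\<close>

lemma sol_unique_weak_solution:
  assumes sa: "self_adjoint_operator D A" and eb: "neg_eigenbasis D A lam phi" and T: "0 < T"
  shows "unique_weak_solution D A \<alpha> T u0 (sol u0)"
proof -
  have cont: "continuous_on {0..T} (sol u0)"
    using sol_continuous[OF Hs_0 order_refl] by (simp add: Hs_continuous_on_0)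
  have limit: "((\<lambda>t. norm (v t - v 0)) \<longlongrightarrow> 0) (at_right 0)" if "continuous_on {0..T} v" for v :: "real \<Rightarrow> 'a"
  proof -
    have "(v \<longlongrightarrow> v 0) (at 0 within {0..T})" using that T by (simp add: continuous_on_def)
    then have "(v \<longlongrightarrow> v 0) (at_right 0)" using T by (simp add: at_within_Icc_at_right)
    then show ?thesis by (simp add: tendsto_norm_zero_iff LIM_zero_iff)
  qed
  have "weak_solution D A \<alpha> T u0 (sol u0)"
    unfolding weak_solution_def
  proof (intro conjI cont)
    show "AE t in lebesgue_on {0<..<T}. caputo_differentiable \<alpha> (sol u0) t \<and> sol u0 t \<in> D \<and>
        \<i> *\<^sub>C caputo_derivative \<alpha> (sol u0) t + A (sol u0 t) = 0"
    proof (rule AE_I2)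
      fix t assume "t \<in> space (lebesgue_on {0<..<T})"
      then have t: "0 < t" by simp
      show "caputo_differentiable \<alpha> (sol u0) t \<and> sol u0 t \<in> D \<and>
        \<i> *\<^sub>C caputo_derivative \<alpha> (sol u0) t + A (sol u0 t) = 0"
        using sol_in_domain[OF sa eb t] sol_has_caputo_derivative[OF t]
        by (auto simp: caputo_derivative_sol[OF t] caputo_differentiable_def)
    qed
    show "((\<lambda>t. norm (sol u0 t - u0)) \<longlongrightarrow> 0) (at_right 0)"
      using limit[OF cont] by (simp add: sol_0)
  qed
  moreover have "v t = sol u0 t" if v: "weak_solution D A \<alpha> T u0 v" and t: "t \<in> {0..T}" for v t
  proof (rule eqI_coeff)
    fix n
    have vc: "continuous_on {0..T} v"
      and ae: "AE t in lebesgue_on {0<..<T}. caputo_differentiable \<alpha> v t \<and> v t \<in> D \<and> \<i> *\<^sub>C caputo_derivative \<alpha> v t + A (v t) = 0"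
      and v0: "((\<lambda>t. norm (v t - u0)) \<longlongrightarrow> 0) (at_right 0)"
      using v unfolding weak_solution_def by auto
    \<comment> \<open>The initial condition speaks of a limit only; continuity on the closed
      interval identifies it with the value v(0) that occurs in the scalar statement.\<close>
    have lims: "(v \<longlongrightarrow> u0) (at_right 0)" "(v \<longlongrightarrow> v 0) (at_right 0)"
      using v0 limit[OF vc] by (simp_all add: tendsto_norm_zero_iff LIM_zero_iff)
    have v0: "v 0 = u0" by (rule tendsto_unique[OF trivial_limit_at_right_real lims(2,1)])
    have phiD: "phi n \<in> D" "- A (phi n) = complex_of_real (lam n) *\<^sub>C phi n"
      using eb unfolding neg_eigenbasis_def by auto
    have "cinner (v t) (phi n) = cinner (v 0) (phi n) * ml_sol \<alpha> (lam n) t"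
    proof (rule caputo_scalar_unique[OF \<alpha> _ _ T t])
      show "continuous_on {0..T} (\<lambda>t. cinner (v t) (phi n))"
        by (rule bounded_linear.continuous_on[OF bounded_linear_cinner_left vc])
      show "AE t in lebesgue_on {0<..<T}. has_caputo_derivative \<alpha> (\<lambda>t. cinner (v t) (phi n))
          ((- \<i> * complex_of_real (lam n)) * cinner (v t) (phi n)) t"
        using ae
      proof eventually_elim
        case (elim t)
        then obtain d where d: "has_caputo_derivative \<alpha> v d t" and vD: "v t \<in> D"
          and eq: "\<i> *\<^sub>C caputo_derivative \<alpha> v t + A (v t) = 0"
          unfolding caputo_differentiable_def by blast
        have "\<i> *\<^sub>C d = - A (v t)"
          using eq unfolding caputo_derivative_eq[OF d \<alpha>(2)] by (simp add: eq_neg_iff_add_eq_0)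
        then have "\<i> * cinner d (phi n) = - cinner (A (v t)) (phi n)"
          by (metis cinner_scaleC_left cinner_minus_left)
        also have "\<dots> = cinner (v t) (- A (phi n))"
          using self_adjoint_cinner[OF sa vD phiD(1)]
          by (metis cinner_commute cinner_minus_left complex_cnj_minus)
        also have "\<dots> = complex_of_real (lam n) * cinner (v t) (phi n)"
          unfolding phiD(2) by (simp add: cinner_scaleC_right)
        finally have "\<i> * (\<i> * cinner d (phi n)) = \<i> * (complex_of_real (lam n) * cinner (v t) (phi n))" by simp
        then have "cinner d (phi n) = (- \<i> * complex_of_real (lam n)) * cinner (v t) (phi n)"
          by (simp add: mult.assoc[symmetric]) (simp add: minus_equation_iff[of "cinner d (phi n)"])
        then show ?case using has_caputo_derivative_cinner[OF d, of "phi n"] by simp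
      qed
    qed
    then show "cinner (v t) (phi n) = cinner (sol u0 t) (phi n)"
      using t v0 by (simp add: sol_coeff)
  qed
  ultimately show ?thesis unfolding unique_weak_solution_def by blast
qed

end

theorem theorem3p3:
  fixes A :: "'a::chilbert_space \<Rightarrow> 'a" and D :: "'a set"
    and lam :: "nat \<Rightarrow> real" and phi :: "nat \<Rightarrow> 'a"
    and \<alpha> s T :: real
  assumes "self_adjoint_operator D A"
    and "negative_definite_operator D A"
    and "compact_resolvent D A"
    and "neg_eigenbasis D A lam phi"
    and "0 < \<alpha>" and "\<alpha> < 1" and "0 \<le> s" and "0 < T"
  shows
    "(\<exists>C>0. \<forall>u0\<in>Hs lam phi s. \<exists>u.
        unique_weak_solution D A \<alpha> T u0 u \<and>
        Hs_continuous_on lam phi s {0..T} u \<and>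
        (\<forall>t\<in>{0<..T}. caputo_differentiable \<alpha> u t) \<and>
        Hs_continuous_on lam phi s {0<..T} (caputo_derivative \<alpha> u) \<and>
        Hs_sup_norm lam phi s T u \<le> C * Hs_norm lam phi s u0 \<and>
        (\<forall>t\<in>{0<..T}. Hs_norm lam phi s (caputo_derivative \<alpha> u t)
                        \<le> C / t powr \<alpha> * Hs_norm lam phi s u0))
     \<and>
     (\<exists>C>0. \<forall>u0\<in>Hs lam phi (s + 1/2). \<exists>u.
        unique_weak_solution D A \<alpha> T u0 u \<and>
        Hs_L2 lam phi (s + 1) T u \<and>
        Hs_L2 lam phi s T (caputo_derivative \<alpha> u) \<and>
        Hs_L2_norm lam phi (s + 1) T u + Hs_L2_norm lam phi s T (caputo_derivative \<alpha> u)
          \<le> C * Hs_norm lam phi (s + 1/2) u0)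
     \<and>
     (\<exists>C>0. \<forall>u0\<in>Hs lam phi (s + 1). \<exists>u v.
        unique_weak_solution D A \<alpha> T u0 u \<and>
        Hs_continuous_on lam phi (s + 1) {0..T} u \<and>
        (\<forall>t\<in>{0<..T}. caputo_differentiable \<alpha> u t \<and> v t = caputo_derivative \<alpha> u t) \<and>
        Hs_continuous_on lam phi s {0..T} v \<and>
        Hs_sup_norm lam phi (s + 1) T u + Hs_sup_norm lam phi s T v
          \<le> C * Hs_norm lam phi (s + 1) u0)
     \<and>
     (\<forall>u0. \<exists>u. unique_weak_solution D A \<alpha> T u0 u \<and>
        (\<forall>t\<in>{0..T}.
           (\<lambda>n. (cinner u0 (phi n)
                   * mittag_leffler \<alpha> 1 (- \<i> * complex_of_real (lam n) * complex_of_real (t powr \<alpha>)))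
                 *\<^sub>C phi n) sums u t))"
proof -
  obtain C where C: "0 < C"
    "\<And>l t. 0 < l \<Longrightarrow> 0 \<le> t \<Longrightarrow> cmod (ml_sol \<alpha> l t) \<le> C"
    "\<And>l t. 0 < l \<Longrightarrow> 0 < t \<Longrightarrow> cmod (ml_sol_deriv \<alpha> l t) \<le> C / t"
    "\<And>l r t. 0 < l \<Longrightarrow> 0 < t \<Longrightarrow> 0 \<le> r \<Longrightarrow> r \<le> t \<Longrightarrow>
        cmod (integral {0..r} (\<lambda>s. (t - s) powr (- \<alpha>) *\<^sub>R ml_sol_deriv \<alpha> l s)) \<le> C * t powr (- \<alpha>)"
    "\<And>l t. 0 < l \<Longrightarrow> 0 < t \<Longrightarrow> l * cmod (ml_sol \<alpha> l t) \<le> C * t powr (- \<alpha>)"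
    using ml_sol_estimates[OF assms(5,6)] by blast
  interpret fractional_evolution phi lam \<alpha> C
  proof
    show "cinner (phi m) (phi n) = (if m = n then 1 else 0)" for m n
      using assms(4) unfolding neg_eigenbasis_def by blast
    show "closure (cspan (range phi)) = UNIV" "0 < lam 0" "mono lam"
      using assms(4) unfolding neg_eigenbasis_def by blast+
    show "cmod (ml_sol \<alpha> l t) \<le> C" if "0 < l" "0 \<le> t" for l t by (rule C(2)[OF that])
    show "cmod (ml_sol_deriv \<alpha> l t) \<le> C / t" if "0 < l" "0 < t" for l t by (rule C(3)[OF that])
    show "cmod (integral {0..r} (\<lambda>s. (t - s) powr (- \<alpha>) *\<^sub>R ml_sol_deriv \<alpha> l s)) \<le> C * t powr (- \<alpha>)"
      if "0 < l" "0 < t" "0 \<le> r" "r \<le> t" for l r t by (rule C(4)[OF that])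
    show "l * cmod (ml_sol \<alpha> l t) \<le> C * t powr (- \<alpha>)" if "0 < l" "0 < t" for l t by (rule C(5)[OF that])
  qed (rule assms(5) assms(6) C(1))+
  note unique = sol_unique_weak_solution[OF assms(1,4,8)]
  note s = assms(7)
  have s1: "0 \<le> s + 1" using s by simp
  have sub: "{0<..T} \<subseteq> {0<..}" by auto
  have ne: "{0..T} \<noteq> {}" using assms(8) by simp
  have diff: "caputo_differentiable \<alpha> (sol u0) t" if "0 < t" for u0 t
    using sol_has_caputo_derivative[OF that] unfolding caputo_differentiable_def by blast
  have sup: "Hs_sup_norm lam phi r T f \<le> B" if "\<And>t. 0 \<le> t \<Longrightarrow> Hs_norm lam phi r (f t) \<le> B" for r f B
    unfolding Hs_sup_norm_def by (rule cSUP_least[OF ne]) (use that in simp)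
  have "\<exists>u. unique_weak_solution D A \<alpha> T u0 u \<and>
        Hs_continuous_on lam phi s {0..T} u \<and>
        (\<forall>t\<in>{0<..T}. caputo_differentiable \<alpha> u t) \<and>
        Hs_continuous_on lam phi s {0<..T} (caputo_derivative \<alpha> u) \<and>
        Hs_sup_norm lam phi s T u \<le> C * Hs_norm lam phi s u0 \<and>
        (\<forall>t\<in>{0<..T}. Hs_norm lam phi s (caputo_derivative \<alpha> u t)
                        \<le> C / t powr \<alpha> * Hs_norm lam phi s u0)" if u0: "u0 \<in> Hs lam phi s" for u0
  proof (intro exI[of _ "sol u0"] conjI ballI unique sol_continuous[OF u0 s] sup sol_norm[OF u0 s])
    have "Hs_continuous_on lam phi s {0<..T} (dsol u0)"
      by (rule Hs_continuous_on_subset[OF dsol_continuous_pos[OF u0 s] sub])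
    then show "Hs_continuous_on lam phi s {0<..T} (caputo_derivative \<alpha> (sol u0))"
      by (subst Hs_continuous_on_cong[where g = "dsol u0"]) (auto simp: caputo_derivative_sol)
    fix t assume "t \<in> {0<..T}"
    then have t: "0 < t" by simp
    show "caputo_differentiable \<alpha> (sol u0) t" by (rule diff[OF t])
    show "Hs_norm lam phi s (caputo_derivative \<alpha> (sol u0) t) \<le> C / t powr \<alpha> * Hs_norm lam phi s u0"
      unfolding caputo_derivative_sol[OF t] by (rule dsol_norm[OF u0 s t])
  qed
  \<comment> \<open>The factor 2 accounts for the two norms, each bounded by the same B.\<close>
  moreover have "\<exists>u. unique_weak_solution D A \<alpha> T u0 u \<and>
        Hs_L2 lam phi (s + 1) T u \<and>
        Hs_L2 lam phi s T (caputo_derivative \<alpha> u) \<and>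
        Hs_L2_norm lam phi (s + 1) T u + Hs_L2_norm lam phi s T (caputo_derivative \<alpha> u)
          \<le> (2 * C * sqrt (T powr (1 - \<alpha>) / (1 - \<alpha>))) * Hs_norm lam phi (s + 1/2) u0"
    if u0: "u0 \<in> Hs lam phi (s + 1/2)" for u0
    using L2_estimates[OF u0 s assms(8)] by (intro exI[of _ "sol u0"] conjI unique) auto
  moreover have "0 < 2 * C * sqrt (T powr (1 - \<alpha>) / (1 - \<alpha>))"
    using C(1) assms(6,8) by simp
  moreover have "\<exists>u v. unique_weak_solution D A \<alpha> T u0 u \<and>
        Hs_continuous_on lam phi (s + 1) {0..T} u \<and>
        (\<forall>t\<in>{0<..T}. caputo_differentiable \<alpha> u t \<and> v t = caputo_derivative \<alpha> u t) \<and>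
        Hs_continuous_on lam phi s {0..T} v \<and>
        Hs_sup_norm lam phi (s + 1) T u + Hs_sup_norm lam phi s T v
          \<le> (2 * C) * Hs_norm lam phi (s + 1) u0" if u0: "u0 \<in> Hs lam phi (s + 1)" for u0
  \<comment> \<open>The witness for v is \<open>dsol u0\<close>, which is also meaningful at t = 0,
    where no Caputo derivative is defined.\<close>
  proof (rule exI[of _ "sol u0"], rule exI[of _ "dsol u0"], intro conjI ballI unique sol_continuous[OF u0 s1] dsol_continuous_regular[OF u0 s])
    show "caputo_differentiable \<alpha> (sol u0) t" if "t \<in> {0<..T}" for t
      using that by (intro diff) simp
    show "dsol u0 t = caputo_derivative \<alpha> (sol u0) t" if "t \<in> {0<..T}" for t
      using that by (simp add: caputo_derivative_sol)
    show "Hs_sup_norm lam phi (s + 1) T (sol u0) + Hs_sup_norm lam phi s T (dsol u0) \<le> (2 * C) * Hs_norm lam phi (s + 1) u0"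
    proof -
      have "Hs_sup_norm lam phi (s + 1) T (sol u0) \<le> C * Hs_norm lam phi (s + 1) u0"
        by (rule sup[OF sol_norm[OF u0 s1]])
      moreover have "Hs_sup_norm lam phi s T (dsol u0) \<le> C * Hs_norm lam phi (s + 1) u0"
        by (rule sup[OF dsol_norm_regular[OF u0 s]])
      ultimately show ?thesis by linarith
    qed
  qed
  moreover have "\<exists>u. unique_weak_solution D A \<alpha> T u0 u \<and>
        (\<forall>t\<in>{0..T}.
           (\<lambda>n. (cinner u0 (phi n)
                   * mittag_leffler \<alpha> 1 (- \<i> * complex_of_real (lam n) * complex_of_real (t powr \<alpha>)))
                 *\<^sub>C phi n) sums u t)" for u0
    using unique sol_sums[of _ u0] unfolding ml_sol_eq_mittag_leffler
    by (intro exI[of _ "sol u0"] conjI ballI) auto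
  ultimately show ?thesis
    using C(1) by (intro conjI exI[of _ C] exI[of _ "2 * C * sqrt (T powr (1 - \<alpha>) / (1 - \<alpha>))"] exI[of _ "2 * C"] ballI allI) auto
qed

end
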